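(* Let $(M,g,J)$ be a Hermitian manifold. For any $\theta\in\Gamma(M,\Omega^{1,0}(\mathrm{End}(T^{1,0}M)))$, with associated connections $\nabla^\theta$ preserving $g$ and $J$ on $T_{\mathbb R}M$ and $\hat\nabla^\theta$ on $T^{1,0}M$, the curvature tensors $R^\theta$ of $\nabla^\theta$ and $\mathfrak R^\theta$ of $\hat\nabla^\theta$ are determined by $$R^\theta_{i\bar jk\bar\ell}=\mathfrak R^\theta_{i\bar jk\bar\ell}=\Theta_{i\bar jk\bar\ell}-\left(h_{k\bar p}\frac{\partial\overline{\theta_{j\ell}^p}}{\partial z^i}+h_{p\bar\ell}\frac{\partial\theta_{ik}^p}{\partial\bar z^j}\right)+\left(\theta_{ik}^p\overline{\theta_{j\ell}^q}h_{p\bar q}-h^{m\bar n}\theta_{im}^p\overline{\theta_{jn}^q}h_{p\bar\ell}h_{k\bar q}\right),$$ $$R^\theta_{ijk\bar\ell}=\mathfrak R^\theta_{ijk\bar\ell}=\left(\frac{\partial\theta_{jk}^m}{\partial z^i}-\frac{\partial\theta_{ik}^m}{\partial z^j}+\Gamma_{jk}^s\theta_{is}^m-\Gamma_{js}^m\theta_{ik}^s+\Gamma_{is}^m\theta_{jk}^s-\Gamma_{ik}^s\theta_{js}^m\right)h_{m\bar\ell}+\left(\theta_{ip}^m\theta_{jk}^p-\theta_{ik}^p\theta_{jp}^m\right)h_{m\bar\ell}.$$ Moreover, $[\mathfrak{Ric}^{(1)}(\theta)]=[\Theta^{(1)}]\in H^{1,1}_{\mathrm{AC}}(M,\mathbb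 R)$ and $$\mathfrak{Ric}^{(1)}(\theta)=\Theta^{(1)}-\sqrt{-1}\,(\partial\overline{\theta_1}-\bar\partial\theta_1),\qquad \theta_1=\theta_{ik}^k\,dz^i.$$
   Context: $(M,g,J)$: a Riemannian manifold with an integrable complex structure $J$ with $g(JX,JY)=g(X,Y)$. $T_{\mathbb C}M=T_{\mathbb R}M\otimes\mathbb C=T^{1,0}M\oplus T^{0,1}M$. The metric $g$ and real connections are extended $\mathbb C$-linearly to $T_{\mathbb C}M$, and $h(X,Y)=g(X,Y)$ for $X,Y\in T_{\mathbb C}M$. In local holomorphic coordinates $\{z^i\}$, $h_{i\bar j}=h(\frac{\partial}{\partial z^i},\frac{\partial}{\partial\bar z^j})$ and $(h^{i\bar j})$ is the inverse matrix, $h^{i\bar\ell}h_{j\bar\ell}=\delta^i_j$; repeated indices are summed. $\Gamma_{ij}^k=h^{k\bar\ell}\frac{\partial h_{j\bar\ell}}{\partial z^i}$ are the Christoffel symbols of the Chern connection on $(T^{1,0}M,h)$. Its curvature is $\Theta_{i\bar jk\bar\ell}=-\frac{\partial^2h_{k\bar\ell}}{\partial z^i\partial\bar z^j}+h^{p\bar q}\frac{\partial h_{p\bar\ell}}{\partial\bar z^j}\frac{\partial h_{k\bar q}}{\partial z^i}$, and $\Theta^{(1)}=\sqrt{-1}\,h^{k\bar\ell}\Theta_{i\bar jk\bar\ell}\,dz^i\wedge d\bar z^j$. Write $\theta=\theta_{ij}^k\,dz^i\otimes dz^j\otimes\frac{\partial}{\partial z^k}$. The connection $\nabla^\theta$ is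 the real connection on $T_{\mathbb R}M$ (preserving $g$ and $J$) whose complexification is given by $$\nabla^\theta_{\frac{\partial}{\partial z^i}}\frac{\partial}{\partial z^j}=(\Gamma_{ij}^k+\theta_{ij}^k)\frac{\partial}{\partial z^k},\qquad \nabla^\theta_{\frac{\partial}{\partial\bar z^i}}\frac{\partial}{\partial z^j}=-h_{j\bar q}h^{k\bar p}\overline{\theta_{ip}^q}\frac{\partial}{\partial z^k}$$ and the complex conjugates of these. Every real connection on $T_{\mathbb R}M$ preserving $g$ and $J$ is of the form $\nabla^\theta$ for a unique $\theta$. $\hat\nabla^\theta$ is the restriction of the complexification of $\nabla^\theta$ to $T^{1,0}M$. Curvatures: $R^\theta(X,Y,Z,W)=h(\nabla^\theta_X\nabla^\theta_YZ-\nabla^\theta_Y\nabla^\theta_XZ-\nabla^\theta_{[X,Y]}Z,W)$ for $X,Y,Z,W\in T_{\mathbb C}M$; $\mathfrak R^\theta$ is defined by the same formula with $\hat\nabla^\theta$, for $X,Y\in T_{\mathbb C}M$, $Z\in T^{1,0}M$, $W\in T^{0,1}M$. Components: $R^\theta_{i\bar jk\bar\ell}=R^\theta(\frac{\partial}{\partial z^i},\frac{\partial}{\partial\bar z^j},\frac{\partial}{\partial z^k},\frac{\partial}{\partial\bar z^\ell})$, $R^\theta_{ijk\bar\ell}=R^\theta(\frac{\partial}{\partial z^i},\frac{\partial}{\partial z^j},\frac{\partial}{\partial z^k},\frac{\partial}{\partial\bar z^\ell})$, and similarly for $\mathfrak R^\theta$. $\mathfrak{Ric}^{(1)}(\theta)=\sqrt{-1}\,(h^{k\bar\ell}\mathfrak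 R^\theta_{i\bar jk\bar\ell})\,dz^i\wedge d\bar z^j$. $H^{1,1}_{\mathrm{AC}}(M,\mathbb R)$ is the real Aeppli cohomology: real $\partial\bar\partial$-closed $(1,1)$-forms modulo real $(1,1)$-forms of the shape $\partial\alpha+\bar\partial\beta$ with $\alpha\in\Omega^{0,1}(M)$, $\beta\in\Omega^{1,0}(M)$. *)

theory Defs
  imports "HOL-Analysis.Analysis" "HOL-Library.Function_Algebras"
begin

text \<open>
  Geometric objects on a complex manifold are families of local expressions, indexed by the charts
  of a holomorphic atlas and obeying the usual transformation laws. A chart is a pair of its
  domain and its coordinate map. Only values at charts of the atlas and at points of their domains
  (and, for sections over an open set, at points of that set) are meaningful, and all conditions
  below are restricted to those. The atlas is not required to be maximal; for a maximal atlas its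
  elements are all the local holomorphic coordinate systems.

  The real tangent space at a point is represented, in each chart, by \<open>complex ^ 'n\<close> regarded as a
  real vector space. Its complexification consists of pairs: \<open>(V, W)\<close> stands for
  $V + \sqrt{-1}\, W$ with $V$ and $W$ real.
\<close>

type_synonym ('m, 'n) chart = "'m set \<times> ('m \<Rightarrow> complex ^ 'n)"
type_synonym ('m, 'n) vfield = "('m, 'n) chart \<Rightarrow> 'm \<Rightarrow> complex ^ 'n"
type_synonym ('m, 'n) cvfield = "('m, 'n) vfield \<times> ('m, 'n) vfield"
type_synonym ('m, 'n) metric = "('m, 'n) chart \<Rightarrow> 'm \<Rightarrow> complex ^ 'n \<Rightarrow> complex ^ 'n \<Rightarrow> real"
type_synonym ('m, 'n) tensor12 = "('m, 'n) chart \<Rightarrow> 'n \<Rightarrow> 'n \<Rightarrow> 'n \<Rightarrow> 'm \<Rightarrow> complex"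
type_synonym ('m, 'n) connection = "('m, 'n) vfield \<Rightarrow> ('m, 'n) vfield \<Rightarrow> ('m, 'n) vfield"
type_synonym ('m, 'n) cconnection = "('m, 'n) cvfield \<Rightarrow> ('m, 'n) cvfield \<Rightarrow> ('m, 'n) cvfield"
type_synonym ('m, 'n) form = "('m, 'n) chart \<Rightarrow> 'n list \<Rightarrow> 'n list \<Rightarrow> 'm \<Rightarrow> complex"

section \<open>Smoothness and complex manifolds\<close>

text \<open>Intended for open \<open>S\<close> in a finite-dimensional space, where existence and continuity of all
  iterated directional derivatives is $C^k$ regularity.\<close>

primrec Ck_on :: "nat \<Rightarrow> 'a::real_normed_vector set \<Rightarrow> ('a \<Rightarrow> 'b::real_normed_vector) \<Rightarrow> bool" where
  "Ck_on 0 S f \<longleftrightarrow> continuous_on S f"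
| "Ck_on (Suc k) S f \<longleftrightarrow>
     (\<forall>x\<in>S. f differentiable (at x)) \<and> (\<forall>v. Ck_on k S (\<lambda>x. frechet_derivative f (at x) v))"

definition smooth_on :: "'a::real_normed_vector set \<Rightarrow> ('a \<Rightarrow> 'b::real_normed_vector) \<Rightarrow> bool" where
  "smooth_on S f \<longleftrightarrow> (\<forall>k. Ck_on k S f)"

definition local_rep :: "('m, 'n::finite) chart \<Rightarrow> ('m \<Rightarrow> 'b) \<Rightarrow> complex ^ 'n \<Rightarrow> 'b" where
  "local_rep c f = f \<circ> inv_into (fst c) (snd c)"

definition chart_smooth_on ::
  "('m, 'n::finite) chart \<Rightarrow> 'm set \<Rightarrow> ('m \<Rightarrow> 'b::real_normed_vector) \<Rightarrow> bool" where
  "chart_smooth_on c W f \<longleftrightarrow> smooth_on (snd c ` (fst c \<inter> W)) (local_rep c f)"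

text \<open>Derivative of \<open>f\<close> at \<open>x\<close> along the real tangent vector with coordinate expression \<open>v\<close> in the
  chart \<open>c\<close>. In particular \<open>chart_deriv c (snd d) x\<close> is the differential of the coordinate change
  from \<open>c\<close> to \<open>d\<close>.\<close>

definition chart_deriv ::
  "('m, 'n::finite) chart \<Rightarrow> ('m \<Rightarrow> 'b::real_normed_vector) \<Rightarrow> 'm \<Rightarrow> complex ^ 'n \<Rightarrow> 'b" where
  "chart_deriv c f x v = frechet_derivative (local_rep c f) (at (snd c x)) v"

text \<open>Coordinate changes are holomorphic: smooth, with complex linear differential.\<close>

definition complex_atlas :: "('m::{t2_space, second_countable_topology}, 'n::finite) chart set \<Rightarrow> bool" where
  "complex_atlas A \<longleftrightarrow>
     (\<Union>c\<in>A. fst c) = UNIV \<and>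
     (\<forall>c\<in>A. open (fst c) \<and> open (snd c ` fst c) \<and>
        homeomorphism (fst c) (snd c ` fst c) (snd c) (inv_into (fst c) (snd c))) \<and>
     (\<forall>c\<in>A. \<forall>d\<in>A. chart_smooth_on c (fst d) (snd d) \<and>
        (\<forall>x\<in>fst c \<inter> fst d. \<forall>v. chart_deriv c (snd d) x (\<i> *s v) = \<i> *s chart_deriv c (snd d) x v))"

definition smooth_fun_on ::
  "('m::topological_space, 'n::finite) chart set \<Rightarrow> 'm set \<Rightarrow> ('m \<Rightarrow> real) \<Rightarrow> bool" where
  "smooth_fun_on A W f \<longleftrightarrow> (\<forall>c\<in>A. chart_smooth_on c W f)"

section \<open>Vector fields\<close>

definition vfield_on ::
  "('m::topological_space, 'n::finite) chart set \<Rightarrow> 'm set \<Rightarrow> ('m, 'n) vfield \<Rightarrow> bool" where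
  "vfield_on A W X \<longleftrightarrow>
     (\<forall>c\<in>A. chart_smooth_on c W (X c)) \<and>
     (\<forall>c\<in>A. \<forall>d\<in>A. \<forall>x\<in>fst c \<inter> fst d \<inter> W. X d x = chart_deriv c (snd d) x (X c x))"

definition vf_eq_on ::
  "('m, 'n) chart set \<Rightarrow> 'm set \<Rightarrow> ('m, 'n) vfield \<Rightarrow> ('m, 'n) vfield \<Rightarrow> bool" where
  "vf_eq_on A W X Y \<longleftrightarrow> (\<forall>c\<in>A. \<forall>x\<in>fst c \<inter> W. X c x = Y c x)"

definition vf_scale :: "('m \<Rightarrow> real) \<Rightarrow> ('m, 'n::finite) vfield \<Rightarrow> ('m, 'n) vfield" where
  "vf_scale f X = (\<lambda>c x. f x *\<^sub>R X c x)"

text \<open>The complex structure $J$ of the manifold.\<close>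

definition vf_J :: "('m, 'n::finite) vfield \<Rightarrow> ('m, 'n) vfield" where
  "vf_J X = (\<lambda>c x. \<i> *s X c x)"

definition lie_bracket :: "('m, 'n::finite) vfield \<Rightarrow> ('m, 'n) vfield \<Rightarrow> ('m, 'n) vfield" where
  "lie_bracket X Y = (\<lambda>c x. chart_deriv c (Y c) x (X c x) - chart_deriv c (X c) x (Y c x))"

section \<open>Complexification\<close>

definition cvfield_on ::
  "('m::topological_space, 'n::finite) chart set \<Rightarrow> 'm set \<Rightarrow> ('m, 'n) cvfield \<Rightarrow> bool" where
  "cvfield_on A W Z \<longleftrightarrow> vfield_on A W (fst Z) \<and> vfield_on A W (snd Z)"

definition cvf_eq_on ::
  "('m, 'n) chart set \<Rightarrow> 'm set \<Rightarrow> ('m, 'n) cvfield \<Rightarrow> ('m, 'n) cvfield \<Rightarrow> bool" where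
  "cvf_eq_on A W X Y \<longleftrightarrow> vf_eq_on A W (fst X) (fst Y) \<and> vf_eq_on A W (snd X) (snd Y)"

definition cvf_scale :: "('m \<Rightarrow> complex) \<Rightarrow> ('m, 'n::finite) cvfield \<Rightarrow> ('m, 'n) cvfield" where
  "cvf_scale f Z =
     (vf_scale (\<lambda>x. Re (f x)) (fst Z) - vf_scale (\<lambda>x. Im (f x)) (snd Z),
      vf_scale (\<lambda>x. Re (f x)) (snd Z) + vf_scale (\<lambda>x. Im (f x)) (fst Z))"

text \<open>Complex bilinear extension of a real bilinear operation on vector fields; it is used both for
  connections and for the Lie bracket.\<close>

definition complexify :: "('m, 'n::finite) connection \<Rightarrow> ('m, 'n) cconnection" where
  "complexify B X Y =
     (B (fst X) (fst Y) - B (snd X) (snd Y), B (fst X) (snd Y) + B (snd X) (fst Y))"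

definition metric_ext ::
  "('m, 'n::finite) metric \<Rightarrow> ('m, 'n) cvfield \<Rightarrow> ('m, 'n) cvfield \<Rightarrow> ('m, 'n) chart \<Rightarrow> 'm \<Rightarrow> complex" where
  "metric_ext g X Y c x =
     Complex (g c x (fst X c x) (fst Y c x) - g c x (snd X c x) (snd Y c x))
             (g c x (fst X c x) (snd Y c x) + g c x (snd X c x) (fst Y c x))"

text \<open>Sections over \<open>W\<close> of the $\sqrt{-1}$-eigenbundle $T^{1,0}M$ of $J$.\<close>

definition T10_sections ::
  "('m::topological_space, 'n::finite) chart set \<Rightarrow> 'm set \<Rightarrow> ('m, 'n) cvfield set" where
  "T10_sections A W =
     {Z. cvfield_on A W Z \<and> cvf_eq_on A W (vf_J (fst Z), vf_J (snd Z)) (cvf_scale (\<lambda>_. \<i>) Z)}"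

text \<open>The local field whose components in the coordinates \<open>c\<close> are constantly \<open>v\<close>.\<close>

definition coord_field :: "('m, 'n::finite) chart \<Rightarrow> complex ^ 'n \<Rightarrow> ('m, 'n) vfield" where
  "coord_field c v = (\<lambda>d x. chart_deriv c (snd d) x v)"

text \<open>$\partial/\partial z^i = \frac12(\partial/\partial x^i - \sqrt{-1}\,\partial/\partial y^i)$ and its
  conjugate, as complexified vector fields and as operators on functions; $\partial/\partial x^i$ and
  $\partial/\partial y^i$ are the coordinate vectors \<open>axis i 1\<close> and \<open>axis i \<i>\<close>.\<close>

definition d_z :: "('m, 'n::finite) chart \<Rightarrow> 'n \<Rightarrow> ('m, 'n) cvfield" where
  "d_z c i = (coord_field c ((1/2) *\<^sub>R axis i 1), coord_field c (- (1/2) *\<^sub>R axis i \<i>))"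

definition d_zbar :: "('m, 'n::finite) chart \<Rightarrow> 'n \<Rightarrow> ('m, 'n) cvfield" where
  "d_zbar c i = (coord_field c ((1/2) *\<^sub>R axis i 1), coord_field c ((1/2) *\<^sub>R axis i \<i>))"

definition D_z :: "('m, 'n::finite) chart \<Rightarrow> 'n \<Rightarrow> ('m \<Rightarrow> complex) \<Rightarrow> 'm \<Rightarrow> complex" where
  "D_z c i f x = (chart_deriv c f x (axis i 1) - \<i> * chart_deriv c f x (axis i \<i>)) / 2"

definition D_zbar :: "('m, 'n::finite) chart \<Rightarrow> 'n \<Rightarrow> ('m \<Rightarrow> complex) \<Rightarrow> 'm \<Rightarrow> complex" where
  "D_zbar c i f x = (chart_deriv c f x (axis i 1) + \<i> * chart_deriv c f x (axis i \<i>)) / 2"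

text \<open>$\partial w^k/\partial z^i$ for the coordinate change from \<open>c\<close> (coordinates $z$) to
  \<open>d\<close> (coordinates $w$).\<close>

definition jacobian :: "('m, 'n::finite) chart \<Rightarrow> ('m, 'n) chart \<Rightarrow> 'n \<Rightarrow> 'n \<Rightarrow> 'm \<Rightarrow> complex" where
  "jacobian c d k i x = D_z c i (\<lambda>y. snd d y $ k) x"

section \<open>Hermitian metrics and the Chern connection\<close>

definition riemannian_metric ::
  "('m::topological_space, 'n::finite) chart set \<Rightarrow> ('m, 'n) metric \<Rightarrow> bool" where
  "riemannian_metric A g \<longleftrightarrow>
     (\<forall>c\<in>A. \<forall>x\<in>fst c. bilinear (g c x) \<and> (\<forall>v w. g c x v w = g c x w v) \<and>
        (\<forall>v. v \<noteq> 0 \<longrightarrow> g c x v v > 0)) \<and>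
     (\<forall>c\<in>A. \<forall>v w. chart_smooth_on c UNIV (\<lambda>x. g c x v w)) \<and>
     (\<forall>c\<in>A. \<forall>d\<in>A. \<forall>x\<in>fst c \<inter> fst d. \<forall>v w.
        g d x (chart_deriv c (snd d) x v) (chart_deriv c (snd d) x w) = g c x v w)"

definition hermitian_manifold ::
  "('m::{t2_space, second_countable_topology}, 'n::finite) chart set \<Rightarrow> ('m, 'n) metric \<Rightarrow> bool" where
  "hermitian_manifold A g \<longleftrightarrow>
     complex_atlas A \<and> riemannian_metric A g \<and>
     (\<forall>c\<in>A. \<forall>x\<in>fst c. \<forall>v w. g c x (\<i> *s v) (\<i> *s w) = g c x v w)"

definition h_lo :: "('m, 'n::finite) metric \<Rightarrow> ('m, 'n) chart \<Rightarrow> 'n \<Rightarrow> 'n \<Rightarrow> 'm \<Rightarrow> complex" where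
  "h_lo g c i j x = metric_ext g (d_z c i) (d_zbar c j) c x"

text \<open>The transpose implements the convention $h^{i\bar\ell}h_{j\bar\ell} = \delta^i_j$.\<close>

definition h_up :: "('m, 'n::finite) metric \<Rightarrow> ('m, 'n) chart \<Rightarrow> 'n \<Rightarrow> 'n \<Rightarrow> 'm \<Rightarrow> complex" where
  "h_up g c i j x = matrix_inv (transpose (\<chi> a b. h_lo g c a b x)) $ i $ j"

text \<open>$\Gamma_{ij}^k$ is \<open>chern_Gamma g c i j k\<close>, and likewise the upper index of $\theta_{ij}^k$ comes
  last.\<close>

definition chern_Gamma ::
  "('m, 'n::finite) metric \<Rightarrow> ('m, 'n) chart \<Rightarrow> 'n \<Rightarrow> 'n \<Rightarrow> 'n \<Rightarrow> 'm \<Rightarrow> complex" where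
  "chern_Gamma g c i j k x = (\<Sum>l\<in>UNIV. h_up g c k l x * D_z c i (h_lo g c j l) x)"

definition chern_curv ::
  "('m, 'n::finite) metric \<Rightarrow> ('m, 'n) chart \<Rightarrow> 'n \<Rightarrow> 'n \<Rightarrow> 'n \<Rightarrow> 'n \<Rightarrow> 'm \<Rightarrow> complex" where
  "chern_curv g c i j k l x =
     - D_z c i (D_zbar c j (h_lo g c k l)) x
     + (\<Sum>p\<in>UNIV. \<Sum>q\<in>UNIV. h_up g c p q x * D_zbar c j (h_lo g c p l) x * D_z c i (h_lo g c k q) x)"

section \<open>Connections preserving the metric and the complex structure\<close>

text \<open>Smooth sections of $\Omega^{1,0}(\mathrm{End}(T^{1,0}M))$.\<close>

definition End_valued_10_form ::
  "('m::topological_space, 'n::finite) chart set \<Rightarrow> ('m, 'n) tensor12 \<Rightarrow> bool" where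
  "End_valued_10_form A \<theta> \<longleftrightarrow>
     (\<forall>c\<in>A. \<forall>i j k. chart_smooth_on c UNIV (\<theta> c i j k)) \<and>
     (\<forall>c\<in>A. \<forall>d\<in>A. \<forall>x\<in>fst c \<inter> fst d. \<forall>i j m.
        (\<Sum>a\<in>UNIV. \<Sum>b\<in>UNIV. \<theta> d a b m x * jacobian c d a i x * jacobian c d b j x)
        = (\<Sum>k\<in>UNIV. \<theta> c i j k x * jacobian c d m k x))"

text \<open>Affine connections as operators on local sections over arbitrary open sets. The second
  conjunct says that the operator is compatible with restriction to smaller open sets.\<close>

definition real_connection ::
  "('m::topological_space, 'n::finite) chart set \<Rightarrow> ('m, 'n) connection \<Rightarrow> bool" where
  "real_connection A D \<longleftrightarrow>
     (\<forall>W X Y. open W \<longrightarrow> vfield_on A W X \<longrightarrow> vfield_on A W Y \<longrightarrow> vfield_on A W (D X Y)) \<and>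
     (\<forall>W X X' Y Y'. open W \<longrightarrow> vfield_on A W X \<longrightarrow> vfield_on A W X' \<longrightarrow>
        vfield_on A W Y \<longrightarrow> vfield_on A W Y' \<longrightarrow> vf_eq_on A W X X' \<longrightarrow> vf_eq_on A W Y Y' \<longrightarrow>
        vf_eq_on A W (D X Y) (D X' Y')) \<and>
     (\<forall>W X X' Y. open W \<longrightarrow> vfield_on A W X \<longrightarrow> vfield_on A W X' \<longrightarrow> vfield_on A W Y \<longrightarrow>
        vf_eq_on A W (D (X + X') Y) (D X Y + D X' Y)) \<and>
     (\<forall>W X Y Y'. open W \<longrightarrow> vfield_on A W X \<longrightarrow> vfield_on A W Y \<longrightarrow> vfield_on A W Y' \<longrightarrow>
        vf_eq_on A W (D X (Y + Y')) (D X Y + D X Y')) \<and>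
     (\<forall>W f X Y. open W \<longrightarrow> smooth_fun_on A W f \<longrightarrow> vfield_on A W X \<longrightarrow> vfield_on A W Y \<longrightarrow>
        vf_eq_on A W (D (vf_scale f X) Y) (vf_scale f (D X Y)) \<and>
        vf_eq_on A W (D X (vf_scale f Y))
          (\<lambda>c x. chart_deriv c f x (X c x) *\<^sub>R Y c x + f x *\<^sub>R D X Y c x))"

definition preserves_metric ::
  "('m::topological_space, 'n::finite) chart set \<Rightarrow> ('m, 'n) metric \<Rightarrow> ('m, 'n) connection \<Rightarrow> bool" where
  "preserves_metric A g D \<longleftrightarrow>
     (\<forall>W X Y Z. open W \<longrightarrow> vfield_on A W X \<longrightarrow> vfield_on A W Y \<longrightarrow> vfield_on A W Z \<longrightarrow>
        (\<forall>c\<in>A. \<forall>x\<in>fst c \<inter> W.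
           chart_deriv c (\<lambda>y. g c y (Y c y) (Z c y)) x (X c x)
           = g c x (D X Y c x) (Z c x) + g c x (Y c x) (D X Z c x)))"

definition preserves_J ::
  "('m::topological_space, 'n::finite) chart set \<Rightarrow> ('m, 'n) connection \<Rightarrow> bool" where
  "preserves_J A D \<longleftrightarrow>
     (\<forall>W X Y. open W \<longrightarrow> vfield_on A W X \<longrightarrow> vfield_on A W Y \<longrightarrow>
        vf_eq_on A W (D X (vf_J Y)) (vf_J (D X Y)))"

text \<open>\<open>D\<close> is the connection $\nabla^\theta$. The complex conjugates of the two coordinate formulas need
  not be listed, because the complexification of a real operator commutes with conjugation.\<close>

definition associated_connection ::
  "('m::topological_space, 'n::finite) chart set \<Rightarrow> ('m, 'n) metric \<Rightarrow> ('m, 'n) tensor12 \<Rightarrow>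
   ('m, 'n) connection \<Rightarrow> bool" where
  "associated_connection A g \<theta> D \<longleftrightarrow>
     real_connection A D \<and> preserves_metric A g D \<and> preserves_J A D \<and>
     (\<forall>c\<in>A. \<forall>i j.
        cvf_eq_on A (fst c) (complexify D (d_z c i) (d_z c j))
          (\<Sum>k\<in>UNIV. cvf_scale (\<lambda>x. chern_Gamma g c i j k x + \<theta> c i j k x) (d_z c k)) \<and>
        cvf_eq_on A (fst c) (complexify D (d_zbar c i) (d_z c j))
          (\<Sum>k\<in>UNIV. cvf_scale
             (\<lambda>x. - (\<Sum>p\<in>UNIV. \<Sum>q\<in>UNIV. h_lo g c j q x * h_up g c k p x * cnj (\<theta> c i p q x)))
             (d_z c k)))"

text \<open>$\hat\nabla^\theta$ over the open set \<open>W\<close>, when \<open>D\<close> is $\nabla^\theta$.\<close>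

definition hat_connection ::
  "('m::topological_space, 'n::finite) chart set \<Rightarrow> 'm set \<Rightarrow> ('m, 'n) connection \<Rightarrow> ('m, 'n) cconnection" where
  "hat_connection A W D X = restrict (complexify D X) (T10_sections A W)"

definition curvature ::
  "('m, 'n::finite) metric \<Rightarrow> ('m, 'n) cconnection \<Rightarrow> ('m, 'n) cvfield \<Rightarrow> ('m, 'n) cvfield \<Rightarrow>
   ('m, 'n) cvfield \<Rightarrow> ('m, 'n) cvfield \<Rightarrow> ('m, 'n) chart \<Rightarrow> 'm \<Rightarrow> complex" where
  "curvature g D X Y Z W =
     metric_ext g (D X (D Y Z) - D Y (D X Z) - D (complexify lie_bracket X Y) Z) W"

section \<open>Differential forms and Aeppli cohomology\<close>

text \<open>A form of type $(p,q)$ is given by its components $\omega_{I\bar J}$ with $I$ and $J$ lists of length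
  $p$ and $q$, antisymmetric in both, so that
  $\omega = \frac{1}{p!\,q!}\sum \omega_{I\bar J}\, dz^{I} \wedge d\bar z^{J}$.\<close>

definition swap_entries :: "nat \<Rightarrow> nat \<Rightarrow> 'n list \<Rightarrow> 'n list" where
  "swap_entries a b I = I[a := I ! b, b := I ! a]"

definition pq_form ::
  "('m::topological_space, 'n::finite) chart set \<Rightarrow> nat \<Rightarrow> nat \<Rightarrow> ('m, 'n) form \<Rightarrow> bool" where
  "pq_form A p q \<omega> \<longleftrightarrow>
     (\<forall>c\<in>A. \<forall>I J. length I = p \<longrightarrow> length J = q \<longrightarrow>
        chart_smooth_on c UNIV (\<omega> c I J) \<and>
        (\<forall>x\<in>fst c.
          (\<forall>a b. a < b \<and> b < p \<longrightarrow> \<omega> c (swap_entries a b I) J x = - \<omega> c I J x) \<and>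
          (\<forall>a b. a < b \<and> b < q \<longrightarrow> \<omega> c I (swap_entries a b J) x = - \<omega> c I J x))) \<and>
     (\<forall>c\<in>A. \<forall>d\<in>A. \<forall>x\<in>fst c \<inter> fst d. \<forall>I J. length I = p \<longrightarrow> length J = q \<longrightarrow>
        \<omega> c I J x =
          (\<Sum>K\<in>{K. length K = p}. \<Sum>L\<in>{L. length L = q}.
             \<omega> d K L x * (\<Prod>a<p. jacobian c d (K ! a) (I ! a) x)
                     * (\<Prod>b<q. cnj (jacobian c d (L ! b) (J ! b) x))))"

definition remove_nth :: "nat \<Rightarrow> 'n list \<Rightarrow> 'n list" where
  "remove_nth a I = take a I @ drop (Suc a) I"

definition del :: "('m, 'n::finite) form \<Rightarrow> ('m, 'n) form" where
  "del \<omega> = (\<lambda>c I J x. \<Sum>a<length I. (-1) ^ a * D_z c (I ! a) (\<omega> c (remove_nth a I) J) x)"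

text \<open>The global sign comes from moving $d\bar z^j$ past $dz^I$.\<close>

definition delbar :: "('m, 'n::finite) form \<Rightarrow> ('m, 'n) form" where
  "delbar \<omega> = (\<lambda>c I J x.
     (-1) ^ length I * (\<Sum>b<length J. (-1) ^ b * D_zbar c (J ! b) (\<omega> c I (remove_nth b J)) x))"

definition cnj_form :: "('m, 'n) form \<Rightarrow> ('m, 'n) form" where
  "cnj_form \<omega> = (\<lambda>c I J x. (-1) ^ (length I * length J) * cnj (\<omega> c J I x))"

definition form_eq ::
  "('m, 'n) chart set \<Rightarrow> nat \<Rightarrow> nat \<Rightarrow> ('m, 'n) form \<Rightarrow> ('m, 'n) form \<Rightarrow> bool" where
  "form_eq A p q \<omega> \<eta> \<longleftrightarrow>
     (\<forall>c\<in>A. \<forall>I J. length I = p \<longrightarrow> length J = q \<longrightarrow> (\<forall>x\<in>fst c. \<omega> c I J x = \<eta> c I J x))"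

definition real_11_forms ::
  "('m::topological_space, 'n::finite) chart set \<Rightarrow> ('m, 'n) form set" where
  "real_11_forms A = {\<omega>. pq_form A 1 1 \<omega> \<and> form_eq A 1 1 (cnj_form \<omega>) \<omega>}"

definition aeppli_cocycles ::
  "('m::topological_space, 'n::finite) chart set \<Rightarrow> ('m, 'n) form set" where
  "aeppli_cocycles A = {\<omega> \<in> real_11_forms A. form_eq A 2 2 (del (delbar \<omega>)) 0}"

definition aeppli_coboundaries ::
  "('m::topological_space, 'n::finite) chart set \<Rightarrow> ('m, 'n) form set" where
  "aeppli_coboundaries A =
     {\<omega> \<in> real_11_forms A. \<exists>\<alpha> \<beta>. pq_form A 0 1 \<alpha> \<and> pq_form A 1 0 \<beta> \<and>
        form_eq A 1 1 \<omega> (del \<alpha> + delbar \<beta>)}"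

definition aeppli_rel ::
  "('m::topological_space, 'n::finite) chart set \<Rightarrow> (('m, 'n) form \<times> ('m, 'n) form) set" where
  "aeppli_rel A =
     {(\<omega>, \<eta>). \<omega> \<in> aeppli_cocycles A \<and> \<eta> \<in> aeppli_cocycles A \<and> \<omega> - \<eta> \<in> aeppli_coboundaries A}"

definition aeppli_cohomology ::
  "('m::topological_space, 'n::finite) chart set \<Rightarrow> ('m, 'n) form set set" where
  "aeppli_cohomology A = aeppli_cocycles A // aeppli_rel A"

definition aeppli_class ::
  "('m::topological_space, 'n::finite) chart set \<Rightarrow> ('m, 'n) form \<Rightarrow> ('m, 'n) form set" where
  "aeppli_class A \<omega> = aeppli_rel A `` {\<omega>}"

text \<open>Forms of type $(1,0)$ and $(1,1)$ with given components; values at lists of other lengths are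
  irrelevant.\<close>

definition form10 :: "(('m, 'n) chart \<Rightarrow> 'n \<Rightarrow> 'm \<Rightarrow> complex) \<Rightarrow> ('m, 'n) form" where
  "form10 a = (\<lambda>c I J. a c (hd I))"

definition form11 :: "(('m, 'n) chart \<Rightarrow> 'n \<Rightarrow> 'n \<Rightarrow> 'm \<Rightarrow> complex) \<Rightarrow> ('m, 'n) form" where
  "form11 a = (\<lambda>c I J. a c (hd I) (hd J))"

definition chern_ricci :: "('m, 'n::finite) metric \<Rightarrow> ('m, 'n) form" where
  "chern_ricci g = form11 (\<lambda>c i j x.
     \<i> * (\<Sum>k\<in>UNIV. \<Sum>l\<in>UNIV. h_up g c k l x * chern_curv g c i j k l x))"

text \<open>$\mathfrak{Ric}^{(1)}(\theta)$, when \<open>D\<close> is $\nabla^\theta$.\<close>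

definition hat_ricci ::
  "('m::topological_space, 'n::finite) chart set \<Rightarrow> ('m, 'n) metric \<Rightarrow> ('m, 'n) connection \<Rightarrow> ('m, 'n) form" where
  "hat_ricci A g D = form11 (\<lambda>c i j x.
     \<i> * (\<Sum>k\<in>UNIV. \<Sum>l\<in>UNIV. h_up g c k l x *
       curvature g (hat_connection A (fst c) D) (d_z c i) (d_zbar c j) (d_z c k) (d_zbar c l) c x))"

definition trace_form :: "('m, 'n::finite) tensor12 \<Rightarrow> ('m, 'n) form" where
  "trace_form \<theta> = form10 (\<lambda>c i x. \<Sum>k\<in>UNIV. \<theta> c i k k x)"

end

theory Submission
  imports Defs
begin

text \<open>
  Coordinate fields commute, so the curvature components of $\nabla^\theta$ are obtained by
  differentiating its coefficients $\Gamma + \theta$ and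
  $B_{jk}^m = -h_{k\bar q}h^{m\bar p}\overline{\theta_{jp}^q}$. No derivative of the inverse metric is
  needed, because everything is contracted with $h_{m\bar\ell}$: one differentiates the identities
  $\Gamma_{ik}^m h_{m\bar\ell} = \partial_i h_{k\bar\ell}$ and
  $B_{jk}^m h_{m\bar\ell} = -h_{k\bar q}\overline{\theta_{j\ell}^q}$ instead, and the terms that are
  linear in both $\Gamma$ and $\bar\theta$ cancel.

  Tracing the $(1,1)$ formula kills the quadratic terms, whence the formula for the Ricci form. The
  Chern-Ricci form has the components $-\sqrt{-1}\,\partial_{\bar j}\Gamma_{ik}^k$. Under a change of
  coordinates $\Gamma_{ik}^k dz^i$ changes by a term holomorphic in the coordinates, namely the trace of
  $\partial_i J \cdot J^{-1}$ for the Jacobian $J$; hence these components define a global form, and it is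
  $\bar\partial$-closed because second derivatives commute.
\<close>

section \<open>Calculus of smooth functions\<close>

text \<open>The local expressions are meaningless off their domains, so fields agree only in the
  sense of \<open>vf_eq_on\<close>, and an identity can be differentiated only on an open set where
  it holds; the congruence lemmas for derivatives and for \<open>D\<close> serve this. Curvature is
  computed over \<open>fst c\<close>, where \<open>d_z c i\<close> is a field. \<open>D\<close> acts
  on real fields and admits only real multipliers, while the coefficients are complex; the Leibniz
  rule is therefore rebuilt on pairs of real fields. As \<open>hat_connection\<close> is
  \<open>undefined\<close> off the sections of T^{1,0}, equality of the two curvatures rests on
  \<open>D\<close> preserving J, which keeps each inner covariant derivative inside T^{1,0}. A
  cohomology class needs cocycles: the Ricci forms are given chart by chart, and it must be proved
  that they transform as (1,1)-forms, are real and are annihilated by del delbar. For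
  \<open>hat_ricci\<close> this goes through the trace formula, whose correction is del alpha +
  delbar beta with alpha = -i conj(theta_1) and beta = i theta_1.\<close>

lemma frechet_derivative_eqI: "(f has_derivative f') (at x) \<Longrightarrow> frechet_derivative f (at x) v = f' v"
  using frechet_derivative_at by metis

text \<open>\<open>frechet_derivative\<close> at a point depends only on values near it, so openness
  of \<open>S\<close> lets agreement on \<open>S\<close> pass to all iterated derivatives.\<close>

lemma Ck_on_cong:
  assumes "open S" "\<And>x. x \<in> S \<Longrightarrow> f x = g x" "Ck_on k S f"
  shows "Ck_on k S g"
  using assms(2,3)
proof (induction k arbitrary: f g)
  case 0
  then show ?case by (simp cong: continuous_on_cong)
next
  case (Suc k)
  have d: "f differentiable (at x)" if "x \<in> S" for x using Suc.prems that by simp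
  have "g differentiable (at x)" if "x \<in> S" for x
    using d[OF that] Suc.prems(1) that assms(1) unfolding differentiable_def
    by (meson has_derivative_transform_within_open)
  moreover have "frechet_derivative f (at x) = frechet_derivative g (at x)" if "x \<in> S" for x
    using frechet_derivative_transform_within_open[OF d[OF that] assms(1) that] Suc.prems(1) by blast
  ultimately show ?case
    using Suc.prems(2) Suc.IH[of "\<lambda>x. frechet_derivative f (at x) v" "\<lambda>x. frechet_derivative g (at x) v" for v]
    by auto
qed

lemma Ck_on_continuous: "Ck_on k S f \<Longrightarrow> continuous_on S f"
  by (cases k) (auto intro!: continuous_at_imp_continuous_on differentiable_imp_continuous_within)

lemma Ck_on_SucD: "Ck_on (Suc k) S f \<Longrightarrow> Ck_on k S f"
proof (induction k arbitrary: f)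
  case 0
  then show ?case using Ck_on_continuous[of "Suc 0"] by simp
qed simp

lemma Ck_on_subset: "Ck_on k S f \<Longrightarrow> T \<subseteq> S \<Longrightarrow> Ck_on k T f"
  by (induction k arbitrary: f) (auto intro: continuous_on_subset)

lemma Ck_on_has_derivative:
  "Ck_on (Suc k) S f \<Longrightarrow> x \<in> S \<Longrightarrow> (f has_derivative frechet_derivative f (at x)) (at x)"
  by (simp add: frechet_derivative_works)

text \<open>\<open>Ck_on\<close> refers to the derivative picked by
  \<open>frechet_derivative\<close>. This rule accepts any explicit derivative instead, and the
  closure proofs below run through it.\<close>

lemma Ck_on_SucI:
  assumes "open S" "\<And>x. x \<in> S \<Longrightarrow> (f has_derivative f' x) (at x)" "\<And>v. Ck_on k S (\<lambda>x. f' x v)"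
  shows "Ck_on (Suc k) S f"
proof -
  have "frechet_derivative f (at x) v = f' x v" if "x \<in> S" for x v
    using assms(2)[OF that] by (rule frechet_derivative_eqI)
  then have "Ck_on k S (\<lambda>x. frechet_derivative f (at x) v)" for v
    by (intro Ck_on_cong[OF assms(1) _ assms(3)]) auto
  then show ?thesis using assms(2) by (auto simp: differentiable_def)
qed

section \<open>Closure properties of C^k maps\<close>

lemma Ck_on_const: "open S \<Longrightarrow> Ck_on k S (\<lambda>x. a)"
proof (induction k arbitrary: a)
  case (Suc k)
  show ?case by (rule Ck_on_SucI[where f' = "\<lambda>x v. 0"]) (use Suc in auto)
qed simp

lemma Ck_on_add:
  assumes "open S" "Ck_on k S f" "Ck_on k S g"
  shows "Ck_on k S (\<lambda>x. f x + g x)"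
  using assms(2,3)
proof (induction k arbitrary: f g)
  case 0
  then show ?case by (simp add: continuous_on_add)
next
  case (Suc k)
  show ?case
    using Suc
    by (intro Ck_on_SucI[OF assms(1), where f' = "\<lambda>x v. frechet_derivative f (at x) v + frechet_derivative g (at x) v"])
       (auto intro!: has_derivative_add simp: frechet_derivative_works[symmetric])
qed

lemma Ck_on_bounded_linear:
  assumes "open S" "bounded_linear L" "Ck_on k S f"
  shows "Ck_on k S (\<lambda>x. L (f x))"
  using assms(3)
proof (induction k arbitrary: f)
  case 0
  then show ?case using assms(2) by (simp add: bounded_linear.continuous_on)
next
  case (Suc k)
  show ?case
    using Suc
    by (intro Ck_on_SucI[OF assms(1), where f' = "\<lambda>x v. L (frechet_derivative f (at x) v)"])
       (auto intro!: bounded_linear.has_derivative[OF assms(2)] simp: frechet_derivative_works[symmetric])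
qed

lemma Ck_on_bounded_bilinear:
  assumes "open S" "bounded_bilinear B" "Ck_on k S f" "Ck_on k S g"
  shows "Ck_on k S (\<lambda>x. B (f x) (g x))"
  using assms(3,4)
proof (induction k arbitrary: f g)
  case 0
  then show ?case using assms(2) by (simp add: bounded_bilinear.continuous_on)
next
  case (Suc k)
  show ?case
  proof (rule Ck_on_SucI[OF assms(1), where f' = "\<lambda>x v. B (f x) (frechet_derivative g (at x) v)
        + B (frechet_derivative f (at x) v) (g x)"])
    show "((\<lambda>x. B (f x) (g x)) has_derivative (\<lambda>v. B (f x) (frechet_derivative g (at x) v)
        + B (frechet_derivative f (at x) v) (g x))) (at x)" if "x \<in> S" for x
      using Suc.prems that
      by (intro bounded_bilinear.FDERIV[OF assms(2)]) (auto simp: frechet_derivative_works[symmetric])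
    show "Ck_on k S (\<lambda>x. B (f x) (frechet_derivative g (at x) v) + B (frechet_derivative f (at x) v) (g x))" for v
      using Suc.prems Ck_on_SucD[OF Suc.prems(1)] Ck_on_SucD[OF Suc.prems(2)]
      by (intro Ck_on_add[OF assms(1)] Suc.IH) auto
  qed
qed

lemma Ck_on_sum:
  assumes "open S" "\<And>i. i \<in> I \<Longrightarrow> Ck_on k S (f i)"
  shows "Ck_on k S (\<lambda>x. \<Sum>i\<in>I. f i x)"
  using assms(2)
  by (induction I rule: infinite_finite_induct) (auto intro!: Ck_on_const Ck_on_add assms(1))

text \<open>The derivative of 1/f is built from 1/f itself and the derivative of f by
  multiplication, so order k for 1/f gives order k + 1.\<close>

lemma Ck_on_inverse:
  fixes f :: "'a::real_normed_vector \<Rightarrow> complex"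
  assumes "open S" "Ck_on k S f" "\<And>x. x \<in> S \<Longrightarrow> f x \<noteq> 0"
  shows "Ck_on k S (\<lambda>x. inverse (f x))"
  using assms(2)
proof (induction k)
  case 0
  then show ?case using assms(3) by (auto intro!: continuous_on_inverse)
next
  case (Suc k)
  show ?case
  proof (rule Ck_on_SucI[OF assms(1), where f' = "\<lambda>x v. - (inverse (f x) * frechet_derivative f (at x) v * inverse (f x))"])
    show "((\<lambda>x. inverse (f x)) has_derivative
        (\<lambda>v. - (inverse (f x) * frechet_derivative f (at x) v * inverse (f x)))) (at x)" if "x \<in> S" for x
      using Suc.prems that assms(3)[OF that]
      by (intro Deriv.has_derivative_inverse) (auto simp: frechet_derivative_works[symmetric])
    have i: "Ck_on k S (\<lambda>x. inverse (f x))"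
      using Suc Ck_on_SucD by blast
    show "Ck_on k S (\<lambda>x. - (inverse (f x) * frechet_derivative f (at x) v * inverse (f x)))" for v
      using Suc.prems
      by (intro Ck_on_bounded_linear[OF assms(1) bounded_linear_minus[OF bounded_linear_ident]]
          Ck_on_bounded_bilinear[OF assms(1) bounded_bilinear_mult] i) auto
  qed
qed

text \<open>\<open>Ck_on\<close> differentiates in a fixed direction, but in the chain rule the
  direction \<open>?g' x v\<close> moves with x. Expanding it in a basis leaves fixed directions
  \<open>b\<close> with C^k coefficients, which is why the codomain of \<open>g\<close> is
  Euclidean.\<close>

lemma Ck_on_compose:
  fixes g :: "'a::real_normed_vector \<Rightarrow> 'b::euclidean_space"
  assumes "open S" "open T" "Ck_on k T f" "Ck_on k S g" "g ` S \<subseteq> T"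
  shows "Ck_on k S (\<lambda>x. f (g x))"
  using assms(3,4)
proof (induction k arbitrary: f)
  case 0
  then show ?case using continuous_on_compose2[OF _ _ assms(5)] by simp
next
  case (Suc k)
  let ?g' = "\<lambda>x. frechet_derivative g (at x)" and ?f' = "\<lambda>y. frechet_derivative f (at y)"
  show ?case
  proof (rule Ck_on_SucI[OF assms(1), where f' = "\<lambda>x v. \<Sum>b\<in>Basis. (?g' x v \<bullet> b) *\<^sub>R ?f' (g x) b"])
    show "((\<lambda>x. f (g x)) has_derivative (\<lambda>v. \<Sum>b\<in>Basis. (?g' x v \<bullet> b) *\<^sub>R ?f' (g x) b)) (at x)"
      if "x \<in> S" for x
    proof -
      have f: "(f has_derivative ?f' (g x)) (at (g x))"
        using Ck_on_has_derivative[OF Suc.prems(1)] that assms(5) by blast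
      have lin: "linear (?f' (g x))" by (rule has_derivative_linear[OF f])
      have "?f' (g x) (?g' x v) = (\<Sum>b\<in>Basis. (?g' x v \<bullet> b) *\<^sub>R ?f' (g x) b)" for v
        by (subst euclidean_representation[of "?g' x v", symmetric])
           (simp only: linear_sum[OF lin] linear_scale[OF lin])
      then show ?thesis
        using has_derivative_compose[OF Ck_on_has_derivative[OF Suc.prems(2) that] f] by simp
    qed
    show "Ck_on k S (\<lambda>x. \<Sum>b\<in>Basis. (?g' x v \<bullet> b) *\<^sub>R ?f' (g x) b)" for v
    proof (rule Ck_on_sum[OF assms(1)])
      fix b :: 'b
      have "Ck_on k S (\<lambda>x. ?f' (g x) b)"
        using Suc.prems Ck_on_SucD[OF Suc.prems(2)] by (intro Suc.IH) auto
      moreover have "Ck_on k S (\<lambda>x. ?g' x v \<bullet> b)"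
        using Suc.prems(2) by (intro Ck_on_bounded_linear[OF assms(1) bounded_linear_inner_left]) auto
      ultimately show "Ck_on k S (\<lambda>x. (?g' x v \<bullet> b) *\<^sub>R ?f' (g x) b)"
        by (intro Ck_on_bounded_bilinear[OF assms(1) bounded_bilinear_scaleR])
    qed
  qed
qed

text \<open>Two mean value theorems, first along \<open>u\<close>, then along \<open>v\<close>. The
  bound on \<open>h\<close> keeps the whole parallelogram spanned at \<open>x\<close> inside the
  ball.\<close>

lemma mixed_difference_eq_second_derivative:
  fixes f :: "'a::real_normed_vector \<Rightarrow> real"
  assumes "Ck_on 2 (ball x r) f" "h > 0" "h * (norm u + norm v) < r"
  obtains s t where "s \<in> {0..h}" "t \<in> {0..h}"
    "f (x + h *\<^sub>R u + h *\<^sub>R v) - f (x + h *\<^sub>R u) - f (x + h *\<^sub>R v) + f x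
      = h * h * frechet_derivative (\<lambda>y. frechet_derivative f (at y) u) (at (x + s *\<^sub>R u + t *\<^sub>R v)) v"
proof -
  let ?f' = "\<lambda>y. frechet_derivative f (at y)"
  let ?f'' = "\<lambda>y. frechet_derivative (\<lambda>y. ?f' y u) (at y)"
  have mem: "x + s *\<^sub>R u + t *\<^sub>R v \<in> ball x r" if "s \<in> {0..h}" "t \<in> {0..h}" for s t
  proof -
    have "norm (s *\<^sub>R u + t *\<^sub>R v) \<le> s * norm u + t * norm v"
      using that by (metis abs_of_nonneg atLeastAtMost_iff norm_scaleR norm_triangle_ineq)
    also have "\<dots> \<le> h * norm u + h * norm v"
      using that by (intro add_mono mult_right_mono) auto
    finally have "dist (x + s *\<^sub>R u + t *\<^sub>R v) x < r"
      using assms(3) by (simp add: dist_norm distrib_left add.assoc)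
    then show ?thesis by (simp add: dist_commute)
  qed
  have C2: "Ck_on (Suc (Suc 0)) (ball x r) f" using assms(1) by (simp add: numeral_2_eq_2)
  have f': "(f has_derivative ?f' y) (at y)" if "y \<in> ball x r" for y
    using Ck_on_has_derivative[OF C2 that] .
  have f'': "((\<lambda>y. ?f' y u) has_derivative ?f'' y) (at y)" if "y \<in> ball x r" for y
    using C2 that by (auto simp: frechet_derivative_works[symmetric])
  \<comment> \<open>The difference in direction \<open>v\<close> as a function of the position along
    \<open>u\<close>: its increment over \<open>{0..h}\<close> is the full second difference, which
    is symmetric in \<open>u\<close> and \<open>v\<close>.\<close>
  define \<phi> where "\<phi> s = f (x + s *\<^sub>R u + h *\<^sub>R v) - f (x + s *\<^sub>R u)" for s
  have "(\<phi> has_derivative (\<lambda>d. ?f' (x + s *\<^sub>R u + h *\<^sub>R v) (d *\<^sub>R u) - ?f' (x + s *\<^sub>R u) (d *\<^sub>R u)))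
      (at s within {0..h})" if "0 \<le> s" "s \<le> h" for s
    unfolding \<phi>_def using mem[of s h] mem[of s 0] that assms(2)
    by (intro has_derivative_diff has_derivative_compose[of _ _ s "{0..h}" f])
       (auto intro!: derivative_eq_intros f')
  from mvt_simple[OF assms(2) this] obtain s where s: "s \<in> {0<..<h}"
    "\<phi> h - \<phi> 0 = ?f' (x + s *\<^sub>R u + h *\<^sub>R v) (h *\<^sub>R u) - ?f' (x + s *\<^sub>R u) (h *\<^sub>R u)"
    by auto
  have scale: "?f' y (h *\<^sub>R u) = h * ?f' y u" if "y \<in> ball x r" for y
    using linear_scale[OF has_derivative_linear[OF f'[OF that]]] by simp
  have "((\<lambda>t. ?f' (x + s *\<^sub>R u + t *\<^sub>R v) u) has_derivative (\<lambda>d. ?f'' (x + s *\<^sub>R u + t *\<^sub>R v) (d *\<^sub>R v)))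
      (at t within {0..h})" if "0 \<le> t" "t \<le> h" for t
    using mem[of s t] that s(1)
    by (intro has_derivative_compose[of _ _ t "{0..h}" "\<lambda>y. ?f' y u"])
       (auto intro!: derivative_eq_intros f'')
  from mvt_simple[OF assms(2) this] obtain t where t: "t \<in> {0<..<h}"
    "?f' (x + s *\<^sub>R u + h *\<^sub>R v) u - ?f' (x + s *\<^sub>R u) u = ?f'' (x + s *\<^sub>R u + t *\<^sub>R v) (h *\<^sub>R v)"
    by auto
  have scale2: "?f'' (x + s *\<^sub>R u + t *\<^sub>R v) (h *\<^sub>R v) = h * ?f'' (x + s *\<^sub>R u + t *\<^sub>R v) v"
    using linear_scale[OF has_derivative_linear[OF f''[OF mem]]] s(1) t(1) by simp
  have "\<phi> h - \<phi> 0 = h * (?f' (x + s *\<^sub>R u + h *\<^sub>R v) u - ?f' (x + s *\<^sub>R u) u)"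
    using s scale[OF mem[of s h]] scale[OF mem[of s 0]] assms(2) by (simp add: right_diff_distrib)
  also have "\<dots> = h * h * ?f'' (x + s *\<^sub>R u + t *\<^sub>R v) v"
    using t(2) scale2 by simp
  finally show ?thesis
    using s(1) t(1) by (intro that[of s t]) (auto simp: \<phi>_def algebra_simps)
qed

text \<open>The second difference equals h * h times either mixed derivative at suitable points
  close to \<open>x\<close>. Were the two unequal at \<open>x\<close>, continuity would keep their
  values at these points apart, yet those values coincide.\<close>

lemma second_derivative_symmetric_real:
  fixes f :: "'a::real_normed_vector \<Rightarrow> real"
  assumes S: "open S" "x \<in> S" and f: "Ck_on 2 S f"
  shows "frechet_derivative (\<lambda>y. frechet_derivative f (at y) u) (at x) v
       = frechet_derivative (\<lambda>y. frechet_derivative f (at y) v) (at x) u"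
    (is "?F u v x = ?F v u x")
proof (rule ccontr)
  assume neq: "?F u v x \<noteq> ?F v u x"
  \<comment> \<open>Half the gap: two numbers within \<open>e\<close> of the two sides cannot be
    equal.\<close>
  define e where "e = \<bar>?F u v x - ?F v u x\<bar> / 2"
  have e: "e > 0" using neq by (simp add: e_def)
  obtain r where r: "r > 0" "ball x r \<subseteq> S" using S open_contains_ball by blast
  have cont: "isCont (?F a b) x" for a b
    using f S by (simp add: numeral_2_eq_2 continuous_on_eq_continuous_at)
  obtain d where d: "d > 0" "\<And>y. dist y x < d \<Longrightarrow> dist (?F u v y) (?F u v x) < e"
    using cont[of u v] e unfolding continuous_at_eps_delta by blast
  obtain d' where d': "d' > 0" "\<And>y. dist y x < d' \<Longrightarrow> dist (?F v u y) (?F v u x) < e"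
    using cont[of v u] e unfolding continuous_at_eps_delta by blast
  define m where "m = min r (min d d')"
  have m: "m > 0" using r d d' by (simp add: m_def)
  \<comment> \<open>The summand 1 avoids division by zero when \<open>u\<close> and \<open>v\<close>
    vanish, and the halving gives the strict bound \<open>hm\<close>.\<close>
  define h where "h = m / (norm u + norm v + 1) / 2"
  have h: "h > 0" unfolding h_def using m by (auto intro!: divide_pos_pos add_nonneg_pos)
  have "h * (norm u + norm v) \<le> h * (norm u + norm v + 1)" using h by (intro mult_left_mono) auto
  also have "\<dots> = m / 2"
    unfolding h_def by (simp add: field_simps add_nonneg_eq_0_iff)
  finally have hm: "h * (norm u + norm v) < m" using m by simp
  have C2: "Ck_on 2 (ball x r) f" using Ck_on_subset[OF f r(2)] .
  \<comment> \<open>Only the total length of the directions enters, so one statement serves both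
    orders of \<open>u\<close> and \<open>v\<close>.\<close>
  have near: "dist (x + s *\<^sub>R a + t *\<^sub>R b) x < m" if "s \<in> {0..h}" "t \<in> {0..h}"
    "norm a + norm b = norm u + norm v" for s t a b
  proof -
    have "norm (s *\<^sub>R a + t *\<^sub>R b) \<le> s * norm a + t * norm b"
      using that by (metis abs_of_nonneg atLeastAtMost_iff norm_scaleR norm_triangle_ineq)
    also have "\<dots> \<le> h * norm a + h * norm b"
      using that by (intro add_mono mult_right_mono) auto
    also have "\<dots> = h * (norm u + norm v)" using that(3) by (simp flip: distrib_left)
    finally show ?thesis using hm by (simp add: dist_norm add.assoc)
  qed
  have hr: "h * (norm u + norm v) < r" using hm by (simp add: m_def)
  obtain s t where st: "s \<in> {0..h}" "t \<in> {0..h}"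
    "f (x + h *\<^sub>R u + h *\<^sub>R v) - f (x + h *\<^sub>R u) - f (x + h *\<^sub>R v) + f x = h * h * ?F u v (x + s *\<^sub>R u + t *\<^sub>R v)"
    using mixed_difference_eq_second_derivative[OF C2 h hr] by metis
  obtain s' t' where st': "s' \<in> {0..h}" "t' \<in> {0..h}"
    "f (x + h *\<^sub>R v + h *\<^sub>R u) - f (x + h *\<^sub>R v) - f (x + h *\<^sub>R u) + f x = h * h * ?F v u (x + s' *\<^sub>R v + t' *\<^sub>R u)"
    using mixed_difference_eq_second_derivative[OF C2 h, of v u] hr by (metis add.commute)
  have "h * h * ?F u v (x + s *\<^sub>R u + t *\<^sub>R v) = h * h * ?F v u (x + s' *\<^sub>R v + t' *\<^sub>R u)"
    unfolding st(3)[symmetric] st'(3)[symmetric] by (simp add: algebra_simps)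
  then have "?F u v (x + s *\<^sub>R u + t *\<^sub>R v) = ?F v u (x + s' *\<^sub>R v + t' *\<^sub>R u)" using h by simp
  moreover have "dist (?F u v (x + s *\<^sub>R u + t *\<^sub>R v)) (?F u v x) < e"
    using near[OF st(1,2), of u v] by (intro d(2)) (auto simp: m_def)
  moreover have "dist (?F v u (x + s' *\<^sub>R v + t' *\<^sub>R u)) (?F v u x) < e"
    using near[OF st'(1,2), of v u] by (intro d'(2)) (auto simp: m_def)
  ultimately show False unfolding e_def dist_real_def by (smt (verit) field_sum_of_halves)
qed

text \<open>The mean value argument is for real functions; the general case is reduced to inner
  products with basis vectors, which commute with differentiation.\<close>

lemma second_derivative_symmetric:
  fixes f :: "'a::real_normed_vector \<Rightarrow> 'b::euclidean_space"
  assumes S: "open S" "x \<in> S" and f: "Ck_on 2 S f"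
  shows "frechet_derivative (\<lambda>y. frechet_derivative f (at y) u) (at x) v
       = frechet_derivative (\<lambda>y. frechet_derivative f (at y) v) (at x) u"
proof (rule euclidean_eqI)
  fix b :: 'b
  have f2: "Ck_on (Suc (Suc 0)) S f" using f by (simp add: numeral_2_eq_2)
  have d1: "frechet_derivative (\<lambda>y. f y \<bullet> b) (at y) w = frechet_derivative f (at y) w \<bullet> b"
    if "y \<in> S" for y w
    by (intro frechet_derivative_eqI bounded_linear.has_derivative[OF bounded_linear_inner_left]
        Ck_on_has_derivative[OF f2 that])
  have d2: "frechet_derivative (\<lambda>y. frechet_derivative (\<lambda>y. f y \<bullet> b) (at y) w) (at x) z
      = frechet_derivative (\<lambda>y. frechet_derivative f (at y) w) (at x) z \<bullet> b" for w z
  proof -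
    have "((\<lambda>y. frechet_derivative f (at y) w \<bullet> b) has_derivative
       (\<lambda>z. frechet_derivative (\<lambda>y. frechet_derivative f (at y) w) (at x) z \<bullet> b)) (at x)"
      using f2 S(2)
      by (intro bounded_linear.has_derivative[OF bounded_linear_inner_left])
         (auto simp: frechet_derivative_works[symmetric])
    then have "((\<lambda>y. frechet_derivative (\<lambda>y. f y \<bullet> b) (at y) w) has_derivative
       (\<lambda>z. frechet_derivative (\<lambda>y. frechet_derivative f (at y) w) (at x) z \<bullet> b)) (at x)"
      by (rule has_derivative_transform_within_open[OF _ S]) (simp add: d1)
    then show ?thesis by (rule frechet_derivative_eqI)
  qed
  have "Ck_on 2 S (\<lambda>y. f y \<bullet> b)"
    by (rule Ck_on_bounded_linear[OF S(1) bounded_linear_inner_left f])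
  from second_derivative_symmetric_real[OF S this, of u v]
  show "frechet_derivative (\<lambda>y. frechet_derivative f (at y) u) (at x) v \<bullet> b
      = frechet_derivative (\<lambda>y. frechet_derivative f (at y) v) (at x) u \<bullet> b"
    by (simp add: d2)
qed

lemma smooth_on_cong:
  "open S \<Longrightarrow> (\<And>x. x \<in> S \<Longrightarrow> f x = g x) \<Longrightarrow> smooth_on S f \<Longrightarrow> smooth_on S g"
  unfolding smooth_on_def by (meson Ck_on_cong)

lemma smooth_on_frechet_derivative: "smooth_on S f \<Longrightarrow> smooth_on S (\<lambda>x. frechet_derivative f (at x) v)"
  unfolding smooth_on_def by (metis Ck_on.simps(2))

lemma smooth_on_has_derivative:
  "smooth_on S f \<Longrightarrow> x \<in> S \<Longrightarrow> (f has_derivative frechet_derivative f (at x)) (at x)"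
  unfolding smooth_on_def using Ck_on_has_derivative by blast

section \<open>Functions in charts\<close>

locale complex_manifold =
  fixes A :: "('m::{t2_space, second_countable_topology}, 'n::finite) chart set"
  assumes atlas: "complex_atlas A"
begin

lemma open_chart: "c \<in> A \<Longrightarrow> open (fst c)"
  using atlas by (simp add: complex_atlas_def)

lemma chart_homeomorphism:
  "c \<in> A \<Longrightarrow> homeomorphism (fst c) (snd c ` fst c) (snd c) (inv_into (fst c) (snd c))"
  using atlas by (simp add: complex_atlas_def)

lemma chart_inverse: "c \<in> A \<Longrightarrow> x \<in> fst c \<Longrightarrow> inv_into (fst c) (snd c) (snd c x) = x"
  using chart_homeomorphism by (meson homeomorphism_apply1)

lemma local_rep_chart: "c \<in> A \<Longrightarrow> x \<in> fst c \<Longrightarrow> local_rep c f (snd c x) = f x"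
  by (simp add: local_rep_def chart_inverse)

lemma open_chart_image: "c \<in> A \<Longrightarrow> open W \<Longrightarrow> open (snd c ` (fst c \<inter> W))"
proof -
  assume c: "c \<in> A" and W: "open W"
  have "openin (top_of_set (snd c ` fst c)) (snd c ` (fst c \<inter> W))"
    using homeomorphism_imp_open_map[OF chart_homeomorphism[OF c], of "fst c \<inter> W"] W
    by (simp add: openin_open_Int)
  moreover have "open (snd c ` fst c)" using atlas c by (simp add: complex_atlas_def)
  ultimately show ?thesis using openin_open_trans by blast
qed

lemma chart_smooth_cong:
  assumes "c \<in> A" "open W" "chart_smooth_on c W f" "\<And>x. x \<in> fst c \<Longrightarrow> x \<in> W \<Longrightarrow> f x = g x"
  shows "chart_smooth_on c W g"
  using assms(3) unfolding chart_smooth_on_def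
  by (rule smooth_on_cong[OF open_chart_image[OF assms(1,2)], rotated])
     (auto simp: local_rep_chart assms)

lemma chart_smooth_subset:
  "chart_smooth_on c W f \<Longrightarrow> fst c \<inter> V \<subseteq> fst c \<inter> W \<Longrightarrow> chart_smooth_on c V f"
  unfolding chart_smooth_on_def smooth_on_def using Ck_on_subset image_mono by metis

lemma chart_smooth_self_iff: "chart_smooth_on c (fst c) f \<longleftrightarrow> chart_smooth_on c UNIV f"
  by (simp add: chart_smooth_on_def)

lemma chart_has_derivative:
  assumes "c \<in> A" "chart_smooth_on c W f" "x \<in> fst c" "x \<in> W"
  shows "(local_rep c f has_derivative chart_deriv c f x) (at (snd c x))"
  using smooth_on_has_derivative[of _ "local_rep c f" "snd c x"] assms
  unfolding chart_smooth_on_def chart_deriv_def[abs_def] by blast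

lemma chart_derivI:
  "(local_rep c f has_derivative f') (at (snd c x)) \<Longrightarrow> chart_deriv c f x v = f' v"
  unfolding chart_deriv_def by (rule frechet_derivative_eqI)

lemma chart_deriv_linear:
  assumes "c \<in> A" "chart_smooth_on c W f" "x \<in> fst c" "x \<in> W"
  shows "linear (chart_deriv c f x)"
  using chart_has_derivative[OF assms] by (rule has_derivative_linear)

text \<open>Off the chart and \<open>W\<close> the two functions may differ; the derivative sees
  only the open image of \<open>fst c \<inter> W\<close>. The identities between coefficients are
  differentiated through this lemma and its Wirtinger form \<open>wirtinger_cong\<close>.\<close>

lemma chart_deriv_cong:
  assumes "c \<in> A" "open W" "chart_smooth_on c W f" "x \<in> fst c" "x \<in> W"
    "\<And>y. y \<in> fst c \<Longrightarrow> y \<in> W \<Longrightarrow> f y = g y"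
  shows "chart_deriv c g x v = chart_deriv c f x v"
proof (rule chart_derivI)
  show "(local_rep c g has_derivative chart_deriv c f x) (at (snd c x))"
    by (rule has_derivative_transform_within_open[OF chart_has_derivative[OF assms(1,3-5)]
          open_chart_image[OF assms(1,2)]])
       (use assms in \<open>auto simp: local_rep_chart\<close>)
qed

section \<open>Calculus rules for functions read in a chart\<close>

lemma chart_smooth_iff:
  "chart_smooth_on c W f \<longleftrightarrow> (\<forall>k. Ck_on k (snd c ` (fst c \<inter> W)) (\<lambda>z. f (inv_into (fst c) (snd c) z)))"
  by (simp add: chart_smooth_on_def smooth_on_def local_rep_def comp_def)

lemma chart_smooth_const: "c \<in> A \<Longrightarrow> open W \<Longrightarrow> chart_smooth_on c W (\<lambda>_. a)"
  by (simp add: chart_smooth_iff Ck_on_const open_chart_image)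

lemma chart_deriv_const: "chart_deriv c (\<lambda>_. a) x v = 0"
  by (simp add: chart_deriv_def local_rep_def comp_def)

lemma chart_smooth_add:
  "c \<in> A \<Longrightarrow> open W \<Longrightarrow> chart_smooth_on c W f \<Longrightarrow> chart_smooth_on c W g \<Longrightarrow>
    chart_smooth_on c W (\<lambda>x. f x + g x)"
  unfolding chart_smooth_iff by (intro allI Ck_on_add open_chart_image) auto

lemma chart_deriv_add:
  assumes "c \<in> A" "x \<in> fst c" "x \<in> W" "chart_smooth_on c W f" "chart_smooth_on c W g"
  shows "chart_deriv c (\<lambda>x. f x + g x) x v = chart_deriv c f x v + chart_deriv c g x v"
  using has_derivative_add[OF chart_has_derivative[of c W f x] chart_has_derivative[of c W g x]] assms
  by (intro chart_derivI) (simp add: local_rep_def comp_def)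

lemma chart_smooth_bounded_linear:
  "bounded_linear L \<Longrightarrow> c \<in> A \<Longrightarrow> open W \<Longrightarrow> chart_smooth_on c W f \<Longrightarrow>
    chart_smooth_on c W (\<lambda>x. L (f x))"
  unfolding chart_smooth_iff by (intro allI Ck_on_bounded_linear[where L = L] open_chart_image) auto

lemma chart_deriv_bounded_linear:
  assumes "bounded_linear L" "c \<in> A" "x \<in> fst c" "x \<in> W" "chart_smooth_on c W f"
  shows "chart_deriv c (\<lambda>x. L (f x)) x v = L (chart_deriv c f x v)"
  using bounded_linear.has_derivative[OF assms(1) chart_has_derivative[of c W f x]] assms
  by (intro chart_derivI) (simp add: local_rep_def comp_def)

lemma chart_smooth_bounded_bilinear:
  "bounded_bilinear B \<Longrightarrow> c \<in> A \<Longrightarrow> open W \<Longrightarrow> chart_smooth_on c W f \<Longrightarrow> chart_smooth_on c W g \<Longrightarrow>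
    chart_smooth_on c W (\<lambda>x. B (f x) (g x))"
  unfolding chart_smooth_iff by (intro allI Ck_on_bounded_bilinear[where B = B] open_chart_image) auto

lemma chart_deriv_bounded_bilinear:
  assumes "bounded_bilinear B" "c \<in> A" "x \<in> fst c" "x \<in> W"
    "chart_smooth_on c W f" "chart_smooth_on c W g"
  shows "chart_deriv c (\<lambda>x. B (f x) (g x)) x v = B (f x) (chart_deriv c g x v) + B (chart_deriv c f x v) (g x)"
  using bounded_bilinear.FDERIV[OF assms(1) chart_has_derivative[of c W f x]
      chart_has_derivative[of c W g x]] assms
  by (intro chart_derivI[where f' = "\<lambda>v. B (f x) (chart_deriv c g x v) + B (chart_deriv c f x v) (g x)"])
     (simp add: local_rep_def comp_def chart_inverse)

lemma chart_smooth_sum: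
  assumes "c \<in> A" "open W" "\<And>i. i \<in> I \<Longrightarrow> chart_smooth_on c W (f i)"
  shows "chart_smooth_on c W (\<lambda>x. \<Sum>i\<in>I. f i x)"
  using assms(3)
  by (induction I rule: infinite_finite_induct)
     (auto intro!: chart_smooth_const chart_smooth_add assms(1,2))

lemma chart_smooth_inverse:
  fixes f :: "'m \<Rightarrow> complex"
  assumes "c \<in> A" "open W" "chart_smooth_on c W f" "\<And>x. x \<in> fst c \<Longrightarrow> x \<in> W \<Longrightarrow> f x \<noteq> 0"
  shows "chart_smooth_on c W (\<lambda>x. inverse (f x))"
  using assms unfolding chart_smooth_iff
  by (intro allI Ck_on_inverse open_chart_image) (auto simp: chart_inverse)

lemmas chart_smooth_mult = chart_smooth_bounded_bilinear[OF bounded_bilinear_mult]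
lemmas chart_smooth_scaleR = chart_smooth_bounded_bilinear[OF bounded_bilinear_scaleR]
lemmas chart_smooth_minus = chart_smooth_bounded_linear[OF bounded_linear_minus[OF bounded_linear_ident]]
lemmas chart_smooth_cnj = chart_smooth_bounded_linear[OF bounded_linear_cnj]
lemmas chart_smooth_Re = chart_smooth_bounded_linear[OF bounded_linear_Re]
lemmas chart_smooth_Im = chart_smooth_bounded_linear[OF bounded_linear_Im]
lemmas chart_smooth_of_real = chart_smooth_bounded_linear[OF bounded_linear_of_real]

lemma chart_smooth_diff:
  assumes "c \<in> A" "open W" "chart_smooth_on c W f" "chart_smooth_on c W g"
  shows "chart_smooth_on c W (\<lambda>x. f x - g x)"
  using chart_smooth_add[OF assms(1-3) chart_smooth_minus[OF assms(1,2,4)]] by simp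

lemma chart_smooth_prod:
  fixes f :: "'i \<Rightarrow> 'm \<Rightarrow> complex"
  assumes "c \<in> A" "open W" "\<And>i. i \<in> I \<Longrightarrow> chart_smooth_on c W (f i)"
  shows "chart_smooth_on c W (\<lambda>x. \<Prod>i\<in>I. f i x)"
  using assms(3)
  by (induction I rule: infinite_finite_induct)
     (auto intro!: chart_smooth_const chart_smooth_mult assms(1,2))

lemma chart_smooth_deriv:
  assumes "c \<in> A" "open W" "chart_smooth_on c W f"
  shows "chart_smooth_on c W (\<lambda>x. chart_deriv c f x v)"
  unfolding chart_smooth_on_def
  by (rule smooth_on_cong[OF open_chart_image[OF assms(1,2)] _
        smooth_on_frechet_derivative[OF assms(3)[unfolded chart_smooth_on_def], of v]])
     (auto simp: local_rep_chart[OF assms(1)] chart_deriv_def)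

lemma chart_deriv_chart_deriv:
  assumes "c \<in> A" "open W" "chart_smooth_on c W f" "x \<in> fst c" "x \<in> W"
  shows "chart_deriv c (\<lambda>y. chart_deriv c f y u) x v
       = frechet_derivative (\<lambda>z. frechet_derivative (local_rep c f) (at z) u) (at (snd c x)) v"
proof -
  let ?S = "snd c ` (fst c \<inter> W)"
  have "((\<lambda>z. frechet_derivative (local_rep c f) (at z) u) has_derivative
       frechet_derivative (\<lambda>z. frechet_derivative (local_rep c f) (at z) u) (at (snd c x))) (at (snd c x))"
    using assms
    by (intro smooth_on_has_derivative[OF smooth_on_frechet_derivative[of ?S]]) (auto simp: chart_smooth_on_def)
  then show ?thesis
    by (rule chart_derivI[OF has_derivative_transform_within_open[OF _ open_chart_image[OF assms(1,2)]]])
       (auto simp: assms local_rep_chart chart_deriv_def)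
qed

lemma chart_deriv_commute:
  fixes f :: "'m \<Rightarrow> 'b::euclidean_space"
  assumes "c \<in> A" "open W" "chart_smooth_on c W f" "x \<in> fst c" "x \<in> W"
  shows "chart_deriv c (\<lambda>y. chart_deriv c f y u) x v = chart_deriv c (\<lambda>y. chart_deriv c f y v) x u"
  unfolding chart_deriv_chart_deriv[OF assms]
  using assms(3-5)
  by (intro second_derivative_symmetric[OF open_chart_image[OF assms(1,2)]])
     (auto simp: chart_smooth_on_def smooth_on_def)

subsection \<open>Change of coordinates\<close>

lemma chart_smooth_coordinates: "c \<in> A \<Longrightarrow> d \<in> A \<Longrightarrow> chart_smooth_on c (fst d) (snd d)"
  using atlas by (simp add: complex_atlas_def)

text \<open>On the overlap \<open>local_rep d f\<close> is \<open>local_rep c f\<close> composed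
  with the coordinate change \<open>local_rep d (snd c)\<close>.\<close>

lemma chart_smooth_change:
  assumes "c \<in> A" "d \<in> A" "open W" "chart_smooth_on c W f"
  shows "chart_smooth_on d (fst c \<inter> W) f"
proof -
  let ?S = "snd d ` (fst d \<inter> (fst c \<inter> W))"
  have o: "open (fst c \<inter> W)" using open_chart[OF assms(1)] assms(3) by blast
  have "chart_smooth_on d (fst c \<inter> W) (snd c)"
    by (rule chart_smooth_subset[OF chart_smooth_coordinates[OF assms(2,1)]]) auto
  then have "smooth_on ?S (\<lambda>z. local_rep c f (local_rep d (snd c) z))"
    using assms(4) unfolding chart_smooth_on_def smooth_on_def
    by (intro allI Ck_on_compose[OF open_chart_image[OF assms(2) o] open_chart_image[OF assms(1,3)], of _ "local_rep c f"])
       (auto simp: local_rep_chart assms(1,2))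
  then show ?thesis unfolding chart_smooth_on_def
    by (rule smooth_on_cong[OF open_chart_image[OF assms(2) o], rotated])
       (auto simp: local_rep_chart assms(1,2))
qed

lemma chart_deriv_chain:
  assumes "c \<in> A" "d \<in> A" "open W" "chart_smooth_on c W f" "x \<in> fst c" "x \<in> fst d" "x \<in> W"
  shows "chart_deriv d f x v = chart_deriv c f x (chart_deriv d (snd c) x v)"
proof -
  have o: "open (fst c \<inter> W)" using open_chart[OF assms(1)] assms(3) by blast
  have "(local_rep c f has_derivative chart_deriv c f x) (at (local_rep d (snd c) (snd d x)))"
    using chart_has_derivative[of c W f x] assms by (simp add: local_rep_chart)
  then have "((\<lambda>z. local_rep c f (local_rep d (snd c) z)) has_derivative
      (\<lambda>v. chart_deriv c f x (chart_deriv d (snd c) x v))) (at (snd d x))"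
    using assms by (intro has_derivative_compose[OF chart_has_derivative[OF _ chart_smooth_coordinates]])
  then have "(local_rep d f has_derivative (\<lambda>v. chart_deriv c f x (chart_deriv d (snd c) x v))) (at (snd d x))"
    by (rule has_derivative_transform_within_open[OF _ open_chart_image[OF assms(2) o]])
       (auto simp: local_rep_chart assms(1,2,5-))
  then show ?thesis by (rule chart_derivI)
qed

lemma chart_deriv_self: "c \<in> A \<Longrightarrow> x \<in> fst c \<Longrightarrow> chart_deriv c (snd c) x v = v"
proof (rule chart_derivI)
  assume "c \<in> A" "x \<in> fst c"
  then show "(local_rep c (snd c) has_derivative (\<lambda>v. v)) (at (snd c x))"
    by (intro has_derivative_transform_within_open[OF has_derivative_ident open_chart_image[of c UNIV]])
       (auto simp: local_rep_chart)
qed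

lemma chart_deriv_change_linear:
  "c \<in> A \<Longrightarrow> d \<in> A \<Longrightarrow> x \<in> fst c \<Longrightarrow> x \<in> fst d \<Longrightarrow> linear (chart_deriv c (snd d) x)"
  by (rule chart_deriv_linear[OF _ chart_smooth_coordinates])

lemma chart_deriv_change_i:
  "c \<in> A \<Longrightarrow> d \<in> A \<Longrightarrow> x \<in> fst c \<Longrightarrow> x \<in> fst d \<Longrightarrow>
    chart_deriv c (snd d) x (\<i> *s v) = \<i> *s chart_deriv c (snd d) x v"
  using atlas by (simp add: complex_atlas_def)

lemma chart_deriv_change_scale:
  assumes "c \<in> A" "d \<in> A" "x \<in> fst c" "x \<in> fst d"
  shows "chart_deriv c (snd d) x (a *s v) = a *s chart_deriv c (snd d) x v"
proof -
  have *: "a *s w = Re a *\<^sub>R w + Im a *\<^sub>R (\<i> *s w)" for w :: "complex ^ 'n"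
    by (simp add: vec_eq_iff complex_eq_iff)
  note l = chart_deriv_change_linear[OF assms]
  show ?thesis
    unfolding *[of v] *[of "chart_deriv c (snd d) x v"]
    by (simp only: linear_add[OF l] linear_scale[OF l] chart_deriv_change_i[OF assms])
qed

text \<open>The chain rule for the function \<open>snd c\<close>, differentiated in the chart
  \<open>c\<close> and in the chart \<open>d\<close>.\<close>

lemma chart_deriv_inverse:
  assumes "c \<in> A" "d \<in> A" "x \<in> fst c" "x \<in> fst d"
  shows "chart_deriv d (snd c) x (chart_deriv c (snd d) x v) = v"
  using chart_deriv_chain[OF assms(2,1) open_chart[OF assms(1)]
      chart_smooth_coordinates[OF assms(2,1)] assms(4,3,3), of v]
  by (simp add: chart_deriv_self assms)

subsection \<open>Wirtinger derivatives\<close>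

text \<open>\<open>D_z\<close> and \<open>D_zbar\<close> at once, for \<open>a = - \<i>\<close> and \<open>a = \<i>\<close>.\<close>

definition wirtinger :: "complex \<Rightarrow> ('m, 'n) chart \<Rightarrow> 'n \<Rightarrow> ('m \<Rightarrow> complex) \<Rightarrow> 'm \<Rightarrow> complex" where
  "wirtinger a c i f x = (chart_deriv c f x (axis i 1) + a * chart_deriv c f x (axis i \<i>)) / 2"

lemma D_z_wirtinger: "D_z c i = wirtinger (- \<i>) c i"
  by (simp add: wirtinger_def D_z_def fun_eq_iff)

lemma D_zbar_wirtinger: "D_zbar c i = wirtinger \<i> c i"
  by (simp add: wirtinger_def D_zbar_def fun_eq_iff)

lemma wirtinger_cong:
  assumes "c \<in> A" "open W" "chart_smooth_on c W f" "x \<in> fst c" "x \<in> W"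
    "\<And>y. y \<in> fst c \<Longrightarrow> y \<in> W \<Longrightarrow> f y = g y"
  shows "wirtinger a c i g x = wirtinger a c i f x"
  by (simp add: wirtinger_def chart_deriv_cong[OF assms])

lemma wirtinger_const: "wirtinger a c i (\<lambda>_. b) x = 0"
  by (simp add: wirtinger_def chart_deriv_const)

lemma chart_smooth_wirtinger:
  "c \<in> A \<Longrightarrow> open W \<Longrightarrow> chart_smooth_on c W f \<Longrightarrow> chart_smooth_on c W (wirtinger a c i f)"
  unfolding wirtinger_def[abs_def]
  by (intro chart_smooth_bounded_linear[OF bounded_linear_divide] chart_smooth_add chart_smooth_mult
      chart_smooth_const chart_smooth_deriv) auto

lemma wirtinger_add:
  assumes "c \<in> A" "x \<in> fst c" "x \<in> W" "chart_smooth_on c W f" "chart_smooth_on c W g"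
  shows "wirtinger a c i (\<lambda>x. f x + g x) x = wirtinger a c i f x + wirtinger a c i g x"
  by (simp add: wirtinger_def chart_deriv_add[OF assms] field_simps)

lemma wirtinger_mult:
  assumes "c \<in> A" "x \<in> fst c" "x \<in> W" "chart_smooth_on c W f" "chart_smooth_on c W g"
  shows "wirtinger a c i (\<lambda>x. f x * g x) x = wirtinger a c i f x * g x + f x * wirtinger a c i g x"
  by (simp add: wirtinger_def chart_deriv_bounded_bilinear[OF bounded_bilinear_mult assms] field_simps)

lemma wirtinger_minus:
  assumes "c \<in> A" "x \<in> fst c" "x \<in> W" "chart_smooth_on c W f"
  shows "wirtinger a c i (\<lambda>x. - f x) x = - wirtinger a c i f x"
  by (simp add: wirtinger_def chart_deriv_bounded_linear[OF bounded_linear_minus[OF bounded_linear_ident] assms] field_simps)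

lemma wirtinger_cmult:
  assumes "c \<in> A" "x \<in> fst c" "x \<in> W" "chart_smooth_on c W f"
  shows "wirtinger a c i (\<lambda>x. b * f x) x = b * wirtinger a c i f x"
  by (simp add: wirtinger_def chart_deriv_bounded_linear[OF bounded_linear_mult_right assms] field_simps)

lemma wirtinger_sum:
  assumes "c \<in> A" "open W" "x \<in> fst c" "x \<in> W" "\<And>k. k \<in> I \<Longrightarrow> chart_smooth_on c W (f k)"
  shows "wirtinger a c i (\<lambda>x. \<Sum>k\<in>I. f k x) x = (\<Sum>k\<in>I. wirtinger a c i (f k) x)"
  using assms(5)
proof (induction I rule: infinite_finite_induct)
  case (insert k I)
  then show ?case
    using wirtinger_add[OF assms(1,3,4), of "f k" "\<lambda>x. \<Sum>k\<in>I. f k x"] chart_smooth_sum[OF assms(1,2), of I f]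
    by simp
qed (simp_all add: wirtinger_const)

lemma wirtinger_cnj:
  assumes "c \<in> A" "x \<in> fst c" "x \<in> W" "chart_smooth_on c W f"
  shows "wirtinger a c i (\<lambda>x. cnj (f x)) x = cnj (wirtinger (cnj a) c i f x)"
  by (simp add: wirtinger_def chart_deriv_bounded_linear[OF bounded_linear_cnj assms])

lemma wirtinger_commute:
  assumes "c \<in> A" "open W" "chart_smooth_on c W f" "x \<in> fst c" "x \<in> W"
  shows "wirtinger a c i (wirtinger b c j f) x = wirtinger b c j (wirtinger a c i f) x"
proof -
  have d: "chart_deriv c (wirtinger b c j f) x v
      = (chart_deriv c (\<lambda>y. chart_deriv c f y (axis j 1)) x v
         + b * chart_deriv c (\<lambda>y. chart_deriv c f y (axis j \<i>)) x v) / 2" for b j v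
  proof -
    have s: "chart_smooth_on c W (\<lambda>y. chart_deriv c f y u)" for u
      by (rule chart_smooth_deriv[OF assms(1-3)])
    have s2: "chart_smooth_on c W (\<lambda>y. b * chart_deriv c f y u)" for u
      by (intro chart_smooth_mult chart_smooth_const s assms(1,2))
    note r = assms(1,4,5)
    show ?thesis
      unfolding wirtinger_def[abs_def]
      by (subst chart_deriv_bounded_linear[OF bounded_linear_divide r chart_smooth_add[OF assms(1,2) s s2]])
         (simp add: chart_deriv_add[OF r s s2] chart_deriv_bounded_linear[OF bounded_linear_mult_right r s])
  qed
  show ?thesis
    unfolding wirtinger_def[of a c i "wirtinger b c j f"] wirtinger_def[of b c j "wirtinger a c i f"] d
    using chart_deriv_commute[OF assms] by (simp add: field_simps)
qed

text \<open>The decomposition of df into its (1,0) and (0,1) parts, evaluated on \<open>v\<close>;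
  it splits the real chain rule into one for \<open>D_z\<close> and one for
  \<open>D_zbar\<close>.\<close>

lemma chart_deriv_eq_wirtinger:
  assumes "c \<in> A" "x \<in> fst c" "x \<in> W" "chart_smooth_on c W f"
  shows "chart_deriv c f x v = (\<Sum>k\<in>UNIV. D_z c k f x * v $ k + D_zbar c k f x * cnj (v $ k))"
proof -
  note lin = chart_deriv_linear[OF assms(1,4,2,3)]
  have v: "v = (\<Sum>k\<in>UNIV. Re (v $ k) *\<^sub>R axis k 1 + Im (v $ k) *\<^sub>R axis k \<i>)"
    by (simp add: vec_eq_iff complex_eq_iff axis_def if_distrib[of Re] if_distrib[of Im]
        if_distrib[of "\<lambda>t. a * t" for a] sum.distrib cong: if_cong)
  have "chart_deriv c f x v = (\<Sum>k\<in>UNIV. Re (v $ k) *\<^sub>R chart_deriv c f x (axis k 1)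
      + Im (v $ k) *\<^sub>R chart_deriv c f x (axis k \<i>))"
    by (subst v) (simp only: linear_sum[OF lin] linear_add[OF lin] linear_scale[OF lin])
  also have "\<dots> = (\<Sum>k\<in>UNIV. D_z c k f x * v $ k + D_zbar c k f x * cnj (v $ k))"
    by (intro sum.cong refl) (simp add: D_z_def D_zbar_def complex_eq_iff field_simps)
  finally show ?thesis .
qed

end

section \<open>Jacobians of coordinate changes\<close>

context complex_manifold
begin

lemma chart_smooth_coordinate:
  "c \<in> A \<Longrightarrow> d \<in> A \<Longrightarrow> chart_smooth_on c (fst d) (\<lambda>y. snd d y $ k)"
  by (intro chart_smooth_bounded_linear[OF bounded_linear_vec_nth] chart_smooth_coordinates open_chart)

lemma chart_deriv_coordinate:
  "c \<in> A \<Longrightarrow> d \<in> A \<Longrightarrow> x \<in> fst c \<Longrightarrow> x \<in> fst d \<Longrightarrow>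
    chart_deriv c (\<lambda>y. snd d y $ k) x v = chart_deriv c (snd d) x v $ k"
  by (rule chart_deriv_bounded_linear[OF bounded_linear_vec_nth _ _ _ chart_smooth_coordinates])

lemma axis_i: "axis i \<i> = \<i> *s axis i (1::complex)"
  by (simp add: vec_eq_iff axis_def)

text \<open>For a complex linear differential the two halves of the Wirtinger derivative coincide,
  so it is the differential on \<open>axis i 1\<close>.\<close>

lemma jacobian_eq:
  "c \<in> A \<Longrightarrow> d \<in> A \<Longrightarrow> x \<in> fst c \<Longrightarrow> x \<in> fst d \<Longrightarrow>
    jacobian c d k i x = chart_deriv c (snd d) x (axis i 1) $ k"
  by (simp add: jacobian_def D_z_def chart_deriv_coordinate axis_i chart_deriv_change_i)

text \<open>The Cauchy-Riemann equations: complex linearity makes the two terms of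
  \<open>D_zbar\<close> opposite.\<close>

lemma D_zbar_coordinate:
  "c \<in> A \<Longrightarrow> d \<in> A \<Longrightarrow> x \<in> fst c \<Longrightarrow> x \<in> fst d \<Longrightarrow> D_zbar c i (\<lambda>y. snd d y $ k) x = 0"
  by (simp add: D_zbar_def chart_deriv_coordinate axis_i chart_deriv_change_i)

lemma chart_deriv_change_nth:
  assumes "c \<in> A" "d \<in> A" "x \<in> fst c" "x \<in> fst d"
  shows "chart_deriv c (snd d) x v $ k = (\<Sum>i\<in>UNIV. jacobian c d k i x * v $ i)"
proof -
  have "chart_deriv c (snd d) x v = chart_deriv c (snd d) x (\<Sum>i\<in>UNIV. v $ i *s axis i 1)"
    by (simp add: basis_expansion)
  also have "\<dots> = (\<Sum>i\<in>UNIV. v $ i *s chart_deriv c (snd d) x (axis i 1))"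
    by (simp add: linear_sum[OF chart_deriv_change_linear[OF assms]] chart_deriv_change_scale[OF assms])
  finally show ?thesis by (simp add: jacobian_eq[OF assms] mult.commute)
qed

lemma jacobian_inverse:
  assumes "c \<in> A" "d \<in> A" "x \<in> fst c" "x \<in> fst d"
  shows "(\<Sum>k\<in>UNIV. jacobian d c l k x * jacobian c d k i x) = (if l = i then 1 else 0)"
proof -
  have "(\<Sum>k\<in>UNIV. jacobian d c l k x * jacobian c d k i x)
      = chart_deriv d (snd c) x (chart_deriv c (snd d) x (axis i 1)) $ l"
    unfolding chart_deriv_change_nth[OF assms(2,1,4,3)] by (simp add: jacobian_eq[OF assms])
  also have "\<dots> = (if l = i then 1 else 0)"
    by (simp add: chart_deriv_inverse[OF assms] axis_def)
  finally show ?thesis .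
qed

lemma chart_smooth_jacobian: "c \<in> A \<Longrightarrow> d \<in> A \<Longrightarrow> chart_smooth_on c (fst d) (jacobian c d k i)"
  unfolding jacobian_def[abs_def] D_z_wirtinger
  by (rule chart_smooth_wirtinger[OF _ open_chart chart_smooth_coordinate])

text \<open>The entries are derivatives of holomorphic functions. Hence the Jacobian acts as a
  constant under \<open>D_zbar\<close> when (0,1)-derivatives are transformed.\<close>

lemma D_zbar_jacobian:
  assumes "c \<in> A" "d \<in> A" "x \<in> fst c" "x \<in> fst d"
  shows "D_zbar c j (jacobian c d k i) x = 0"
proof -
  note s = chart_smooth_coordinate[OF assms(1,2)]
  have "D_zbar c j (jacobian c d k i) x = D_z c i (D_zbar c j (\<lambda>y. snd d y $ k)) x"
    unfolding jacobian_def[abs_def] D_z_wirtinger D_zbar_wirtinger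
    by (rule wirtinger_commute[OF assms(1) open_chart[OF assms(2)] s assms(3,4)])
  also have "\<dots> = D_z c i (\<lambda>_. 0) x"
    unfolding D_z_wirtinger
    by (rule wirtinger_cong[OF assms(1) open_chart[OF assms(2)] chart_smooth_const[OF assms(1) open_chart[OF assms(2)]] assms(3,4)])
       (simp add: D_zbar_coordinate assms)
  also have "\<dots> = 0" by (simp add: D_z_wirtinger wirtinger_const)
  finally show ?thesis .
qed

text \<open>Since the differential of the coordinate change commutes with \<open>\<i>\<close>, the
  \<open>D_zbar d\<close> terms from \<open>axis i 1\<close> and \<open>axis i \<i>\<close> cancel,
  and types are not mixed.\<close>

lemma D_z_change:
  assumes "c \<in> A" "d \<in> A" "x \<in> fst c" "x \<in> fst d" "open W" "x \<in> W" "chart_smooth_on d W f"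
  shows "D_z c i f x = (\<Sum>a\<in>UNIV. D_z d a f x * jacobian c d a i x)"
proof -
  have "chart_deriv c f x v = (\<Sum>a\<in>UNIV. D_z d a f x * chart_deriv c (snd d) x v $ a
      + D_zbar d a f x * cnj (chart_deriv c (snd d) x v $ a))" for v
    using chart_deriv_chain[OF assms(2,1,5,7,4,3,6), of v] chart_deriv_eq_wirtinger[OF assms(2,4,6,7)]
    by simp
  then show ?thesis
    unfolding D_z_def[of c]
    by (simp add: axis_i chart_deriv_change_i[OF assms(1-4)] jacobian_eq[OF assms(1-4)]
        sum_distrib_left sum_divide_distrib flip: sum_subtractf)
       (auto intro!: sum.cong simp: field_simps)
qed

lemma D_zbar_change:
  assumes "c \<in> A" "d \<in> A" "x \<in> fst c" "x \<in> fst d" "open W" "x \<in> W" "chart_smooth_on d W f"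
  shows "D_zbar c i f x = (\<Sum>a\<in>UNIV. D_zbar d a f x * cnj (jacobian c d a i x))"
proof -
  have "chart_deriv c f x v = (\<Sum>a\<in>UNIV. D_z d a f x * chart_deriv c (snd d) x v $ a
      + D_zbar d a f x * cnj (chart_deriv c (snd d) x v $ a))" for v
    using chart_deriv_chain[OF assms(2,1,5,7,4,3,6), of v] chart_deriv_eq_wirtinger[OF assms(2,4,6,7)]
    by simp
  then show ?thesis
    unfolding D_zbar_def[of c]
    by (simp add: axis_i chart_deriv_change_i[OF assms(1-4)] jacobian_eq[OF assms(1-4)]
        sum_distrib_left sum_divide_distrib flip: sum.distrib)
       (auto intro!: sum.cong simp: field_simps)
qed

section \<open>Vector fields\<close>

lemma vfield_on_smooth: "vfield_on A W X \<Longrightarrow> c \<in> A \<Longrightarrow> chart_smooth_on c W (X c)"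
  by (simp add: vfield_on_def)

lemma vfield_on_change:
  "vfield_on A W X \<Longrightarrow> c \<in> A \<Longrightarrow> d \<in> A \<Longrightarrow> x \<in> fst c \<Longrightarrow> x \<in> fst d \<Longrightarrow> x \<in> W \<Longrightarrow>
    X d x = chart_deriv c (snd d) x (X c x)"
  unfolding vfield_on_def by blast

lemma vfield_onI:
  assumes "\<And>c. c \<in> A \<Longrightarrow> chart_smooth_on c W (X c)"
    "\<And>c d x. c \<in> A \<Longrightarrow> d \<in> A \<Longrightarrow> x \<in> fst c \<Longrightarrow> x \<in> fst d \<Longrightarrow> x \<in> W \<Longrightarrow>
      X d x = chart_deriv c (snd d) x (X c x)"
  shows "vfield_on A W X"
  using assms unfolding vfield_on_def by blast

lemma vfield_on_cong:
  assumes "open W" "vfield_on A W X" "vf_eq_on A W X Y"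
  shows "vfield_on A W Y"
proof -
  have eq: "X c x = Y c x" if "c \<in> A" "x \<in> fst c" "x \<in> W" for c x
    using assms(3) that by (simp add: vf_eq_on_def)
  have "chart_smooth_on c W (Y c)" if "c \<in> A" for c
    by (rule chart_smooth_cong[OF that assms(1) vfield_on_smooth[OF assms(2) that] eq[OF that]])
  moreover have "Y d x = chart_deriv c (snd d) x (Y c x)"
    if "c \<in> A" "d \<in> A" "x \<in> fst c" "x \<in> fst d" "x \<in> W" for c d x
    using vfield_on_change[OF assms(2) that] eq that by metis
  ultimately show ?thesis by (rule vfield_onI)
qed

lemma vfield_on_add:
  assumes W: "open W" and X: "vfield_on A W X" and Y: "vfield_on A W Y"
  shows "vfield_on A W (X + Y)"
proof (rule vfield_onI, goal_cases)
  case (1 c)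
  then show ?case
    unfolding plus_fun_def by (intro chart_smooth_add W vfield_on_smooth[OF X] vfield_on_smooth[OF Y])
next
  case (2 c d x)
  then show ?case
    by (simp add: linear_add[OF chart_deriv_change_linear[OF 2(1-4)]]
        vfield_on_change[OF X 2] vfield_on_change[OF Y 2])
qed

lemma vfield_on_scale:
  assumes W: "open W" and f: "smooth_fun_on A W f" and X: "vfield_on A W X"
  shows "vfield_on A W (vf_scale f X)"
proof (rule vfield_onI, goal_cases)
  case (1 c)
  then show ?case
    using f unfolding vf_scale_def smooth_fun_on_def
    by (intro chart_smooth_scaleR W vfield_on_smooth[OF X]) auto
next
  case (2 c d x)
  then show ?case
    by (simp add: vf_scale_def linear_scale[OF chart_deriv_change_linear[OF 2(1-4)]] vfield_on_change[OF X 2])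
qed

lemma vfield_on_zero: "open W \<Longrightarrow> vfield_on A W 0"
  by (rule vfield_onI) (auto simp: zero_fun_def linear_0[OF chart_deriv_change_linear] intro: chart_smooth_const)

lemma vfield_on_minus:
  assumes W: "open W" and X: "vfield_on A W X"
  shows "vfield_on A W (- X)"
proof (rule vfield_onI, goal_cases)
  case (1 c)
  then show ?case
    unfolding fun_Compl_def by (intro chart_smooth_minus W vfield_on_smooth[OF X])
next
  case (2 c d x)
  then show ?case
    by (simp add: linear_neg[OF chart_deriv_change_linear[OF 2(1-4)]] vfield_on_change[OF X 2])
qed

lemma vfield_on_diff: "open W \<Longrightarrow> vfield_on A W X \<Longrightarrow> vfield_on A W Y \<Longrightarrow> vfield_on A W (X - Y)"
  using vfield_on_add[OF _ _ vfield_on_minus, of W X Y] by simp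

lemma vfield_on_coord_field:
  assumes "c \<in> A"
  shows "vfield_on A (fst c) (coord_field c v)"
proof -
  have "chart_smooth_on d (fst c) (\<lambda>x. chart_deriv c (snd d) x v)" if d: "d \<in> A" for d
    using chart_smooth_change[OF assms d open_chart[OF d]
        chart_smooth_deriv[OF assms open_chart[OF d] chart_smooth_coordinates[OF assms d]]]
    by (rule chart_smooth_subset) auto
  moreover have "chart_deriv c (snd e) x v = chart_deriv d (snd e) x (chart_deriv c (snd d) x v)"
    if "d \<in> A" "e \<in> A" "x \<in> fst d" "x \<in> fst e" "x \<in> fst c" for d e x
    using that assms
    by (intro chart_deriv_chain[where W = "fst e"] open_chart chart_smooth_coordinates)
  ultimately show ?thesis unfolding coord_field_def by (rule vfield_onI)
qed

lemma coord_field_self: "c \<in> A \<Longrightarrow> x \<in> fst c \<Longrightarrow> coord_field c v c x = v"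
  by (simp add: coord_field_def chart_deriv_self)

text \<open>The components of a coordinate field in \<open>d\<close> are first derivatives of the
  coordinate change, so the bracket is a difference of mixed second derivatives taken in
  \<open>c\<close>.\<close>

lemma lie_bracket_coord_field:
  assumes "c \<in> A" "d \<in> A" "x \<in> fst c" "x \<in> fst d"
  shows "lie_bracket (coord_field c v) (coord_field c w) d x = 0"
proof -
  have "chart_deriv d (coord_field c w d) x (coord_field c v d x)
      = chart_deriv c (\<lambda>y. chart_deriv c (snd d) y w) x v" for v w
    unfolding coord_field_def
    using chart_deriv_chain[OF assms(1,2) open_chart[OF assms(2)]
        chart_smooth_deriv[OF assms(1) open_chart[OF assms(2)] chart_smooth_coordinates[OF assms(1,2)]] assms(3,4,4)]
    by (simp add: chart_deriv_inverse[OF assms])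
  then show ?thesis
    using chart_deriv_commute[OF assms(1) open_chart[OF assms(2)] chart_smooth_coordinates[OF assms(1,2)] assms(3,4)]
    by (simp add: lie_bracket_def)
qed

lemma smooth_fun_on_chart:
  assumes "c \<in> A" "chart_smooth_on c UNIV f"
  shows "smooth_fun_on A (fst c) f"
  unfolding smooth_fun_on_def
  using chart_smooth_change[OF assms(1) _ open_UNIV assms(2)] by simp

lemma vf_eq_on_refl: "vf_eq_on A W X X"
  by (simp add: vf_eq_on_def)

lemma vf_eq_on_add: "vf_eq_on A W X X' \<Longrightarrow> vf_eq_on A W Y Y' \<Longrightarrow> vf_eq_on A W (X + Y) (X' + Y')"
  by (simp add: vf_eq_on_def)

lemma vf_eq_on_diff: "vf_eq_on A W X X' \<Longrightarrow> vf_eq_on A W Y Y' \<Longrightarrow> vf_eq_on A W (X - Y) (X' - Y')"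
  by (simp add: vf_eq_on_def)

section \<open>Complexified fields\<close>

lemma cvfield_on_add: "open W \<Longrightarrow> cvfield_on A W X \<Longrightarrow> cvfield_on A W Y \<Longrightarrow> cvfield_on A W (X + Y)"
  by (simp add: cvfield_on_def vfield_on_add)

lemma cvfield_on_zero: "open W \<Longrightarrow> cvfield_on A W 0"
  by (simp add: cvfield_on_def vfield_on_zero)

lemma cvfield_on_sum:
  "open W \<Longrightarrow> (\<And>k. k \<in> K \<Longrightarrow> cvfield_on A W (X k)) \<Longrightarrow> cvfield_on A W (\<Sum>k\<in>K. X k)"
  by (induction K rule: infinite_finite_induct) (auto intro: cvfield_on_zero cvfield_on_add)

lemma cvfield_on_scale:
  "open W \<Longrightarrow> smooth_fun_on A W (\<lambda>x. Re (f x)) \<Longrightarrow> smooth_fun_on A W (\<lambda>x. Im (f x)) \<Longrightarrow>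
    cvfield_on A W X \<Longrightarrow> cvfield_on A W (cvf_scale f X)"
  by (simp add: cvfield_on_def cvf_scale_def vfield_on_scale vfield_on_add vfield_on_diff)

lemma cvfield_on_d_z: "c \<in> A \<Longrightarrow> cvfield_on A (fst c) (d_z c i)"
  by (simp add: cvfield_on_def d_z_def vfield_on_coord_field)

lemma cvfield_on_d_zbar: "c \<in> A \<Longrightarrow> cvfield_on A (fst c) (d_zbar c i)"
  by (simp add: cvfield_on_def d_zbar_def vfield_on_coord_field)

lemma cvf_eq_on_refl: "cvf_eq_on A W X X"
  by (simp add: cvf_eq_on_def vf_eq_on_refl)

lemma cvf_eq_on_sym: "cvf_eq_on A W X Y \<Longrightarrow> cvf_eq_on A W Y X"
  by (simp add: cvf_eq_on_def vf_eq_on_def)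

lemma cvf_eq_on_trans: "cvf_eq_on A W X Y \<Longrightarrow> cvf_eq_on A W Y Z \<Longrightarrow> cvf_eq_on A W X Z"
  by (simp add: cvf_eq_on_def vf_eq_on_def)

lemma lie_bracket_coordinate_fields:
  assumes "c \<in> A" "X = d_z c i \<or> X = d_zbar c i" "Y = d_z c j \<or> Y = d_zbar c j"
  shows "cvf_eq_on A (fst c) (complexify lie_bracket X Y) 0"
  using assms(2,3)
  by (auto simp: cvf_eq_on_def vf_eq_on_def complexify_def d_z_def d_zbar_def
      lie_bracket_coord_field[OF assms(1)])

end

section \<open>Complexified connections\<close>

locale connection = complex_manifold A
  for A :: "('m::{t2_space, second_countable_topology}, 'n::finite) chart set" +
  fixes D :: "('m, 'n) connection"
  assumes real_connection: "real_connection A D"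
begin

lemmas connection_axioms_split = real_connection[unfolded real_connection_def]

lemma vfield_on_D:
  "open W \<Longrightarrow> vfield_on A W X \<Longrightarrow> vfield_on A W Y \<Longrightarrow> vfield_on A W (D X Y)"
  by (rule connection_axioms_split[THEN conjunct1, rule_format])

lemma D_cong:
  assumes "open W" "vfield_on A W X" "vfield_on A W Y" "vf_eq_on A W X X'" "vf_eq_on A W Y Y'"
  shows "vf_eq_on A W (D X Y) (D X' Y')"
  by (rule connection_axioms_split[THEN conjunct2, THEN conjunct1, rule_format, OF assms(1,2)
        vfield_on_cong[OF assms(1,2,4)] assms(3) vfield_on_cong[OF assms(1,3,5)] assms(4,5)])

lemma D_add_left:
  "open W \<Longrightarrow> vfield_on A W X \<Longrightarrow> vfield_on A W X' \<Longrightarrow> vfield_on A W Y \<Longrightarrow>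
    vf_eq_on A W (D (X + X') Y) (D X Y + D X' Y)"
  by (rule connection_axioms_split[THEN conjunct2, THEN conjunct2, THEN conjunct1, rule_format])

lemma D_add_right:
  "open W \<Longrightarrow> vfield_on A W X \<Longrightarrow> vfield_on A W Y \<Longrightarrow> vfield_on A W Y' \<Longrightarrow>
    vf_eq_on A W (D X (Y + Y')) (D X Y + D X Y')"
  by (rule connection_axioms_split[THEN conjunct2, THEN conjunct2, THEN conjunct2, THEN conjunct1, rule_format])

lemma D_leibniz:
  assumes "open W" "smooth_fun_on A W f" "vfield_on A W X" "vfield_on A W Y" "c \<in> A" "x \<in> fst c" "x \<in> W"
  shows "D X (vf_scale f Y) c x = chart_deriv c f x (X c x) *\<^sub>R Y c x + f x *\<^sub>R D X Y c x"
  using connection_axioms_split[THEN conjunct2, THEN conjunct2, THEN conjunct2, THEN conjunct2,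
      rule_format, OF assms(1-4), THEN conjunct2] assms(5-7)
  by (simp add: vf_eq_on_def)

lemma D_diff_right:
  assumes "open W" "vfield_on A W X" "vfield_on A W Y" "vfield_on A W Y'"
  shows "vf_eq_on A W (D X (Y - Y')) (D X Y - D X Y')"
  using D_add_right[OF assms(1,2) vfield_on_diff[OF assms(1,3,4)] assms(4)]
  by (auto simp: vf_eq_on_def)

lemma D_zero_right: "open W \<Longrightarrow> vfield_on A W X \<Longrightarrow> vf_eq_on A W (D X 0) 0"
  using D_diff_right[of W X 0 0] vfield_on_zero[of W] by simp

lemma D_minus_right: "open W \<Longrightarrow> vfield_on A W X \<Longrightarrow> vfield_on A W Y \<Longrightarrow> vf_eq_on A W (D X (- Y)) (- D X Y)"
  using D_diff_right[of W X 0 Y] vfield_on_zero[of W] D_zero_right[of W X] by (simp add: vf_eq_on_def)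

lemma D_zero_left: "open W \<Longrightarrow> vfield_on A W Y \<Longrightarrow> vf_eq_on A W (D 0 Y) 0"
  using D_add_left[of W 0 0 Y] vfield_on_zero[of W] by (simp add: vf_eq_on_def)

lemma cvfield_on_complexify:
  "open W \<Longrightarrow> cvfield_on A W X \<Longrightarrow> cvfield_on A W Y \<Longrightarrow> cvfield_on A W (complexify D X Y)"
  by (simp add: complexify_def cvfield_on_def vfield_on_D vfield_on_add vfield_on_diff)

lemma complexify_cong:
  assumes "open W" "cvfield_on A W X" "cvfield_on A W Y" "cvf_eq_on A W X X'" "cvf_eq_on A W Y Y'"
  shows "cvf_eq_on A W (complexify D X Y) (complexify D X' Y')"
  using assms(2-) unfolding complexify_def cvfield_on_def cvf_eq_on_def fst_conv snd_conv
  by (intro conjI vf_eq_on_add vf_eq_on_diff D_cong[OF assms(1)]) auto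

text \<open>Meant for the bracket of two coordinate fields, which is known to vanish only on the
  chart domain.\<close>

lemma complexify_zero_left:
  assumes "open W" "cvfield_on A W Y" "cvf_eq_on A W X 0"
  shows "cvf_eq_on A W (complexify D X Y) 0"
proof (rule cvf_eq_on_trans[OF cvf_eq_on_sym])
  show "cvf_eq_on A W (complexify D 0 Y) (complexify D X Y)"
    using assms by (intro complexify_cong cvfield_on_zero cvf_eq_on_refl) (auto intro: cvf_eq_on_sym)
  show "cvf_eq_on A W (complexify D 0 Y) 0"
    using D_zero_left[OF assms(1)] assms(2)
    by (simp add: complexify_def cvfield_on_def cvf_eq_on_def vf_eq_on_def)
qed

lemma complexify_add_right:
  assumes "open W" "cvfield_on A W X" "cvfield_on A W Y" "cvfield_on A W Y'"
  shows "cvf_eq_on A W (complexify D X (Y + Y')) (complexify D X Y + complexify D X Y')"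
  using D_add_right[OF assms(1)] assms(2-)
  by (simp add: complexify_def cvfield_on_def cvf_eq_on_def vf_eq_on_def algebra_simps)

lemma complexify_zero_right:
  assumes "open W" "cvfield_on A W X"
  shows "cvf_eq_on A W (complexify D X 0) 0"
  using D_zero_right[OF assms(1)] assms(2)
  by (simp add: complexify_def cvfield_on_def cvf_eq_on_def vf_eq_on_def)

lemma complexify_sum_right:
  assumes "open W" "cvfield_on A W X" "\<And>k. k \<in> K \<Longrightarrow> cvfield_on A W (Y k)"
  shows "cvf_eq_on A W (complexify D X (\<Sum>k\<in>K. Y k)) (\<Sum>k\<in>K. complexify D X (Y k))"
  using assms(3)
proof (induction K rule: infinite_finite_induct)
  case (insert k K)
  have "cvf_eq_on A W (complexify D X (Y k + (\<Sum>k\<in>K. Y k)))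
      (complexify D X (Y k) + complexify D X (\<Sum>k\<in>K. Y k))"
    using insert.prems by (intro complexify_add_right cvfield_on_sum assms(1,2)) auto
  then show ?case using insert by (simp add: cvf_eq_on_def vf_eq_on_def)
qed (auto intro: complexify_zero_right assms)

text \<open>This is Xf for a complexified field \<open>X\<close> and a complex function
  \<open>f\<close>; the chart is a parameter because the components of \<open>X\<close> are read in
  it.\<close>

definition cderiv :: "('m, 'n) cvfield \<Rightarrow> ('m, 'n) chart \<Rightarrow> ('m \<Rightarrow> complex) \<Rightarrow> 'm \<Rightarrow> complex" where
  "cderiv X c f x = chart_deriv c f x (fst X c x) + \<i> * chart_deriv c f x (snd X c x)"

text \<open>Real and imaginary parts of \<open>f\<close> and of the fields produce four real Leibniz
  rules per component. The two components are compared only in the chart \<open>c\<close> at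
  \<open>x\<close>, where \<open>cderiv X c f\<close> is evaluated.\<close>

lemma complexify_leibniz:
  assumes W: "open W" and X: "cvfield_on A W X" and Y: "cvfield_on A W Y"
    and f: "smooth_fun_on A W (\<lambda>x. Re (f x))" "smooth_fun_on A W (\<lambda>x. Im (f x))"
    and c: "c \<in> A" "x \<in> fst c" "x \<in> W" and fc: "chart_smooth_on c W f"
  shows "fst (complexify D X (cvf_scale f Y)) c x
      = fst (cvf_scale (cderiv X c f) Y + cvf_scale f (complexify D X Y)) c x"
    and "snd (complexify D X (cvf_scale f Y)) c x
      = snd (cvf_scale (cderiv X c f) Y + cvf_scale f (complexify D X Y)) c x"
proof -
  have Xs: "vfield_on A W (fst X)" "vfield_on A W (snd X)"
    and Ys: "vfield_on A W (fst Y)" "vfield_on A W (snd Y)"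
    using X Y by (auto simp: cvfield_on_def)
  note sc = vfield_on_scale[OF W]
  have diff: "D Z (vf_scale p U - vf_scale q V) c x = D Z (vf_scale p U) c x - D Z (vf_scale q V) c x"
    if "vfield_on A W Z" "vfield_on A W U" "vfield_on A W V" "smooth_fun_on A W p" "smooth_fun_on A W q"
    for Z U V p q
    using D_diff_right[OF W that(1) sc[OF that(4,2)] sc[OF that(5,3)]] c by (simp add: vf_eq_on_def)
  have add: "D Z (vf_scale p U + vf_scale q V) c x = D Z (vf_scale p U) c x + D Z (vf_scale q V) c x"
    if "vfield_on A W Z" "vfield_on A W U" "vfield_on A W V" "smooth_fun_on A W p" "smooth_fun_on A W q"
    for Z U V p q
    using D_add_right[OF W that(1) sc[OF that(4,2)] sc[OF that(5,3)]] c by (simp add: vf_eq_on_def)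
  have Re: "chart_deriv c (\<lambda>x. Re (f x)) x v = Re (chart_deriv c f x v)" for v
    by (rule chart_deriv_bounded_linear[OF bounded_linear_Re c fc])
  have Im: "chart_deriv c (\<lambda>x. Im (f x)) x v = Im (chart_deriv c f x v)" for v
    by (rule chart_deriv_bounded_linear[OF bounded_linear_Im c fc])
  show "fst (complexify D X (cvf_scale f Y)) c x
      = fst (cvf_scale (cderiv X c f) Y + cvf_scale f (complexify D X Y)) c x"
    unfolding complexify_def cvf_scale_def
    by (simp add: diff add Xs Ys f D_leibniz[OF W] c Re Im)
       (simp add: vf_scale_def cderiv_def algebra_simps)
  show "snd (complexify D X (cvf_scale f Y)) c x
      = snd (cvf_scale (cderiv X c f) Y + cvf_scale f (complexify D X Y)) c x"
    unfolding complexify_def cvf_scale_def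
    by (simp add: diff add Xs Ys f D_leibniz[OF W] c Re Im)
       (simp add: vf_scale_def cderiv_def algebra_simps)
qed

end

section \<open>Hermitian metrics\<close>

locale hermitian = complex_manifold A
  for A :: "('m::{t2_space, second_countable_topology}, 'n::finite) chart set" +
  fixes g :: "('m, 'n) metric"
  assumes hermitian_manifold: "hermitian_manifold A g"
begin

lemma g_bilinear: "c \<in> A \<Longrightarrow> x \<in> fst c \<Longrightarrow> bilinear (g c x)"
  and g_sym: "c \<in> A \<Longrightarrow> x \<in> fst c \<Longrightarrow> g c x v w = g c x w v"
  and g_pos: "c \<in> A \<Longrightarrow> x \<in> fst c \<Longrightarrow> v \<noteq> 0 \<Longrightarrow> g c x v v > 0"
  and g_i: "c \<in> A \<Longrightarrow> x \<in> fst c \<Longrightarrow> g c x (\<i> *s v) (\<i> *s w) = g c x v w"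
  and g_smooth: "c \<in> A \<Longrightarrow> chart_smooth_on c UNIV (\<lambda>x. g c x v w)"
  and g_change: "c \<in> A \<Longrightarrow> d \<in> A \<Longrightarrow> x \<in> fst c \<Longrightarrow> x \<in> fst d \<Longrightarrow>
    g d x (chart_deriv c (snd d) x v) (chart_deriv c (snd d) x w) = g c x v w"
  using hermitian_manifold unfolding hermitian_manifold_def riemannian_metric_def by blast+

text \<open>The sesquilinear form whose components are $h_{i\bar j}$, so that positivity of \<open>g\<close> gives
  invertibility of $(h_{i\bar j})$.\<close>

definition herm :: "('m, 'n) chart \<Rightarrow> 'm \<Rightarrow> complex ^ 'n \<Rightarrow> complex ^ 'n \<Rightarrow> complex" where
  "herm c x v w = Complex (g c x v w) (g c x v (\<i> *s w)) / 2"

text \<open>J is skew for \<open>g\<close>: apply invariance to \<open>v\<close> and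
  \<open>\<i> *s w\<close> and use that J squared is -1.\<close>

lemma g_left_i: "c \<in> A \<Longrightarrow> x \<in> fst c \<Longrightarrow> g c x (\<i> *s v) w = - g c x v (\<i> *s w)"
proof -
  assume c: "c \<in> A" "x \<in> fst c"
  have "\<i> *s (\<i> *s w) = - w" by (simp add: vec_eq_iff)
  then show ?thesis
    using g_i[OF c, of v "\<i> *s w"] bilinear_rneg[OF g_bilinear[OF c]] by simp
qed

text \<open>Invariance and skewness of J merge the four terms of the expanded product in pairs, so
  the factor 1/4 becomes the 1/2 of \<open>herm\<close>.\<close>

lemma h_lo_herm: "c \<in> A \<Longrightarrow> x \<in> fst c \<Longrightarrow> h_lo g c i j x = herm c x (axis i 1) (axis j 1)"
  by (simp add: h_lo_def herm_def metric_ext_def d_z_def d_zbar_def coord_field_self axis_i g_i g_left_i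
      bilinear_lmul[OF g_bilinear] bilinear_rmul[OF g_bilinear] bilinear_lneg[OF g_bilinear] bilinear_rneg[OF g_bilinear] complex_eq_iff)

lemma herm_scale_left:
  assumes "c \<in> A" "x \<in> fst c"
  shows "herm c x (a *s v) w = a * herm c x v w"
proof -
  have "a *s v = Re a *\<^sub>R v + Im a *\<^sub>R (\<i> *s v)"
    by (simp add: vec_eq_iff complex_eq_iff)
  then show ?thesis
    using g_i[OF assms, of v w] g_left_i[OF assms, of v w]
    by (simp add: herm_def bilinear_ladd[OF g_bilinear[OF assms]] bilinear_lmul[OF g_bilinear[OF assms]]
        complex_eq_iff field_simps)
qed

lemma herm_add_left: "c \<in> A \<Longrightarrow> x \<in> fst c \<Longrightarrow> herm c x (u + v) w = herm c x u w + herm c x v w"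
  by (simp add: herm_def bilinear_ladd[OF g_bilinear] complex_eq_iff field_simps)

lemma herm_cnj: "c \<in> A \<Longrightarrow> x \<in> fst c \<Longrightarrow> cnj (herm c x v w) = herm c x w v"
  using g_left_i[of c x v w] g_sym[of c x v w] g_sym[of c x w "\<i> *s v"]
  by (simp add: herm_def complex_eq_iff)

lemma herm_sum_left:
  assumes "c \<in> A" "x \<in> fst c"
  shows "herm c x (\<Sum>i\<in>I. v i) w = (\<Sum>i\<in>I. herm c x (v i) w)"
proof (induction I rule: infinite_finite_induct)
  case (insert i I)
  then show ?case by (simp add: herm_add_left assms)
qed (use herm_scale_left[OF assms, of 0] in auto)

lemma herm_expand_left:
  assumes "c \<in> A" "x \<in> fst c"
  shows "herm c x v w = (\<Sum>i\<in>UNIV. v $ i * herm c x (axis i 1) w)"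
proof -
  have "herm c x v w = herm c x (\<Sum>i\<in>UNIV. v $ i *s axis i 1) w" by (simp add: basis_expansion)
  then show ?thesis by (simp only: herm_sum_left[OF assms] herm_scale_left[OF assms])
qed

lemma herm_expand:
  assumes "c \<in> A" "x \<in> fst c"
  shows "herm c x v w = (\<Sum>i\<in>UNIV. \<Sum>j\<in>UNIV. v $ i * cnj (w $ j) * h_lo g c i j x)"
proof -
  have "herm c x (axis i 1) w = (\<Sum>j\<in>UNIV. cnj (w $ j) * h_lo g c i j x)" for i
  proof -
    have "cnj (herm c x w (axis i 1)) = (\<Sum>j\<in>UNIV. cnj (w $ j) * cnj (herm c x (axis j 1) (axis i 1)))"
      by (subst herm_expand_left[OF assms]) simp
    then show ?thesis by (simp add: herm_cnj[OF assms] h_lo_herm[OF assms])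
  qed
  then show ?thesis
    by (subst herm_expand_left[OF assms]) (simp add: sum_distrib_left mult.assoc)
qed

lemma herm_pos: "c \<in> A \<Longrightarrow> x \<in> fst c \<Longrightarrow> v \<noteq> 0 \<Longrightarrow> herm c x v v \<noteq> 0"
  using g_pos[of c x v] by (simp add: herm_def complex_eq_iff)

lemma cnj_h_lo: "c \<in> A \<Longrightarrow> x \<in> fst c \<Longrightarrow> cnj (h_lo g c i j x) = h_lo g c j i x"
  by (simp add: h_lo_herm herm_cnj)

text \<open>Contracting the kernel equations of \<open>v\<close> with its conjugate gives
  \<open>herm c x v v = 0\<close>, so positivity forces \<open>v = 0\<close>.\<close>

lemma invertible_h_lo:
  assumes "c \<in> A" "x \<in> fst c"
  shows "invertible (transpose (\<chi> a b. h_lo g c a b x))"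
  unfolding invertible_left_inverse matrix_left_invertible_ker
proof (intro allI impI)
  fix v :: "complex ^ 'n"
  assume v: "transpose (\<chi> a b. h_lo g c a b x) *v v = 0"
  have "(\<Sum>i\<in>UNIV. v $ i * h_lo g c i j x) = 0" for j
    using arg_cong[OF v, of "\<lambda>w. w $ j"]
    by (simp add: matrix_vector_mult_def transpose_def mult.commute)
  then have "(\<Sum>j\<in>UNIV. cnj (v $ j) * (\<Sum>i\<in>UNIV. v $ i * h_lo g c i j x)) = 0" by simp
  then have "herm c x v v = 0"
    unfolding herm_expand[OF assms] by (subst sum.swap) (simp add: sum_distrib_left mult_ac)
  then show "v = 0" using herm_pos[OF assms] by blast
qed

text \<open>The two orders of multiplication of the transposed matrix with its inverse: one
  contracts the barred indices, the other the unbarred ones.\<close>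

lemma h_up_inverse:
  assumes "c \<in> A" "x \<in> fst c"
  shows h_up_h_lo: "(\<Sum>l\<in>UNIV. h_up g c i l x * h_lo g c j l x) = (if i = j then 1 else 0)"
    and h_lo_h_up: "(\<Sum>l\<in>UNIV. h_lo g c l i x * h_up g c l j x) = (if i = j then 1 else 0)"
proof -
  let ?H = "transpose (\<chi> a b. h_lo g c a b x)"
  have "?H ** matrix_inv ?H = mat 1 \<and> matrix_inv ?H ** ?H = mat 1"
    using invertible_h_lo[OF assms] unfolding matrix_inv_def invertible_def by (rule someI_ex)
  then have "(?H ** matrix_inv ?H) $ i $ j = mat 1 $ i $ j" "(matrix_inv ?H ** ?H) $ i $ j = mat 1 $ i $ j"
    by simp_all
  then show "(\<Sum>l\<in>UNIV. h_up g c i l x * h_lo g c j l x) = (if i = j then 1 else 0)"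
    "(\<Sum>l\<in>UNIV. h_lo g c l i x * h_up g c l j x) = (if i = j then 1 else 0)"
    by (simp_all add: matrix_matrix_mult_def mat_def transpose_def h_up_def)
qed

text \<open>A left inverse of an invertible matrix is the inverse. This identifies
  \<open>h_up\<close> after conjugation and after a change of chart.\<close>

lemma h_up_unique:
  assumes c: "c \<in> A" and x: "x \<in> fst c"
    and Q: "\<And>i j. (\<Sum>l\<in>UNIV. Q i l * h_lo g c j l x) = (if i = j then 1 else 0)"
  shows "Q i j = h_up g c i j x"
proof -
  have "Q i j = (\<Sum>l\<in>UNIV. Q i l * (\<Sum>k\<in>UNIV. h_lo g c k l x * h_up g c k j x))"
    by (simp add: h_lo_h_up[OF c x] if_distrib[of "\<lambda>t. a * t" for a] cong: if_cong)
  also have "\<dots> = (\<Sum>k\<in>UNIV. (\<Sum>l\<in>UNIV. Q i l * h_lo g c k l x) * h_up g c k j x)"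
    by (simp add: sum_distrib_left sum_distrib_right mult.assoc) (rule sum.swap)
  also have "\<dots> = h_up g c i j x"
    by (simp add: Q if_distrib[of "\<lambda>t. t * a" for a] cong: if_cong)
  finally show ?thesis .
qed

lemma cnj_h_up:
  assumes "c \<in> A" "x \<in> fst c"
  shows "cnj (h_up g c i j x) = h_up g c j i x"
proof (rule h_up_unique[OF assms, of "\<lambda>j i. cnj (h_up g c i j x)"])
  fix i j
  show "(\<Sum>l\<in>UNIV. cnj (h_up g c l i x) * h_lo g c j l x) = (if i = j then 1 else 0)"
    using arg_cong[OF h_lo_h_up[OF assms, of j i], of cnj]
    by (auto simp: cnj_h_lo[OF assms] mult.commute)
qed

lemma chart_smooth_h_lo: "c \<in> A \<Longrightarrow> chart_smooth_on c UNIV (h_lo g c i j)"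
proof -
  assume c: "c \<in> A"
  have "chart_smooth_on c UNIV (\<lambda>x. (of_real (g c x v w) + \<i> * of_real (g c x v' w')) / 2)" for v w v' w'
    by (intro chart_smooth_bounded_linear[OF bounded_linear_divide] chart_smooth_add chart_smooth_mult
        chart_smooth_const chart_smooth_of_real g_smooth c open_UNIV)
  then show ?thesis
    by (rule chart_smooth_cong[OF c open_UNIV])
       (auto simp: h_lo_herm[OF c] herm_def complex_eq_iff intro: refl)
qed

lemma chart_smooth_det:
  fixes M :: "'m \<Rightarrow> complex ^ 'n ^ 'n"
  assumes "c \<in> A" "open W" "\<And>i j. chart_smooth_on c W (\<lambda>x. M x $ i $ j)"
  shows "chart_smooth_on c W (\<lambda>x. det (M x))"
  unfolding det_def
  by (intro chart_smooth_sum chart_smooth_mult chart_smooth_const chart_smooth_prod assms)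

text \<open>Cramer's rule writes the entry as a quotient of determinants, which are polynomials in
  the smooth \<open>h_lo\<close> and constants.\<close>

lemma chart_smooth_h_up:
  assumes c: "c \<in> A"
  shows "chart_smooth_on c UNIV (h_up g c k j)"
proof -
  define H where "H x = transpose (\<chi> a b. h_lo g c a b x)" for x
  define N where "N x = (\<chi> i m. if m = k then axis j 1 $ i else H x $ i $ m)" for x
  have det: "det (H x) \<noteq> 0" if "x \<in> fst c" for x
    using invertible_h_lo[OF c that] by (simp add: H_def invertible_det_nz)
  have H: "chart_smooth_on c UNIV (\<lambda>x. H x $ i $ m)" for i m
    unfolding H_def transpose_def by (simp add: chart_smooth_h_lo c)
  have N: "chart_smooth_on c UNIV (\<lambda>x. N x $ i $ m)" for i m
    unfolding N_def using H chart_smooth_const[OF c open_UNIV] by (cases "m = k") simp_all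
  have "chart_smooth_on c UNIV (\<lambda>x. det (N x) * inverse (det (H x)))"
    using det by (intro chart_smooth_mult chart_smooth_inverse chart_smooth_det c open_UNIV H N)
  then show ?thesis
  proof (rule chart_smooth_cong[OF c open_UNIV])
    fix x assume x: "x \<in> fst c"
    have "H x *v (\<chi> k. h_up g c k j x) = axis j 1"
      using h_lo_h_up[OF c x, of _ j]
      by (simp add: vec_eq_iff matrix_vector_mult_def H_def transpose_def axis_def)
    then show "det (N x) * inverse (det (H x)) = h_up g c k j x"
      unfolding cramer[OF det[OF x]] by (simp add: vec_eq_iff N_def divide_inverse)
  qed
qed

section \<open>Chern symbols and their contraction with the metric\<close>

lemma chart_smooth_chern_Gamma: "c \<in> A \<Longrightarrow> chart_smooth_on c UNIV (chern_Gamma g c i j k)"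
  unfolding chern_Gamma_def[abs_def] D_z_wirtinger
  by (intro chart_smooth_sum chart_smooth_mult chart_smooth_wirtinger chart_smooth_h_lo chart_smooth_h_up open_UNIV)

lemma chern_Gamma_h_lo:
  assumes "c \<in> A" "x \<in> fst c"
  shows "(\<Sum>s\<in>UNIV. chern_Gamma g c i k s x * h_lo g c s l x) = D_z c i (h_lo g c k l) x"
proof -
  have "(\<Sum>s\<in>UNIV. chern_Gamma g c i k s x * h_lo g c s l x)
      = (\<Sum>q\<in>UNIV. (\<Sum>s\<in>UNIV. h_lo g c s l x * h_up g c s q x) * D_z c i (h_lo g c k q) x)"
    unfolding chern_Gamma_def sum_distrib_right by (subst sum.swap) (simp add: mult_ac)
  also have "\<dots> = D_z c i (h_lo g c k l) x"
    by (simp add: h_lo_h_up[OF assms] if_distrib[of "\<lambda>t. t * a" for a] cong: if_cong)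
  finally show ?thesis .
qed

section \<open>Complex bilinear extension of the metric\<close>

lemma metric_ext_add_left: "c \<in> A \<Longrightarrow> x \<in> fst c \<Longrightarrow>
    metric_ext g (X + Y) V c x = metric_ext g X V c x + metric_ext g Y V c x"
  by (simp add: metric_ext_def bilinear_ladd[OF g_bilinear] complex_eq_iff)

lemma metric_ext_diff_left: "c \<in> A \<Longrightarrow> x \<in> fst c \<Longrightarrow>
    metric_ext g (X - Y) V c x = metric_ext g X V c x - metric_ext g Y V c x"
  by (simp add: metric_ext_def bilinear_lsub[OF g_bilinear] complex_eq_iff)

lemma metric_ext_zero_left: "c \<in> A \<Longrightarrow> x \<in> fst c \<Longrightarrow> metric_ext g 0 V c x = 0"
  by (simp add: metric_ext_def bilinear_lzero[OF g_bilinear] complex_eq_iff)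

lemma metric_ext_scale_left: "c \<in> A \<Longrightarrow> x \<in> fst c \<Longrightarrow>
    metric_ext g (cvf_scale f X) V c x = f x * metric_ext g X V c x"
  by (simp add: metric_ext_def cvf_scale_def vf_scale_def bilinear_lsub[OF g_bilinear] bilinear_ladd[OF g_bilinear]
      bilinear_lmul[OF g_bilinear] complex_eq_iff algebra_simps)

lemma metric_ext_sum_left:
  assumes "c \<in> A" "x \<in> fst c"
  shows "metric_ext g (\<Sum>k\<in>K. X k) V c x = (\<Sum>k\<in>K. metric_ext g (X k) V c x)"
  by (induction K rule: infinite_finite_induct)
     (auto simp: metric_ext_zero_left metric_ext_add_left assms)

lemma metric_ext_cong_left:
  "fst X c x = fst Y c x \<Longrightarrow> snd X c x = snd Y c x \<Longrightarrow> metric_ext g X V c x = metric_ext g Y V c x"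
  by (simp add: metric_ext_def)

lemma metric_ext_cvf_eq:
  "c \<in> A \<Longrightarrow> x \<in> fst c \<Longrightarrow> cvf_eq_on A (fst c) X Y \<Longrightarrow> metric_ext g X V c x = metric_ext g Y V c x"
  by (rule metric_ext_cong_left) (auto simp: cvf_eq_on_def vf_eq_on_def)

end

section \<open>Sections of the holomorphic tangent bundle\<close>

context complex_manifold
begin

text \<open>Multiplying a pair (V, W) by \<open>\<i>\<close> gives (-W, V); the eigenvalue equation
  becomes JV = -W and JW = V.\<close>

lemma T10_sections_iff:
  "Z \<in> T10_sections A W \<longleftrightarrow>
     cvfield_on A W Z \<and> vf_eq_on A W (vf_J (fst Z)) (- snd Z) \<and> vf_eq_on A W (vf_J (snd Z)) (fst Z)"
  by (simp add: T10_sections_def cvf_eq_on_def cvf_scale_def vf_scale_def vf_eq_on_def)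

lemma d_z_T10: "c \<in> A \<Longrightarrow> d_z c i \<in> T10_sections A (fst c)"
proof -
  assume c: "c \<in> A"
  have *: "(1 / 2) *\<^sub>R axis i \<i> = \<i> *s ((1 / 2) *\<^sub>R axis i (1::complex))"
    "- ((1 / 2) *\<^sub>R axis i 1) = \<i> *s ((1 / 2) *\<^sub>R axis i \<i>)"
    by (auto simp: vec_eq_iff axis_def complex_eq_iff)
  have "\<i> *s chart_deriv c (snd d) x ((1/2) *\<^sub>R axis i 1) = chart_deriv c (snd d) x ((1 / 2) *\<^sub>R axis i \<i>)"
    "\<i> *s chart_deriv c (snd d) x ((1/2) *\<^sub>R axis i \<i>) = - chart_deriv c (snd d) x ((1 / 2) *\<^sub>R axis i 1)"
    if "d \<in> A" "x \<in> fst c" "x \<in> fst d" for d x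
    using chart_deriv_change_i[OF c that] linear_neg[OF chart_deriv_change_linear[OF c that]] *
    by metis+
  then show ?thesis
    using c cvfield_on_d_z[OF c, of i]
    by (auto simp: T10_sections_iff vf_eq_on_def vf_J_def d_z_def coord_field_def
        linear_neg[OF chart_deriv_change_linear[OF c]] vec_eq_iff)
qed

end

text \<open>\<open>D\<close> commutes with J on real fields, hence its complexification preserves
  the eigenbundle. This lets \<open>hat_connection\<close> be iterated without leaving its
  domain.\<close>

lemma (in connection) complexify_T10:
  assumes J: "preserves_J A D" and W: "open W" and X: "cvfield_on A W X" and Z: "Z \<in> T10_sections A W"
  shows "complexify D X Z \<in> T10_sections A W"
proof -
  have Zf: "cvfield_on A W Z" and ZJ: "vf_eq_on A W (vf_J (fst Z)) (- snd Z)" "vf_eq_on A W (vf_J (snd Z)) (fst Z)"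
    using Z by (auto simp: T10_sections_iff)
  have v: "vfield_on A W (fst X)" "vfield_on A W (snd X)" "vfield_on A W (fst Z)" "vfield_on A W (snd Z)"
    using X Zf by (auto simp: cvfield_on_def)
  have sym: "vf_eq_on A W Q P" if "vf_eq_on A W P Q" for P Q using that by (simp add: vf_eq_on_def)
  \<comment> \<open>For real directions the relations JV = -W and JW = V pass to the derivatives of
    V and W; the complex direction \<open>X\<close> follows by combining its two parts.\<close>
  have J1: "vf_eq_on A W (vf_J (D U (fst Z))) (- D U (snd Z))" if U: "vfield_on A W U" for U
  proof -
    have "vf_eq_on A W (D U (vf_J (fst Z))) (vf_J (D U (fst Z)))"
      using J W U v unfolding preserves_J_def by blast
    moreover have "vf_eq_on A W (D U (- snd Z)) (D U (vf_J (fst Z)))"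
      by (intro D_cong W U vfield_on_minus v vf_eq_on_refl sym[OF ZJ(1)])
    moreover note D_minus_right[OF W U v(4)]
    ultimately show ?thesis by (simp add: vf_eq_on_def)
  qed
  have J2: "vf_eq_on A W (vf_J (D U (snd Z))) (D U (fst Z))" if U: "vfield_on A W U" for U
  proof -
    have "vf_eq_on A W (D U (vf_J (snd Z))) (vf_J (D U (snd Z)))"
      using J W U v unfolding preserves_J_def by blast
    moreover have "vf_eq_on A W (D U (fst Z)) (D U (vf_J (snd Z)))"
      by (intro D_cong W U v vf_eq_on_refl sym[OF ZJ(2)])
    ultimately show ?thesis by (simp add: vf_eq_on_def)
  qed
  have "vf_J (P - Q) = vf_J P - vf_J Q" "vf_J (P + Q) = vf_J P + vf_J Q" for P Q :: "('m, 'n) vfield"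
    by (auto simp: vf_J_def fun_eq_iff vector_ssub_ldistrib vector_add_ldistrib)
  then show ?thesis
    using cvfield_on_complexify[OF W X Zf] J1[OF v(1)] J1[OF v(2)] J2[OF v(1)] J2[OF v(2)]
    by (simp add: T10_sections_iff complexify_def vf_eq_on_def)
qed

section \<open>Curvature\<close>

locale theta_connection = hermitian A g + connection A D
  for A :: "('m::{t2_space, second_countable_topology}, 'n::finite) chart set"
    and g :: "('m, 'n) metric" and D :: "('m, 'n) connection" +
  fixes \<theta> :: "('m, 'n) tensor12"
  assumes theta_form: "End_valued_10_form A \<theta>"
    and associated: "associated_connection A g \<theta> D"
begin

lemma chart_smooth_theta: "c \<in> A \<Longrightarrow> chart_smooth_on c UNIV (\<theta> c i j k)"
  using theta_form by (simp add: End_valued_10_form_def)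

text \<open>The coefficients of \<open>D\<close> along $\partial/\partial z^i$ and $\partial/\partial\bar z^i$.\<close>

definition coeff_z :: "('m, 'n) chart \<Rightarrow> 'n \<Rightarrow> 'n \<Rightarrow> 'n \<Rightarrow> 'm \<Rightarrow> complex" where
  "coeff_z c i j k x = chern_Gamma g c i j k x + \<theta> c i j k x"

definition coeff_zbar :: "('m, 'n) chart \<Rightarrow> 'n \<Rightarrow> 'n \<Rightarrow> 'n \<Rightarrow> 'm \<Rightarrow> complex" where
  "coeff_zbar c i j k x = - (\<Sum>p\<in>UNIV. \<Sum>q\<in>UNIV. h_lo g c j q x * h_up g c k p x * cnj (\<theta> c i p q x))"

lemma complexify_d_z_d_z: "c \<in> A \<Longrightarrow>
    cvf_eq_on A (fst c) (complexify D (d_z c i) (d_z c j)) (\<Sum>k\<in>UNIV. cvf_scale (coeff_z c i j k) (d_z c k))"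
  and complexify_d_zbar_d_z: "c \<in> A \<Longrightarrow>
    cvf_eq_on A (fst c) (complexify D (d_zbar c i) (d_z c j)) (\<Sum>k\<in>UNIV. cvf_scale (coeff_zbar c i j k) (d_z c k))"
  using associated unfolding associated_connection_def coeff_z_def[abs_def] coeff_zbar_def[abs_def] by blast+

lemma chart_smooth_coeff_z: "c \<in> A \<Longrightarrow> chart_smooth_on c UNIV (coeff_z c i j k)"
  unfolding coeff_z_def[abs_def]
  by (intro chart_smooth_add chart_smooth_theta chart_smooth_chern_Gamma open_UNIV)

lemma chart_smooth_coeff_zbar: "c \<in> A \<Longrightarrow> chart_smooth_on c UNIV (coeff_zbar c i j k)"
  unfolding coeff_zbar_def[abs_def]
  by (intro chart_smooth_minus chart_smooth_sum chart_smooth_mult chart_smooth_cnj chart_smooth_theta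
      chart_smooth_h_lo chart_smooth_h_up open_UNIV)

text \<open>Leibniz rule for a field expanded in the frame \<open>d_z c k\<close>. It is meant for
  \<open>Z\<close> a first covariant derivative, whose expansion is known only on
  \<open>fst c\<close>; then \<open>F\<close> consists of connection coefficients.\<close>

lemma metric_ext_complexify:
  assumes c: "c \<in> A" and x: "x \<in> fst c" and X: "cvfield_on A (fst c) X"
    and Z: "cvf_eq_on A (fst c) Z (\<Sum>k\<in>UNIV. cvf_scale (F k) (d_z c k))"
    and F: "\<And>k. chart_smooth_on c UNIV (F k)"
  shows "metric_ext g (complexify D X Z) V c x
    = (\<Sum>k\<in>UNIV. cderiv X c (F k) x * metric_ext g (d_z c k) V c x
        + F k x * metric_ext g (complexify D X (d_z c k)) V c x)"
proof -
  note o = open_chart[OF c]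
  have sF: "smooth_fun_on A (fst c) (\<lambda>x. Re (F k x))" "smooth_fun_on A (fst c) (\<lambda>x. Im (F k x))" for k
    by (intro smooth_fun_on_chart c chart_smooth_Re chart_smooth_Im F open_UNIV)+
  have Y: "cvfield_on A (fst c) (cvf_scale (F k) (d_z c k))" for k
    by (intro cvfield_on_scale o sF cvfield_on_d_z c)
  have "metric_ext g (complexify D X Z) V c x
      = metric_ext g (complexify D X (\<Sum>k\<in>UNIV. cvf_scale (F k) (d_z c k))) V c x"
    by (intro metric_ext_cvf_eq c x cvf_eq_on_sym[OF complexify_cong] o X cvfield_on_sum Y cvf_eq_on_refl
        cvf_eq_on_sym[OF Z])
  also have "\<dots> = metric_ext g (\<Sum>k\<in>UNIV. complexify D X (cvf_scale (F k) (d_z c k))) V c x"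
    by (intro metric_ext_cvf_eq c x complexify_sum_right o X Y)
  also have "\<dots> = (\<Sum>k\<in>UNIV. metric_ext g (complexify D X (cvf_scale (F k) (d_z c k))) V c x)"
    by (rule metric_ext_sum_left[OF c x])
  also have "\<dots> = (\<Sum>k\<in>UNIV. metric_ext g (cvf_scale (cderiv X c (F k)) (d_z c k)
      + cvf_scale (F k) (complexify D X (d_z c k))) V c x)"
    by (intro sum.cong refl metric_ext_cong_left
        complexify_leibniz[OF o X cvfield_on_d_z[OF c] sF c x x F[folded chart_smooth_self_iff]])
  finally show ?thesis
    by (simp add: metric_ext_add_left[OF c x] metric_ext_scale_left[OF c x])
qed

lemma cderiv_coordinate_fields:
  assumes c: "c \<in> A" and x: "x \<in> fst c" and f: "chart_smooth_on c UNIV f"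
  shows cderiv_d_z: "cderiv (d_z c i) c f x = D_z c i f x"
    and cderiv_d_zbar: "cderiv (d_zbar c i) c f x = D_zbar c i f x"
proof -
  note l = chart_deriv_linear[OF c f x UNIV_I]
  show "cderiv (d_z c i) c f x = D_z c i f x" "cderiv (d_zbar c i) c f x = D_zbar c i f x"
    unfolding cderiv_def d_z_def d_zbar_def D_z_def D_zbar_def fst_conv snd_conv coord_field_self[OF c x]
      scaleR_minus_left linear_scale[OF l] linear_neg[OF l]
    by (simp_all add: scaleR_conv_of_real field_simps)
qed

lemma metric_ext_d_z_d_zbar: "metric_ext g (d_z c k) (d_zbar c l) c x = h_lo g c k l x"
  by (simp add: h_lo_def)

lemma metric_ext_complexify_d_z:
  assumes c: "c \<in> A" and x: "x \<in> fst c"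
  shows "metric_ext g (complexify D (d_z c i) (d_z c k)) (d_zbar c l) c x = (\<Sum>m\<in>UNIV. coeff_z c i k m x * h_lo g c m l x)"
    and "metric_ext g (complexify D (d_zbar c i) (d_z c k)) (d_zbar c l) c x = (\<Sum>m\<in>UNIV. coeff_zbar c i k m x * h_lo g c m l x)"
  by (simp_all add: metric_ext_cvf_eq[OF c x complexify_d_z_d_z[OF c]]
      metric_ext_cvf_eq[OF c x complexify_d_zbar_d_z[OF c]] metric_ext_sum_left[OF c x]
      metric_ext_scale_left[OF c x] metric_ext_d_z_d_zbar)

text \<open>All sections that \<open>hat_connection\<close> receives here, namely
  \<open>d_z c k\<close> and its derivatives along \<open>X\<close> and \<open>Y\<close>, lie in
  \<open>T10_sections\<close>, where \<open>restrict\<close> changes nothing.\<close>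

lemma curvature_hat:
  assumes c: "c \<in> A" and X: "cvfield_on A (fst c) X" and Y: "cvfield_on A (fst c) Y"
  shows "curvature g (hat_connection A (fst c) D) X Y (d_z c k) V = curvature g (complexify D) X Y (d_z c k) V"
proof -
  have J: "preserves_J A D" using associated by (simp add: associated_connection_def)
  note t = complexify_T10[OF J open_chart[OF c] _ d_z_T10[OF c]]
  show ?thesis
    using t[OF X] t[OF Y] d_z_T10[OF c, of k] by (simp add: curvature_def hat_connection_def)
qed

lemma curvature_coordinate_fields:
  assumes c: "c \<in> A" and x: "x \<in> fst c"
    and X: "X = d_z c i \<or> X = d_zbar c i" and Y: "Y = d_z c j \<or> Y = d_zbar c j"
  shows "curvature g (complexify D) X Y (d_z c k) V c x
    = metric_ext g (complexify D X (complexify D Y (d_z c k))) V c x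
      - metric_ext g (complexify D Y (complexify D X (d_z c k))) V c x"
proof -
  have "metric_ext g (complexify D (complexify lie_bracket X Y) (d_z c k)) V c x = metric_ext g 0 V c x"
    by (intro metric_ext_cvf_eq c x complexify_zero_left open_chart cvfield_on_d_z
        lie_bracket_coordinate_fields[OF c X Y])
  then show ?thesis
    by (simp add: curvature_def metric_ext_diff_left[OF c x] metric_ext_zero_left[OF c x])
qed

lemma curvature_11_expand:
  assumes c: "c \<in> A" and x: "x \<in> fst c"
  shows "curvature g (complexify D) (d_z c i) (d_zbar c j) (d_z c k) (d_zbar c l) c x
    = (\<Sum>m\<in>UNIV. D_z c i (coeff_zbar c j k m) x * h_lo g c m l x + coeff_zbar c j k m x * (\<Sum>s\<in>UNIV. coeff_z c i m s x * h_lo g c s l x))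
    - (\<Sum>m\<in>UNIV. D_zbar c j (coeff_z c i k m) x * h_lo g c m l x + coeff_z c i k m x * (\<Sum>s\<in>UNIV. coeff_zbar c j m s x * h_lo g c s l x))"
  using metric_ext_complexify[OF c x cvfield_on_d_z[OF c] complexify_d_zbar_d_z[OF c] chart_smooth_coeff_zbar[OF c]]
    metric_ext_complexify[OF c x cvfield_on_d_zbar[OF c] complexify_d_z_d_z[OF c] chart_smooth_coeff_z[OF c]]
  by (simp add: curvature_coordinate_fields[OF c x disjI1[OF refl] disjI2[OF refl]]
      cderiv_d_z[OF c x chart_smooth_coeff_zbar[OF c]] cderiv_d_zbar[OF c x chart_smooth_coeff_z[OF c]]
      metric_ext_d_z_d_zbar metric_ext_complexify_d_z[OF c x])

lemma curvature_20_expand: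
  assumes c: "c \<in> A" and x: "x \<in> fst c"
  shows "curvature g (complexify D) (d_z c i) (d_z c j) (d_z c k) (d_zbar c l) c x
    = (\<Sum>m\<in>UNIV. D_z c i (coeff_z c j k m) x * h_lo g c m l x + coeff_z c j k m x * (\<Sum>s\<in>UNIV. coeff_z c i m s x * h_lo g c s l x))
    - (\<Sum>m\<in>UNIV. D_z c j (coeff_z c i k m) x * h_lo g c m l x + coeff_z c i k m x * (\<Sum>s\<in>UNIV. coeff_z c j m s x * h_lo g c s l x))"
  using metric_ext_complexify[OF c x cvfield_on_d_z[OF c] complexify_d_z_d_z[OF c] chart_smooth_coeff_z[OF c]]
  by (simp add: curvature_coordinate_fields[OF c x disjI1[OF refl] disjI1[OF refl]]
      cderiv_d_z[OF c x chart_smooth_coeff_z[OF c]] metric_ext_d_z_d_zbar metric_ext_complexify_d_z[OF c x])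

end

section \<open>Evaluation of the curvature components\<close>

context complex_manifold
begin

lemma wirtinger_sum_mult_on:
  assumes c: "c \<in> A" and W: "open W" and x: "x \<in> fst c" "x \<in> W"
    and F: "\<And>k. chart_smooth_on c W (F k)" and G: "\<And>k. chart_smooth_on c W (G k)"
  shows "wirtinger a c i (\<lambda>y. \<Sum>k\<in>K. F k y * G k y) x
    = (\<Sum>k\<in>K. wirtinger a c i (F k) x * G k x + F k x * wirtinger a c i (G k) x)"
  using wirtinger_sum[OF c W x chart_smooth_mult[OF c W F G]]
  by (simp add: wirtinger_mult[OF c x F G])

lemmas wirtinger_sum_mult = wirtinger_sum_mult_on[OF _ open_UNIV _ UNIV_I]

end

context hermitian
begin

text \<open>The parameter \<open>a\<close> is kept open: \<open>\<i>\<close> serves the Chern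
  curvature, \<open>- \<i>\<close> the (2,0) component of the curvature.\<close>

lemma chern_Gamma_derivative:
  assumes c: "c \<in> A" and x: "x \<in> fst c"
  shows "(\<Sum>s\<in>UNIV. wirtinger a c j (chern_Gamma g c i k s) x * h_lo g c s l x)
    = wirtinger a c j (D_z c i (h_lo g c k l)) x
      - (\<Sum>s\<in>UNIV. chern_Gamma g c i k s x * wirtinger a c j (h_lo g c s l) x)"
proof -
  have "chart_smooth_on c UNIV (D_z c i (h_lo g c k l))"
    unfolding D_z_wirtinger by (intro chart_smooth_wirtinger chart_smooth_h_lo c open_UNIV)
  then have "wirtinger a c j (\<lambda>y. \<Sum>s\<in>UNIV. chern_Gamma g c i k s y * h_lo g c s l y) x
      = wirtinger a c j (D_z c i (h_lo g c k l)) x"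
    by (rule wirtinger_cong[OF c open_UNIV _ x UNIV_I]) (simp add: chern_Gamma_h_lo[OF c])
  then show ?thesis
    by (simp add: wirtinger_sum_mult[OF c x chart_smooth_chern_Gamma[OF c] chart_smooth_h_lo[OF c]] sum.distrib eq_diff_eq)
qed

text \<open>Differentiating the contraction with \<open>h_lo\<close> yields both terms of
  \<open>chern_curv\<close>; the second derivative only has to be put in the order used
  there.\<close>

lemma chern_curv_eq:
  assumes c: "c \<in> A" and x: "x \<in> fst c"
  shows "(\<Sum>s\<in>UNIV. D_zbar c j (chern_Gamma g c i k s) x * h_lo g c s l x) = - chern_curv g c i j k l x"
proof -
  have "D_zbar c j (D_z c i (h_lo g c k l)) x = D_z c i (D_zbar c j (h_lo g c k l)) x"
    unfolding D_zbar_wirtinger D_z_wirtinger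
    by (rule wirtinger_commute[OF c open_UNIV chart_smooth_h_lo[OF c] x UNIV_I])
  moreover have "(\<Sum>s\<in>UNIV. chern_Gamma g c i k s x * D_zbar c j (h_lo g c s l) x)
      = (\<Sum>p\<in>UNIV. \<Sum>q\<in>UNIV. h_up g c p q x * D_zbar c j (h_lo g c p l) x * D_z c i (h_lo g c k q) x)"
    unfolding chern_Gamma_def sum_distrib_right by (intro sum.cong refl) (simp add: mult_ac)
  ultimately show ?thesis
    using chern_Gamma_derivative[OF c x, of \<i> j i k l, folded D_zbar_wirtinger]
    by (simp add: chern_curv_def)
qed

end

context theta_connection
begin

lemma sum_coeff_z_h_lo:
  assumes c: "c \<in> A" and x: "x \<in> fst c"
  shows "(\<Sum>s\<in>UNIV. coeff_z c i k s x * h_lo g c s l x)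
    = D_z c i (h_lo g c k l) x + (\<Sum>s\<in>UNIV. \<theta> c i k s x * h_lo g c s l x)"
  unfolding chern_Gamma_h_lo[OF c x, symmetric]
  by (simp add: coeff_z_def distrib_right sum.distrib)

lemma sum_coeff_zbar_h_lo:
  assumes c: "c \<in> A" and x: "x \<in> fst c"
  shows "(\<Sum>m\<in>UNIV. coeff_zbar c j k m x * h_lo g c m l x) = - (\<Sum>q\<in>UNIV. h_lo g c k q x * cnj (\<theta> c j l q x))"
proof -
  have "(\<Sum>m\<in>UNIV. coeff_zbar c j k m x * h_lo g c m l x)
      = - (\<Sum>m\<in>UNIV. \<Sum>p\<in>UNIV. (\<Sum>q\<in>UNIV. h_lo g c k q x * cnj (\<theta> c j p q x)) * (h_lo g c m l x * h_up g c m p x))"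
    unfolding coeff_zbar_def by (simp add: sum_negf sum_distrib_left sum_distrib_right mult_ac)
  also have "\<dots> = - (\<Sum>p\<in>UNIV. (\<Sum>q\<in>UNIV. h_lo g c k q x * cnj (\<theta> c j p q x)) * (\<Sum>m\<in>UNIV. h_lo g c m l x * h_up g c m p x))"
    unfolding sum_distrib_left[where r = "sum _ _"] by (subst sum.swap) (rule refl)
  also have "\<dots> = - (\<Sum>q\<in>UNIV. h_lo g c k q x * cnj (\<theta> c j l q x))"
    by (simp add: h_lo_h_up[OF c x] if_distrib[of "\<lambda>t. a * t" for a] cong: if_cong)
  finally show ?thesis .
qed

text \<open>Of the three sums only the middle one survives in the curvature. The first and the last
  cancel against the two products of \<open>coeff_z\<close> with \<open>coeff_zbar\<close>, one for
  each order of differentiation.\<close>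

lemma coeff_zbar_derivative:
  assumes c: "c \<in> A" and x: "x \<in> fst c"
  shows "(\<Sum>m\<in>UNIV. D_z c i (coeff_zbar c j k m) x * h_lo g c m l x)
    = - (\<Sum>q\<in>UNIV. D_z c i (h_lo g c k q) x * cnj (\<theta> c j l q x))
      - (\<Sum>q\<in>UNIV. h_lo g c k q x * D_z c i (\<lambda>y. cnj (\<theta> c j l q y)) x)
      - (\<Sum>m\<in>UNIV. coeff_zbar c j k m x * D_z c i (h_lo g c m l) x)"
proof -
  have th: "chart_smooth_on c UNIV (\<lambda>y. cnj (\<theta> c j l q y))" for q
    by (intro chart_smooth_cnj c open_UNIV chart_smooth_theta)
  have s: "chart_smooth_on c UNIV (\<lambda>y. \<Sum>q\<in>UNIV. h_lo g c k q y * cnj (\<theta> c j l q y))"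
    by (intro chart_smooth_sum chart_smooth_mult th chart_smooth_h_lo c open_UNIV)
  have "D_z c i (\<lambda>y. \<Sum>m\<in>UNIV. coeff_zbar c j k m y * h_lo g c m l y) x
      = D_z c i (\<lambda>y. - (\<Sum>q\<in>UNIV. h_lo g c k q y * cnj (\<theta> c j l q y))) x"
    unfolding D_z_wirtinger
    by (rule wirtinger_cong[OF c open_UNIV chart_smooth_minus[OF c open_UNIV s] x UNIV_I])
       (simp add: sum_coeff_zbar_h_lo[OF c])
  also have "\<dots> = - D_z c i (\<lambda>y. \<Sum>q\<in>UNIV. h_lo g c k q y * cnj (\<theta> c j l q y)) x"
    unfolding D_z_wirtinger by (rule wirtinger_minus[OF c x UNIV_I s])
  finally show ?thesis
    unfolding D_z_wirtinger wirtinger_sum_mult[OF c x chart_smooth_coeff_zbar[OF c] chart_smooth_h_lo[OF c]]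
      wirtinger_sum_mult[OF c x chart_smooth_h_lo[OF c] th]
    by (simp add: sum.distrib algebra_simps)
qed

lemma wirtinger_coeff_z:
  assumes c: "c \<in> A" and x: "x \<in> fst c"
  shows "wirtinger a c j (coeff_z c i k m) x = wirtinger a c j (chern_Gamma g c i k m) x + wirtinger a c j (\<theta> c i k m) x"
  unfolding coeff_z_def[abs_def]
  by (rule wirtinger_add[OF c x UNIV_I chart_smooth_chern_Gamma[OF c] chart_smooth_theta[OF c]])

lemma curvature_11:
  assumes c: "c \<in> A" and x: "x \<in> fst c"
  shows "curvature g (complexify D) (d_z c i) (d_zbar c j) (d_z c k) (d_zbar c l) c x
    = chern_curv g c i j k l x
           - ((\<Sum>p\<in>UNIV. h_lo g c k p x * D_z c i (\<lambda>y. cnj (\<theta> c j l p y)) x)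
              + (\<Sum>p\<in>UNIV. h_lo g c p l x * D_zbar c j (\<theta> c i k p) x))
           + ((\<Sum>p\<in>UNIV. \<Sum>q\<in>UNIV. \<theta> c i k p x * cnj (\<theta> c j l q x) * h_lo g c p q x)
              - (\<Sum>m\<in>UNIV. \<Sum>n\<in>UNIV. \<Sum>p\<in>UNIV. \<Sum>q\<in>UNIV.
                   h_up g c m n x * \<theta> c i m p x * cnj (\<theta> c j n q x) * h_lo g c p l x * h_lo g c k q x))"
proof -
  have 1: "(\<Sum>m\<in>UNIV. D_zbar c j (coeff_z c i k m) x * h_lo g c m l x)
      = - chern_curv g c i j k l x + (\<Sum>p\<in>UNIV. h_lo g c p l x * D_zbar c j (\<theta> c i k p) x)"
    unfolding chern_curv_eq[OF c x, symmetric] D_zbar_wirtinger wirtinger_coeff_z[OF c x]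
    by (simp add: algebra_simps sum.distrib)
  \<comment> \<open>The Chern part of \<open>coeff_z\<close> gives the first sum, to be cancelled;
    its theta part gives the first quadratic term.\<close>
  have 2: "(\<Sum>m\<in>UNIV. coeff_z c i k m x * (\<Sum>s\<in>UNIV. coeff_zbar c j m s x * h_lo g c s l x))
      = - (\<Sum>q\<in>UNIV. D_z c i (h_lo g c k q) x * cnj (\<theta> c j l q x))
        - (\<Sum>p\<in>UNIV. \<Sum>q\<in>UNIV. \<theta> c i k p x * cnj (\<theta> c j l q x) * h_lo g c p q x)"
  proof -
    have "(\<Sum>m\<in>UNIV. coeff_z c i k m x * (\<Sum>s\<in>UNIV. coeff_zbar c j m s x * h_lo g c s l x))
        = - (\<Sum>q\<in>UNIV. (\<Sum>m\<in>UNIV. coeff_z c i k m x * h_lo g c m q x) * cnj (\<theta> c j l q x))"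
      unfolding sum_coeff_zbar_h_lo[OF c x] mult_minus_right sum_negf sum_distrib_left sum_distrib_right
      by (subst sum.swap) (simp add: mult.assoc)
    moreover have "(\<Sum>p\<in>UNIV. \<Sum>q\<in>UNIV. \<theta> c i k p x * cnj (\<theta> c j l q x) * h_lo g c p q x)
        = (\<Sum>q\<in>UNIV. (\<Sum>p\<in>UNIV. \<theta> c i k p x * h_lo g c p q x) * cnj (\<theta> c j l q x))"
      unfolding sum_distrib_right by (subst sum.swap) (simp add: mult_ac)
    ultimately show ?thesis
      unfolding sum_coeff_z_h_lo[OF c x] by (simp add: distrib_right sum.distrib)
  qed
  \<comment> \<open>Expanding \<open>coeff_zbar\<close> against the theta part of
    \<open>coeff_z\<close> brings in the remaining \<open>h_up\<close> and the second quadratic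
    term.\<close>
  have 3: "(\<Sum>m\<in>UNIV. coeff_zbar c j k m x * (\<Sum>s\<in>UNIV. coeff_z c i m s x * h_lo g c s l x))
      = (\<Sum>m\<in>UNIV. coeff_zbar c j k m x * D_z c i (h_lo g c m l) x)
        - (\<Sum>m\<in>UNIV. \<Sum>n\<in>UNIV. \<Sum>p\<in>UNIV. \<Sum>q\<in>UNIV.
             h_up g c m n x * \<theta> c i m p x * cnj (\<theta> c j n q x) * h_lo g c p l x * h_lo g c k q x)"
  proof -
    have "coeff_zbar c j k m x * (\<Sum>p\<in>UNIV. \<theta> c i m p x * h_lo g c p l x)
        = - (\<Sum>n\<in>UNIV. \<Sum>p\<in>UNIV. \<Sum>q\<in>UNIV.
             h_up g c m n x * \<theta> c i m p x * cnj (\<theta> c j n q x) * h_lo g c p l x * h_lo g c k q x)" for m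
      unfolding coeff_zbar_def mult_minus_left sum_distrib_right sum_distrib_left sum_negf
      by (subst sum.swap) (simp add: mult_ac)
    then show ?thesis
      unfolding sum_coeff_z_h_lo[OF c x] by (simp add: distrib_left sum.distrib sum_subtractf)
  qed
  show ?thesis
    unfolding curvature_11_expand[OF c x] sum.distrib coeff_zbar_derivative[OF c x] 1 2 3 by simp
qed

text \<open>The Chern connection contributes no (2,0) curvature: its part of each order of
  differentiation reduces to a second derivative of the metric, symmetric in i and j.\<close>

lemma curvature_20:
  assumes c: "c \<in> A" and x: "x \<in> fst c"
  shows "curvature g (complexify D) (d_z c i) (d_z c j) (d_z c k) (d_zbar c l) c x
    = (\<Sum>m\<in>UNIV.
             (D_z c i (\<theta> c j k m) x - D_z c j (\<theta> c i k m) x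
              + (\<Sum>s\<in>UNIV. chern_Gamma g c j k s x * \<theta> c i s m x)
              - (\<Sum>s\<in>UNIV. chern_Gamma g c j s m x * \<theta> c i k s x)
              + (\<Sum>s\<in>UNIV. chern_Gamma g c i s m x * \<theta> c j k s x)
              - (\<Sum>s\<in>UNIV. chern_Gamma g c i k s x * \<theta> c j s m x)) * h_lo g c m l x)
           + (\<Sum>m\<in>UNIV.
               (\<Sum>p\<in>UNIV. \<theta> c i p m x * \<theta> c j k p x - \<theta> c i k p x * \<theta> c j p m x) * h_lo g c m l x)"
proof -
  let ?h = "\<lambda>m. h_lo g c m l x" and ?G = "\<lambda>i j k. chern_Gamma g c i j k x" and ?t = "\<lambda>i j k. \<theta> c i j k x"
  \<comment> \<open>One of the two orders of differentiation; the other is the same identity with i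
    and j exchanged. The products of Chern symbols with derivatives of the metric have already
    cancelled here.\<close>
  have expand: "(\<Sum>m\<in>UNIV. D_z c i (coeff_z c j k m) x * ?h m + coeff_z c j k m x * (\<Sum>s\<in>UNIV. coeff_z c i m s x * ?h s))
    = D_z c i (D_z c j (h_lo g c k l)) x + (\<Sum>m\<in>UNIV. D_z c i (\<theta> c j k m) x * ?h m)
      + (\<Sum>m\<in>UNIV. (\<Sum>s\<in>UNIV. ?G j k s * ?t i s m) * ?h m)
      + (\<Sum>m\<in>UNIV. (\<Sum>s\<in>UNIV. ?G i s m * ?t j k s) * ?h m)
      + (\<Sum>m\<in>UNIV. (\<Sum>s\<in>UNIV. ?t i s m * ?t j k s) * ?h m)" for i j
  proof -
    \<comment> \<open>Moves the metric to the outer sum, the position it has in the claim.\<close>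
    have sw: "(\<Sum>m\<in>UNIV. a m * (\<Sum>s\<in>UNIV. b m s * ?h s)) = (\<Sum>s\<in>UNIV. (\<Sum>m\<in>UNIV. b m s * a m) * ?h s)"
      for a :: "'n \<Rightarrow> complex" and b
      unfolding sum_distrib_left sum_distrib_right by (subst sum.swap) (simp add: mult_ac)
    have "(\<Sum>m\<in>UNIV. coeff_z c j k m x * (\<Sum>s\<in>UNIV. coeff_z c i m s x * ?h s))
      = (\<Sum>m\<in>UNIV. ?G j k m * D_z c i (h_lo g c m l) x) + (\<Sum>m\<in>UNIV. ?G j k m * (\<Sum>s\<in>UNIV. ?t i m s * ?h s))
        + (\<Sum>m\<in>UNIV. ?t j k m * (\<Sum>s\<in>UNIV. ?G i m s * ?h s)) + (\<Sum>m\<in>UNIV. ?t j k m * (\<Sum>s\<in>UNIV. ?t i m s * ?h s))"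
      unfolding sum_coeff_z_h_lo[OF c x] chern_Gamma_h_lo[OF c x] by (simp add: coeff_z_def algebra_simps sum.distrib)
    moreover have "(\<Sum>m\<in>UNIV. D_z c i (coeff_z c j k m) x * ?h m) = D_z c i (D_z c j (h_lo g c k l)) x
        - (\<Sum>m\<in>UNIV. ?G j k m * D_z c i (h_lo g c m l) x) + (\<Sum>m\<in>UNIV. D_z c i (\<theta> c j k m) x * ?h m)"
      using chern_Gamma_derivative[OF c x, of "- \<i>" i j k l]
      unfolding D_z_wirtinger wirtinger_coeff_z[OF c x] by (simp add: distrib_right sum.distrib)
    ultimately show ?thesis
      unfolding sum.distrib sw by (simp add: mult.commute)
  qed
  have comm: "D_z c i (D_z c j (h_lo g c k l)) x = D_z c j (D_z c i (h_lo g c k l)) x"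
    unfolding D_z_wirtinger by (rule wirtinger_commute[OF c open_UNIV chart_smooth_h_lo[OF c] x UNIV_I])
  show ?thesis
    unfolding curvature_20_expand[OF c x] expand comm
    by (simp add: algebra_simps sum.distrib sum_subtractf)
qed

end

section \<open>Transformation of the Ricci form\<close>

context complex_manifold
begin

lemma wirtinger_cong_zero:
  assumes "c \<in> A" "open W" "x \<in> fst c" "x \<in> W" "\<And>y. y \<in> fst c \<Longrightarrow> y \<in> W \<Longrightarrow> f y = 0"
  shows "wirtinger a c i f x = 0"
  using wirtinger_cong[OF assms(1,2) chart_smooth_const[OF assms(1,2)] assms(3,4), of 0 f a i] assms(5)
  by (simp add: wirtinger_const)

lemma D_z_cnj_jacobian:
  assumes "c \<in> A" "d \<in> A" "x \<in> fst c" "x \<in> fst d"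
  shows "D_z c i (\<lambda>y. cnj (jacobian c d b j y)) x = 0"
  using wirtinger_cnj[OF assms(1,3,4) chart_smooth_jacobian[OF assms(1,2)], of "- \<i>"]
    D_zbar_jacobian[OF assms]
  by (simp add: D_z_wirtinger D_zbar_wirtinger)

lemma D_zbar_D_z_jacobian:
  assumes "c \<in> A" "d \<in> A" "x \<in> fst c" "x \<in> fst d"
  shows "D_zbar c j (D_z c i (jacobian c d b k)) x = 0"
proof -
  note o = open_chart[OF assms(2)]
  have "D_zbar c j (D_z c i (jacobian c d b k)) x = D_z c i (D_zbar c j (jacobian c d b k)) x"
    unfolding D_zbar_wirtinger D_z_wirtinger
    by (rule wirtinger_commute[OF assms(1) o chart_smooth_jacobian[OF assms(1,2)] assms(3,4)])
  also have "\<dots> = 0"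
    unfolding D_z_wirtinger
    by (rule wirtinger_cong_zero[OF assms(1) o assms(3,4)]) (rule D_zbar_jacobian[OF assms(1,2)])
  finally show ?thesis .
qed

text \<open>The entry is holomorphic in the coordinates of \<open>d\<close>;
  \<open>D_zbar_change\<close> carries this over to \<open>c\<close>.\<close>

lemma D_zbar_jacobian_inverse:
  assumes "c \<in> A" "d \<in> A" "x \<in> fst c" "x \<in> fst d"
  shows "D_zbar c j (jacobian d c k a) x = 0"
  unfolding D_zbar_change[OF assms open_chart[OF assms(1)] assms(3) chart_smooth_jacobian[OF assms(2,1)]]
  by (simp add: D_zbar_jacobian[OF assms(2,1,4,3)])

end

context hermitian
begin

lemma h_lo_change:
  assumes "c \<in> A" "d \<in> A" "x \<in> fst c" "x \<in> fst d"
  shows "h_lo g c k l x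
    = (\<Sum>a\<in>UNIV. jacobian c d a k x * (\<Sum>b\<in>UNIV. cnj (jacobian c d b l x) * h_lo g d a b x))"
proof -
  have "h_lo g c k l x = herm d x (chart_deriv c (snd d) x (axis k 1)) (chart_deriv c (snd d) x (axis l 1))"
    by (simp add: h_lo_herm[OF assms(1,3)] herm_def g_change[OF assms] flip: chart_deriv_change_i[OF assms])
  then show ?thesis
    by (simp add: herm_expand[OF assms(2,4)] jacobian_eq[OF assms] sum_distrib_left mult.assoc)
qed

text \<open>$\Gamma_{ik}^k$, which is $\partial_i \log\det h$; using its transformation law avoids determinants.\<close>

definition gamma :: "('m, 'n) chart \<Rightarrow> 'n \<Rightarrow> 'm \<Rightarrow> complex" where
  "gamma c i x = (\<Sum>k\<in>UNIV. chern_Gamma g c i k k x)"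

lemma chart_smooth_gamma: "c \<in> A \<Longrightarrow> chart_smooth_on c UNIV (gamma c i)"
  unfolding gamma_def[abs_def] by (intro chart_smooth_sum chart_smooth_chern_Gamma open_UNIV)

lemma D_zbar_gamma:
  assumes c: "c \<in> A" and x: "x \<in> fst c"
  shows "(\<Sum>k\<in>UNIV. \<Sum>l\<in>UNIV. h_up g c k l x * chern_curv g c i j k l x) = - D_zbar c j (gamma c i) x"
proof -
  have "(\<Sum>l\<in>UNIV. h_up g c k l x * chern_curv g c i j k l x) = - D_zbar c j (chern_Gamma g c i k k) x" for k
  proof -
    have "(\<Sum>l\<in>UNIV. h_up g c k l x * chern_curv g c i j k l x)
        = - (\<Sum>l\<in>UNIV. h_up g c k l x * (\<Sum>s\<in>UNIV. D_zbar c j (chern_Gamma g c i k s) x * h_lo g c s l x))"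
      by (simp add: chern_curv_eq[OF c x] sum_negf)
    also have "\<dots> = - (\<Sum>s\<in>UNIV. D_zbar c j (chern_Gamma g c i k s) x * (\<Sum>l\<in>UNIV. h_up g c k l x * h_lo g c s l x))"
      unfolding sum_distrib_left by (subst sum.swap) (simp add: mult_ac)
    also have "\<dots> = - D_zbar c j (chern_Gamma g c i k k) x"
      by (simp add: h_up_h_lo[OF c x] if_distrib[of "\<lambda>t. a * t" for a] cong: if_cong)
    finally show ?thesis .
  qed
  then show ?thesis
    unfolding gamma_def[abs_def] D_zbar_wirtinger
    by (simp add: wirtinger_sum[OF c open_UNIV x UNIV_I chart_smooth_chern_Gamma[OF c]] sum_negf)
qed

text \<open>Product rule for the metric written as \<open>jacobian\<close> times \<open>E\<close>:
  the conjugate Jacobian inside \<open>E\<close> is constant for \<open>D_z\<close>. Differentiating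
  \<open>jacobian\<close> gives the inhomogeneous trace, differentiating \<open>E\<close> the
  pulled-back \<open>gamma d\<close>.\<close>

lemma gamma_change:
  assumes "c \<in> A" "d \<in> A" "x \<in> fst c" "x \<in> fst d"
  shows "gamma c i x = (\<Sum>k\<in>UNIV. \<Sum>a\<in>UNIV. D_z c i (jacobian c d a k) x * jacobian d c k a x)
    + (\<Sum>e\<in>UNIV. gamma d e x * jacobian c d e i x)"
proof -
  note c = assms(1) and d = assms(2) and xc = assms(3) and xd = assms(4)
  note o = open_chart[OF d]
  let ?J = "\<lambda>a k. jacobian c d a k x" and ?K = "\<lambda>k a. jacobian d c k a x"
    and ?U = "\<lambda>k l. h_up g c k l x"
  \<comment> \<open>The metric with its barred index already in \<open>c\<close> and its unbarred
    index still in \<open>d\<close>.\<close>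
  define E where "E a l y = (\<Sum>b\<in>UNIV. cnj (jacobian c d b l y) * h_lo g d a b y)" for a l y
  have sJ: "chart_smooth_on c (fst d) (jacobian c d a k)" for a k
    by (rule chart_smooth_jacobian[OF c d])
  have sJ': "chart_smooth_on c (fst d) (\<lambda>y. cnj (jacobian c d b l y))" for b l
    by (rule chart_smooth_cnj[OF c o sJ])
  have sh: "chart_smooth_on c (fst d) (h_lo g d a b)" for a b
    using chart_smooth_change[OF d c open_UNIV chart_smooth_h_lo[OF d]] by simp
  have sE: "chart_smooth_on c (fst d) (E a l)" for a l
    unfolding E_def[abs_def] by (intro chart_smooth_sum chart_smooth_mult sJ' sh c o)
  have dE: "D_z c i (E a l) x = (\<Sum>b\<in>UNIV. cnj (?J b l) * D_z c i (h_lo g d a b) x)" for a l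
    using D_z_cnj_jacobian[OF assms]
    unfolding E_def[abs_def] D_z_wirtinger wirtinger_sum_mult_on[OF c o xc xd sJ' sh] by simp
  have dh: "D_z c i (h_lo g c k l) x
      = (\<Sum>a\<in>UNIV. D_z c i (jacobian c d a k) x * E a l x + ?J a k * D_z c i (E a l) x)" for k l
  proof -
    have "D_z c i (\<lambda>y. \<Sum>a\<in>UNIV. jacobian c d a k y * E a l y) x = D_z c i (h_lo g c k l) x"
      unfolding D_z_wirtinger
      by (rule wirtinger_cong[OF c o chart_smooth_subset[OF chart_smooth_h_lo[OF c]] xc xd])
         (auto simp: h_lo_change[OF c d] E_def)
    then show ?thesis
      unfolding D_z_wirtinger wirtinger_sum_mult_on[OF c o xc xd sJ sE] by simp
  qed
  have hK: "(\<Sum>m\<in>UNIV. h_lo g c m l x * ?K m a) = E a l x" for l a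
  proof -
    have "(\<Sum>m\<in>UNIV. h_lo g c m l x * ?K m a) = (\<Sum>a'\<in>UNIV. (\<Sum>m\<in>UNIV. ?J a' m * ?K m a) * E a' l x)"
      unfolding h_lo_change[OF assms] E_def[symmetric] sum_distrib_right
      by (subst sum.swap) (simp add: mult_ac)
    then show ?thesis
      by (simp add: jacobian_inverse[OF d c xd xc] if_distrib[of "\<lambda>t. t * a" for a] cong: if_cong)
  qed
  \<comment> \<open>By \<open>hK\<close>, \<open>E\<close> is the metric in \<open>c\<close> times
    the inverse Jacobian, so contraction with the inverse metric leaves only that Jacobian.\<close>
  have UE: "(\<Sum>l\<in>UNIV. ?U k l * E a l x) = ?K k a" for k a
  proof -
    have "(\<Sum>l\<in>UNIV. ?U k l * E a l x) = (\<Sum>m\<in>UNIV. (\<Sum>l\<in>UNIV. ?U k l * h_lo g c m l x) * ?K m a)"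
      unfolding hK[symmetric] sum_distrib_left sum_distrib_right
      by (subst sum.swap) (simp add: mult_ac)
    then show ?thesis
      by (simp add: h_up_h_lo[OF c xc] if_distrib[of "\<lambda>t. t * a" for a] cong: if_cong)
  qed
  \<comment> \<open>The inverse metric is pushed forward contravariantly; this is checked by
    contracting with the metric in \<open>d\<close> and using uniqueness of the inverse.\<close>
  have UJJ: "(\<Sum>k\<in>UNIV. \<Sum>l\<in>UNIV. ?U k l * ?J a k * cnj (?J b l)) = h_up g d a b x" for a b
  proof (rule h_up_unique[OF d xd])
    fix a a'
    have "(\<Sum>b\<in>UNIV. (\<Sum>k\<in>UNIV. \<Sum>l\<in>UNIV. ?U k l * ?J a k * cnj (?J b l)) * h_lo g d a' b x)
        = (\<Sum>k\<in>UNIV. \<Sum>b\<in>UNIV. \<Sum>l\<in>UNIV. ?U k l * ?J a k * cnj (?J b l) * h_lo g d a' b x)"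
      unfolding sum_distrib_right by (rule sum.swap)
    also have "\<dots> = (\<Sum>k\<in>UNIV. \<Sum>l\<in>UNIV. \<Sum>b\<in>UNIV. ?U k l * ?J a k * cnj (?J b l) * h_lo g d a' b x)"
      by (intro sum.cong refl sum.swap)
    also have "\<dots> = (\<Sum>k\<in>UNIV. ?J a k * (\<Sum>l\<in>UNIV. ?U k l * E a' l x))"
      by (simp add: E_def sum_distrib_left mult_ac)
    finally have "(\<Sum>b\<in>UNIV. (\<Sum>k\<in>UNIV. \<Sum>l\<in>UNIV. ?U k l * ?J a k * cnj (?J b l)) * h_lo g d a' b x)
        = (\<Sum>k\<in>UNIV. ?J a k * (\<Sum>l\<in>UNIV. ?U k l * E a' l x))" .
    then show "(\<Sum>b\<in>UNIV. (\<Sum>k\<in>UNIV. \<Sum>l\<in>UNIV. ?U k l * ?J a k * cnj (?J b l)) * h_lo g d a' b x)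
        = (if a = a' then 1 else 0)"
      by (simp add: UE jacobian_inverse[OF d c xd xc])
  qed
  have gd: "gamma d e x = (\<Sum>a\<in>UNIV. \<Sum>b\<in>UNIV. h_up g d a b x * D_z d e (h_lo g d a b) x)" for e
    by (simp add: gamma_def chern_Gamma_def)
  have "gamma c i x = (\<Sum>k\<in>UNIV. \<Sum>l\<in>UNIV. ?U k l * D_z c i (h_lo g c k l) x)"
    by (simp add: gamma_def chern_Gamma_def)
  also have "\<dots> = (\<Sum>k\<in>UNIV. \<Sum>a\<in>UNIV. D_z c i (jacobian c d a k) x * (\<Sum>l\<in>UNIV. ?U k l * E a l x))
      + (\<Sum>k\<in>UNIV. \<Sum>l\<in>UNIV. \<Sum>a\<in>UNIV. ?U k l * ?J a k * D_z c i (E a l) x)"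
  proof -
    have "(\<Sum>l\<in>UNIV. ?U k l * (\<Sum>a\<in>UNIV. D_z c i (jacobian c d a k) x * E a l x))
        = (\<Sum>a\<in>UNIV. D_z c i (jacobian c d a k) x * (\<Sum>l\<in>UNIV. ?U k l * E a l x))" for k
      unfolding sum_distrib_left by (subst sum.swap) (simp add: mult_ac)
    then show ?thesis
      unfolding dh sum.distrib distrib_left by (simp add: sum_distrib_left mult.assoc)
  qed
  also have "(\<Sum>k\<in>UNIV. \<Sum>l\<in>UNIV. \<Sum>a\<in>UNIV. ?U k l * ?J a k * D_z c i (E a l) x)
      = (\<Sum>a\<in>UNIV. \<Sum>b\<in>UNIV. (\<Sum>k\<in>UNIV. \<Sum>l\<in>UNIV. ?U k l * ?J a k * cnj (?J b l)) * D_z c i (h_lo g d a b) x)"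
  proof -
    have "(\<Sum>k\<in>UNIV. \<Sum>l\<in>UNIV. \<Sum>a\<in>UNIV. ?U k l * ?J a k * D_z c i (E a l) x)
        = (\<Sum>k\<in>UNIV. \<Sum>a\<in>UNIV. \<Sum>l\<in>UNIV. ?U k l * ?J a k * D_z c i (E a l) x)"
      by (intro sum.cong refl sum.swap)
    also have "\<dots> = (\<Sum>a\<in>UNIV. \<Sum>k\<in>UNIV. \<Sum>l\<in>UNIV. ?U k l * ?J a k * D_z c i (E a l) x)"
      by (rule sum.swap)
    also have "\<dots> = (\<Sum>a\<in>UNIV. \<Sum>k\<in>UNIV. \<Sum>l\<in>UNIV. \<Sum>b\<in>UNIV. ?U k l * ?J a k * cnj (?J b l) * D_z c i (h_lo g d a b) x)"
      by (simp add: dE sum_distrib_left mult.assoc)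
    also have "\<dots> = (\<Sum>a\<in>UNIV. \<Sum>k\<in>UNIV. \<Sum>b\<in>UNIV. \<Sum>l\<in>UNIV. ?U k l * ?J a k * cnj (?J b l) * D_z c i (h_lo g d a b) x)"
      by (intro sum.cong refl sum.swap)
    also have "\<dots> = (\<Sum>a\<in>UNIV. \<Sum>b\<in>UNIV. \<Sum>k\<in>UNIV. \<Sum>l\<in>UNIV. ?U k l * ?J a k * cnj (?J b l) * D_z c i (h_lo g d a b) x)"
      by (intro sum.cong refl sum.swap)
    finally show ?thesis by (simp add: sum_distrib_right)
  qed
  also have "\<dots> = (\<Sum>e\<in>UNIV. gamma d e x * ?J e i)"
  proof -
    have "\<dots> = (\<Sum>a\<in>UNIV. \<Sum>b\<in>UNIV. \<Sum>e\<in>UNIV. h_up g d a b x * D_z d e (h_lo g d a b) x * ?J e i)"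
      unfolding UJJ D_z_change[OF assms open_UNIV UNIV_I chart_smooth_h_lo[OF d]]
      by (simp add: sum_distrib_left mult.assoc)
    also have "\<dots> = (\<Sum>a\<in>UNIV. \<Sum>e\<in>UNIV. \<Sum>b\<in>UNIV. h_up g d a b x * D_z d e (h_lo g d a b) x * ?J e i)"
      by (intro sum.cong refl sum.swap)
    also have "\<dots> = (\<Sum>e\<in>UNIV. \<Sum>a\<in>UNIV. \<Sum>b\<in>UNIV. h_up g d a b x * D_z d e (h_lo g d a b) x * ?J e i)"
      by (rule sum.swap)
    finally show ?thesis by (simp add: gd sum_distrib_right)
  qed
  finally show ?thesis unfolding UE .
qed

text \<open>In \<open>gamma_change\<close> the trace \<open>P\<close> is made of holomorphic
  functions, so \<open>D_zbar\<close> removes it and what is left is tensorial.\<close>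

lemma D_zbar_gamma_change:
  assumes "c \<in> A" "d \<in> A" "x \<in> fst c" "x \<in> fst d"
  shows "D_zbar c j (gamma c i) x
    = (\<Sum>a\<in>UNIV. \<Sum>b\<in>UNIV. D_zbar d b (gamma d a) x * jacobian c d a i x * cnj (jacobian c d b j x))"
proof -
  note c = assms(1) and d = assms(2) and xc = assms(3) and xd = assms(4)
  note o = open_chart[OF d]
  have sJ: "chart_smooth_on c (fst d) (jacobian c d a k)" for a k
    by (rule chart_smooth_jacobian[OF c d])
  have sDJ: "chart_smooth_on c (fst d) (D_z c i (jacobian c d a k))" for a k
    unfolding D_z_wirtinger by (rule chart_smooth_wirtinger[OF c o sJ])
  have sK: "chart_smooth_on c (fst d) (jacobian d c k a)" for a k
    using chart_smooth_change[OF d c open_chart[OF c] chart_smooth_jacobian[OF d c]]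
    by (rule chart_smooth_subset) auto
  have sg: "chart_smooth_on c (fst d) (gamma d e)" for e
    using chart_smooth_change[OF d c open_UNIV chart_smooth_gamma[OF d]] by simp
  define P where "P y = (\<Sum>k\<in>UNIV. \<Sum>a\<in>UNIV. D_z c i (jacobian c d a k) y * jacobian d c k a y)" for y
  define Q where "Q y = (\<Sum>e\<in>UNIV. gamma d e y * jacobian c d e i y)" for y
  have sP': "chart_smooth_on c (fst d) (\<lambda>y. \<Sum>a\<in>UNIV. D_z c i (jacobian c d a k) y * jacobian d c k a y)" for k
    by (intro chart_smooth_sum chart_smooth_mult c o sDJ sK)
  have sP: "chart_smooth_on c (fst d) P"
    unfolding P_def[abs_def] by (intro chart_smooth_sum c o sP')
  have sQ: "chart_smooth_on c (fst d) Q"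
    unfolding Q_def[abs_def] by (intro chart_smooth_sum chart_smooth_mult c o sg sJ)
  have "D_zbar c j P x = 0"
    unfolding P_def[abs_def] D_zbar_wirtinger wirtinger_sum[OF c o xc xd sP']
      wirtinger_sum_mult_on[OF c o xc xd sDJ sK]
    by (simp add: D_zbar_D_z_jacobian[OF assms] D_zbar_jacobian_inverse[OF assms] flip: D_zbar_wirtinger)
  moreover have "D_zbar c j Q x = (\<Sum>e\<in>UNIV. D_zbar c j (gamma d e) x * jacobian c d e i x)"
    unfolding Q_def[abs_def] D_zbar_wirtinger wirtinger_sum_mult_on[OF c o xc xd sg sJ]
    by (simp add: D_zbar_jacobian[OF assms] flip: D_zbar_wirtinger)
  moreover have "D_zbar c j (gamma c i) x = D_zbar c j (\<lambda>y. P y + Q y) x"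
    unfolding D_zbar_wirtinger
    by (rule wirtinger_cong[OF c o chart_smooth_add[OF c o sP sQ] xc xd])
       (simp add: P_def Q_def gamma_change[OF c d])
  ultimately have "D_zbar c j (gamma c i) x = (\<Sum>e\<in>UNIV. D_zbar c j (gamma d e) x * jacobian c d e i x)"
    by (simp add: D_zbar_wirtinger wirtinger_add[OF c xc xd sP sQ])
  then show ?thesis
    unfolding D_zbar_change[OF assms open_UNIV UNIV_I chart_smooth_gamma[OF d]]
    by (simp add: sum_distrib_left sum_distrib_right mult_ac)
qed

end

section \<open>Forms of low degree\<close>

lemma sum_lists_length_0: "(\<Sum>K\<in>{K. length K = 0}. f K) = f []"
  by simp

lemma sum_lists_length_1: "(\<Sum>K\<in>{K. length K = 1}. f K) = (\<Sum>a\<in>UNIV. f [a])"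
proof -
  have *: "{K. length K = 1} = range (\<lambda>a. [a])" by (auto simp: length_Suc_conv)
  show ?thesis unfolding * by (simp add: sum.reindex inj_on_def comp_def)
qed

text \<open>On lists of length one antisymmetry is vacuous and the products of Jacobians have a
  single factor each.\<close>

lemma pq_form_11_iff:
  fixes A :: "('m::topological_space, 'n::finite) chart set"
  shows "pq_form A 1 1 \<omega> \<longleftrightarrow>
    (\<forall>c\<in>A. \<forall>i j. chart_smooth_on c UNIV (\<omega> c [i] [j])) \<and>
    (\<forall>c\<in>A. \<forall>d\<in>A. \<forall>x\<in>fst c \<inter> fst d. \<forall>i j. \<omega> c [i] [j] x =
      (\<Sum>a\<in>UNIV. \<Sum>b\<in>UNIV. \<omega> d [a] [b] x * jacobian c d a i x * cnj (jacobian c d b j x)))"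
proof -
  have all1: "(\<forall>I::'n list. length I = 1 \<longrightarrow> P I) \<longleftrightarrow> (\<forall>i. P [i])" for P
    by (auto simp: length_Suc_conv)
  have all2: "(\<forall>I J::'n list. length I = 1 \<longrightarrow> length J = 1 \<longrightarrow> P I J) \<longleftrightarrow> (\<forall>i j. P [i] [j])" for P
    by (auto simp: length_Suc_conv)
  have no_swap: "(\<forall>a b. a < b \<and> b < 1 \<longrightarrow> R a b) = True" for R :: "nat \<Rightarrow> nat \<Rightarrow> bool" by simp
  show ?thesis
    unfolding pq_form_def all2 sum_lists_length_1 no_swap by (simp add: lessThan_Suc)
qed

lemma pq_form_10_iff:
  fixes A :: "('m::topological_space, 'n::finite) chart set"
  shows "pq_form A 1 0 \<omega> \<longleftrightarrow>
    (\<forall>c\<in>A. \<forall>i. chart_smooth_on c UNIV (\<omega> c [i] [])) \<and>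
    (\<forall>c\<in>A. \<forall>d\<in>A. \<forall>x\<in>fst c \<inter> fst d. \<forall>i. \<omega> c [i] [] x =
      (\<Sum>a\<in>UNIV. \<omega> d [a] [] x * jacobian c d a i x))"
proof -
  have all2: "(\<forall>I J::'n list. length I = 1 \<longrightarrow> length J = 0 \<longrightarrow> P I J) \<longleftrightarrow> (\<forall>i. P [i] [])" for P
    by (auto simp: length_Suc_conv)
  have no_swap: "(\<forall>a b. a < b \<and> b < 1 \<longrightarrow> R a b) = True" "(\<forall>a b. a < b \<and> b < 0 \<longrightarrow> R a b) = True"
    for R :: "nat \<Rightarrow> nat \<Rightarrow> bool" by simp_all
  show ?thesis
    unfolding pq_form_def all2 sum_lists_length_1 sum_lists_length_0 no_swap by (simp add: lessThan_Suc)
qed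

lemma pq_form_01_iff:
  fixes A :: "('m::topological_space, 'n::finite) chart set"
  shows "pq_form A 0 1 \<omega> \<longleftrightarrow>
    (\<forall>c\<in>A. \<forall>j. chart_smooth_on c UNIV (\<omega> c [] [j])) \<and>
    (\<forall>c\<in>A. \<forall>d\<in>A. \<forall>x\<in>fst c \<inter> fst d. \<forall>j. \<omega> c [] [j] x =
      (\<Sum>b\<in>UNIV. \<omega> d [] [b] x * cnj (jacobian c d b j x)))"
proof -
  have all2: "(\<forall>I J::'n list. length I = 0 \<longrightarrow> length J = 1 \<longrightarrow> P I J) \<longleftrightarrow> (\<forall>j. P [] [j])" for P
    by (auto simp: length_Suc_conv)
  have no_swap: "(\<forall>a b. a < b \<and> b < 1 \<longrightarrow> R a b) = True" "(\<forall>a b. a < b \<and> b < 0 \<longrightarrow> R a b) = True"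
    for R :: "nat \<Rightarrow> nat \<Rightarrow> bool" by simp_all
  show ?thesis
    unfolding pq_form_def all2 sum_lists_length_1 sum_lists_length_0 no_swap by (simp add: lessThan_Suc)
qed

lemma form_eq_11_iff: "form_eq A 1 1 \<omega> \<eta> \<longleftrightarrow> (\<forall>c\<in>A. \<forall>i j. \<forall>x\<in>fst c. \<omega> c [i] [j] x = \<eta> c [i] [j] x)"
  by (auto simp: form_eq_def length_Suc_conv)

lemma del_1: "del \<omega> c [i] J x = D_z c i (\<omega> c [] J) x"
  by (simp add: del_def remove_nth_def lessThan_Suc)

lemma delbar_1: "delbar \<omega> c I [j] x = (-1) ^ length I * D_zbar c j (\<omega> c I []) x"
  by (simp add: delbar_def remove_nth_def lessThan_Suc)

lemma del_2: "del \<omega> c [i, i'] J x = D_z c i (\<omega> c [i'] J) x - D_z c i' (\<omega> c [i] J) x"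
  by (simp add: del_def remove_nth_def lessThan_Suc numeral_2_eq_2)

text \<open>The sign for moving past the single dz reverses the usual order of the alternating
  difference.\<close>

lemma delbar_2: "delbar \<omega> c [i] [j, j'] x = D_zbar c j' (\<omega> c [i] [j]) x - D_zbar c j (\<omega> c [i] [j']) x"
  by (simp add: delbar_def remove_nth_def lessThan_Suc numeral_2_eq_2)

text \<open>Conjugation exchanges the two factors of dz wedge dzbar, hence the sign: reality means
  that the coefficient matrix is anti-Hermitian.\<close>

lemma real_11_forms_iff:
  "\<omega> \<in> real_11_forms A \<longleftrightarrow> pq_form A 1 1 \<omega> \<and> (\<forall>c\<in>A. \<forall>i j. \<forall>x\<in>fst c. cnj (\<omega> c [j] [i] x) = - \<omega> c [i] [j] x)"
  unfolding real_11_forms_def form_eq_11_iff cnj_form_def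
  by (auto simp: minus_equation_iff[of "cnj _"] simp del: One_nat_def)

section \<open>Aeppli cohomology\<close>

context complex_manifold
begin

lemma pq_form_11_add: "pq_form A 1 1 \<omega> \<Longrightarrow> pq_form A 1 1 \<eta> \<Longrightarrow> pq_form A 1 1 (\<omega> + \<eta>)"
  unfolding pq_form_11_iff
  by (auto simp: plus_fun_def distrib_right sum.distrib intro!: chart_smooth_add)

lemma pq_form_11_minus: "pq_form A 1 1 \<omega> \<Longrightarrow> pq_form A 1 1 (- \<omega>)"
  unfolding pq_form_11_iff
  by (auto simp: fun_Compl_def sum_negf intro!: chart_smooth_minus)

lemma real_11_forms_add: "\<omega> \<in> real_11_forms A \<Longrightarrow> \<eta> \<in> real_11_forms A \<Longrightarrow> \<omega> + \<eta> \<in> real_11_forms A"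
  by (simp add: real_11_forms_iff pq_form_11_add del: One_nat_def)

lemma real_11_forms_minus: "\<omega> \<in> real_11_forms A \<Longrightarrow> - \<omega> \<in> real_11_forms A"
  by (simp add: real_11_forms_iff pq_form_11_minus del: One_nat_def)

lemma aeppli_coboundaries_add:
  assumes "\<omega> \<in> aeppli_coboundaries A" "\<eta> \<in> aeppli_coboundaries A"
  shows "\<omega> + \<eta> \<in> aeppli_coboundaries A"
proof -
  obtain \<alpha> \<beta> where 1: "pq_form A 0 1 \<alpha>" "pq_form A 1 0 \<beta>" "form_eq A 1 1 \<omega> (del \<alpha> + delbar \<beta>)"
    using assms(1) by (auto simp: aeppli_coboundaries_def)
  obtain \<alpha>' \<beta>' where 2: "pq_form A 0 1 \<alpha>'" "pq_form A 1 0 \<beta>'" "form_eq A 1 1 \<eta> (del \<alpha>' + delbar \<beta>')"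
    using assms(2) by (auto simp: aeppli_coboundaries_def)
  have "pq_form A 0 1 (\<alpha> + \<alpha>')" "pq_form A 1 0 (\<beta> + \<beta>')"
    using 1(1,2) 2(1,2) unfolding pq_form_01_iff pq_form_10_iff
    by (auto simp: plus_fun_def distrib_right sum.distrib intro!: chart_smooth_add)
  moreover have "form_eq A 1 1 (\<omega> + \<eta>) (del (\<alpha> + \<alpha>') + delbar (\<beta> + \<beta>'))"
    unfolding form_eq_11_iff
  proof (intro ballI allI)
    fix c x and i j :: 'n assume c: "c \<in> A" and x: "x \<in> fst c"
    have s: "chart_smooth_on c UNIV (\<alpha> c [] [j])" "chart_smooth_on c UNIV (\<alpha>' c [] [j])"
      "chart_smooth_on c UNIV (\<beta> c [i] [])" "chart_smooth_on c UNIV (\<beta>' c [i] [])"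
      using 1(1,2) 2(1,2) c unfolding pq_form_01_iff pq_form_10_iff by blast+
    show "(\<omega> + \<eta>) c [i] [j] x = (del (\<alpha> + \<alpha>') + delbar (\<beta> + \<beta>')) c [i] [j] x"
      using 1(3)[unfolded form_eq_11_iff] 2(3)[unfolded form_eq_11_iff] c x wirtinger_add[OF c x UNIV_I s(1,2)] wirtinger_add[OF c x UNIV_I s(3,4)]
      by (simp add: del_1 delbar_1 plus_fun_def D_z_wirtinger D_zbar_wirtinger)
  qed
  ultimately show ?thesis
    using assms real_11_forms_add unfolding aeppli_coboundaries_def by blast
qed

lemma aeppli_coboundaries_minus:
  assumes "\<omega> \<in> aeppli_coboundaries A"
  shows "- \<omega> \<in> aeppli_coboundaries A"
proof -
  obtain \<alpha> \<beta> where 1: "pq_form A 0 1 \<alpha>" "pq_form A 1 0 \<beta>" "form_eq A 1 1 \<omega> (del \<alpha> + delbar \<beta>)"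
    using assms(1) by (auto simp: aeppli_coboundaries_def)
  have "pq_form A 0 1 (- \<alpha>)" "pq_form A 1 0 (- \<beta>)"
    using 1(1,2) unfolding pq_form_01_iff pq_form_10_iff
    by (auto simp: fun_Compl_def sum_negf intro!: chart_smooth_minus)
  moreover have "form_eq A 1 1 (- \<omega>) (del (- \<alpha>) + delbar (- \<beta>))"
    unfolding form_eq_11_iff
  proof (intro ballI allI)
    fix c x and i j :: 'n assume c: "c \<in> A" and x: "x \<in> fst c"
    have s: "chart_smooth_on c UNIV (\<alpha> c [] [j])" "chart_smooth_on c UNIV (\<beta> c [i] [])"
      using 1(1,2) c unfolding pq_form_01_iff pq_form_10_iff by blast+
    show "(- \<omega>) c [i] [j] x = (del (- \<alpha>) + delbar (- \<beta>)) c [i] [j] x"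
      using 1(3)[unfolded form_eq_11_iff] c x wirtinger_minus[OF c x UNIV_I s(1)] wirtinger_minus[OF c x UNIV_I s(2)]
      by (simp add: del_1 delbar_1 fun_Compl_def D_z_wirtinger D_zbar_wirtinger)
  qed
  ultimately show ?thesis
    using assms real_11_forms_minus unfolding aeppli_coboundaries_def by blast
qed

text \<open>Coboundaries are closed under sums and negatives, so any \<open>\<zeta>\<close> differs
  from \<open>\<omega>\<close> by a coboundary exactly when it does from \<open>\<eta>\<close>.
  Being a cocycle is part of the relation and must be known for both representatives.\<close>

lemma aeppli_class_eqI:
  assumes "\<omega> \<in> aeppli_cocycles A" "\<eta> \<in> aeppli_cocycles A" "\<omega> - \<eta> \<in> aeppli_coboundaries A"
  shows "aeppli_class A \<omega> = aeppli_class A \<eta>"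
proof -
  have "\<omega> - \<zeta> \<in> aeppli_coboundaries A \<longleftrightarrow> \<eta> - \<zeta> \<in> aeppli_coboundaries A" for \<zeta>
    using aeppli_coboundaries_add[OF assms(3), of "\<eta> - \<zeta>"]
      aeppli_coboundaries_add[OF aeppli_coboundaries_minus[OF assms(3)], of "\<omega> - \<zeta>"]
    by (auto simp: algebra_simps)
  then show ?thesis
    using assms(1,2) by (auto simp: aeppli_class_def aeppli_rel_def)
qed

text \<open>The product rule would add a derivative of the conjugate Jacobian, but this is
  antiholomorphic, so \<open>D_z\<close> of the transformation law stays tensorial.\<close>

lemma pq_form_del:
  assumes "pq_form A 0 1 \<alpha>"
  shows "pq_form A 1 1 (del \<alpha>)"
  unfolding pq_form_11_iff
proof (intro conjI ballI allI)
  fix c and i j :: 'n assume c: "c \<in> A"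
  have "chart_smooth_on c UNIV (D_z c i (\<alpha> c [] [j]))"
    using assms c unfolding D_z_wirtinger pq_form_01_iff by (intro chart_smooth_wirtinger) auto
  then show "chart_smooth_on c UNIV (del \<alpha> c [i] [j])"
    by (simp add: del_1[abs_def])
next
  fix c d x and i j :: 'n assume c: "c \<in> A" and d: "d \<in> A" and x: "x \<in> fst c \<inter> fst d"
  note o = open_chart[OF d]
  have xc: "x \<in> fst c" and xd: "x \<in> fst d" using x by auto
  have s: "chart_smooth_on c UNIV (\<alpha> c [] [j])" if "c \<in> A" for c j
    using assms that unfolding pq_form_01_iff by blast
  have sd: "chart_smooth_on c (fst d) (\<alpha> d [] [b])" for b
    using chart_smooth_change[OF d c open_UNIV s[OF d]] by simp
  have sJ: "chart_smooth_on c (fst d) (\<lambda>y. cnj (jacobian c d b j y))" for b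
    by (rule chart_smooth_cnj[OF c o chart_smooth_jacobian[OF c d]])
  have law: "\<alpha> c [] [j] y = (\<Sum>b\<in>UNIV. \<alpha> d [] [b] y * cnj (jacobian c d b j y))"
    if "y \<in> fst c" "y \<in> fst d" for y
    using assms c d that unfolding pq_form_01_iff by blast
  have "D_z c i (\<alpha> c [] [j]) x = D_z c i (\<lambda>y. \<Sum>b\<in>UNIV. \<alpha> d [] [b] y * cnj (jacobian c d b j y)) x"
    unfolding D_z_wirtinger
    by (rule wirtinger_cong[OF c o chart_smooth_sum[OF c o chart_smooth_mult[OF c o sd sJ]] xc xd])
       (simp add: law)
  also have "\<dots> = (\<Sum>b\<in>UNIV. D_z c i (\<alpha> d [] [b]) x * cnj (jacobian c d b j x))"
    using D_z_cnj_jacobian[OF c d xc xd]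
    unfolding D_z_wirtinger wirtinger_sum_mult_on[OF c o xc xd sd sJ] by simp
  also have "\<dots> = (\<Sum>b\<in>UNIV. \<Sum>a\<in>UNIV. D_z d a (\<alpha> d [] [b]) x * jacobian c d a i x * cnj (jacobian c d b j x))"
    unfolding D_z_change[OF c d xc xd open_UNIV UNIV_I s[OF d]] sum_distrib_right by (rule refl)
  also have "\<dots> = (\<Sum>a\<in>UNIV. \<Sum>b\<in>UNIV. D_z d a (\<alpha> d [] [b]) x * jacobian c d a i x * cnj (jacobian c d b j x))"
    by (rule sum.swap)
  finally show "del \<alpha> c [i] [j] x
      = (\<Sum>a\<in>UNIV. \<Sum>b\<in>UNIV. del \<alpha> d [a] [b] x * jacobian c d a i x * cnj (jacobian c d b j x))"
    by (simp add: del_1)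
qed

text \<open>The roles are exchanged: here the holomorphic Jacobian is killed by
  \<open>D_zbar\<close>.\<close>

lemma pq_form_delbar:
  assumes "pq_form A 1 0 \<beta>"
  shows "pq_form A 1 1 (delbar \<beta>)"
  unfolding pq_form_11_iff
proof (intro conjI ballI allI)
  fix c and i j :: 'n assume c: "c \<in> A"
  have "chart_smooth_on c UNIV (\<lambda>x. - D_zbar c j (\<beta> c [i] []) x)"
    using assms c unfolding D_zbar_wirtinger pq_form_10_iff
    by (intro chart_smooth_minus chart_smooth_wirtinger) auto
  then show "chart_smooth_on c UNIV (delbar \<beta> c [i] [j])"
    by (simp add: delbar_1[abs_def])
next
  fix c d x and i j :: 'n assume c: "c \<in> A" and d: "d \<in> A" and x: "x \<in> fst c \<inter> fst d"
  note o = open_chart[OF d]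
  have xc: "x \<in> fst c" and xd: "x \<in> fst d" using x by auto
  have s: "chart_smooth_on c UNIV (\<beta> c [i] [])" if "c \<in> A" for c i
    using assms that unfolding pq_form_10_iff by blast
  have sd: "chart_smooth_on c (fst d) (\<beta> d [a] [])" for a
    using chart_smooth_change[OF d c open_UNIV s[OF d]] by simp
  note sJ = chart_smooth_jacobian[OF c d]
  have law: "\<beta> c [i] [] y = (\<Sum>a\<in>UNIV. \<beta> d [a] [] y * jacobian c d a i y)"
    if "y \<in> fst c" "y \<in> fst d" for y
    using assms c d that unfolding pq_form_10_iff by blast
  have "D_zbar c j (\<beta> c [i] []) x = D_zbar c j (\<lambda>y. \<Sum>a\<in>UNIV. \<beta> d [a] [] y * jacobian c d a i y) x"
    unfolding D_zbar_wirtinger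
    by (rule wirtinger_cong[OF c o chart_smooth_sum[OF c o chart_smooth_mult[OF c o sd sJ]] xc xd])
       (simp add: law)
  also have "\<dots> = (\<Sum>a\<in>UNIV. D_zbar c j (\<beta> d [a] []) x * jacobian c d a i x)"
    using D_zbar_jacobian[OF c d xc xd]
    unfolding D_zbar_wirtinger wirtinger_sum_mult_on[OF c o xc xd sd sJ] by simp
  also have "\<dots> = (\<Sum>a\<in>UNIV. \<Sum>b\<in>UNIV. D_zbar d b (\<beta> d [a] []) x * jacobian c d a i x * cnj (jacobian c d b j x))"
    unfolding D_zbar_change[OF c d xc xd open_UNIV UNIV_I s[OF d]] sum_distrib_right by (simp add: mult_ac)
  finally show "delbar \<beta> c [i] [j] x
      = (\<Sum>a\<in>UNIV. \<Sum>b\<in>UNIV. delbar \<beta> d [a] [b] x * jacobian c d a i x * cnj (jacobian c d b j x))"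
    by (simp add: delbar_1 sum_negf)
qed

lemma pq_form_cnj_form:
  assumes "pq_form A 1 0 \<beta>"
  shows "pq_form A 0 1 (cnj_form \<beta>)"
  unfolding pq_form_01_iff
proof (intro conjI ballI allI)
  fix c and j :: 'n assume c: "c \<in> A"
  then have "chart_smooth_on c UNIV (\<lambda>x. cnj (\<beta> c [j] [] x))"
    using assms unfolding pq_form_10_iff by (intro chart_smooth_cnj) auto
  then show "chart_smooth_on c UNIV (cnj_form \<beta> c [] [j])"
    by (simp add: cnj_form_def)
next
  fix c d x and j :: 'n assume "c \<in> A" "d \<in> A" "x \<in> fst c \<inter> fst d"
  then have "\<beta> c [j] [] x = (\<Sum>a\<in>UNIV. \<beta> d [a] [] x * jacobian c d a j x)"
    using assms unfolding pq_form_10_iff by blast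
  then show "cnj_form \<beta> c [] [j] x = (\<Sum>b\<in>UNIV. cnj_form \<beta> d [] [b] x * cnj (jacobian c d b j x))"
    by (simp add: cnj_form_def)
qed

text \<open>A form $\partial p + \bar\partial q$ with only locally defined $p$ and $q$ is already
  $\partial\bar\partial$-closed; the Chern-Ricci form is of this kind.\<close>

lemma del_delbar_zero:
  assumes p: "\<And>c j. c \<in> A \<Longrightarrow> chart_smooth_on c UNIV (p c j)"
    and q: "\<And>c i. c \<in> A \<Longrightarrow> chart_smooth_on c UNIV (q c i)"
    and \<omega>: "\<And>c i j x. c \<in> A \<Longrightarrow> x \<in> fst c \<Longrightarrow> \<omega> c [i] [j] x = D_z c i (p c j) x + D_zbar c j (q c i) x"
  shows "form_eq A 2 2 (del (delbar \<omega>)) 0"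
proof -
  have "del (delbar \<omega>) c [i, i'] [j, j'] x = 0" if c: "c \<in> A" and x: "x \<in> fst c" for c i i' j j' x
  proof -
    define P where "P y = D_zbar c j' (p c j) y - D_zbar c j (p c j') y" for y
    have sD: "chart_smooth_on c UNIV (wirtinger a c k f)" if "chart_smooth_on c UNIV f" for a k f
      by (rule chart_smooth_wirtinger[OF c open_UNIV that])
    have sP: "chart_smooth_on c UNIV P"
      unfolding P_def[abs_def] D_zbar_wirtinger by (intro chart_smooth_diff sD p c open_UNIV)
    have D\<omega>: "D_zbar c k (\<omega> c [i] [l]) y = D_z c i (D_zbar c k (p c l)) y + D_zbar c k (D_zbar c l (q c i)) y"
      if y: "y \<in> fst c" for i k l y
    proof -
      have "D_zbar c k (\<omega> c [i] [l]) y = D_zbar c k (\<lambda>y. D_z c i (p c l) y + D_zbar c l (q c i) y) y"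
        unfolding D_zbar_wirtinger D_z_wirtinger
        by (rule wirtinger_cong[OF c open_UNIV chart_smooth_add[OF c open_UNIV sD[OF p[OF c]] sD[OF q[OF c]]] y UNIV_I])
           (simp add: \<omega>[OF c] D_zbar_wirtinger D_z_wirtinger)
      then show ?thesis
        by (simp add: D_zbar_wirtinger D_z_wirtinger wirtinger_add[OF c y UNIV_I sD[OF p[OF c]] sD[OF q[OF c]]]
            wirtinger_commute[OF c open_UNIV p[OF c] y UNIV_I, of \<i> k "- \<i>" i])
    qed
    have "delbar \<omega> c [i] [j, j'] y = D_z c i P y" if y: "y \<in> fst c" for i y
    proof -
      have "D_z c i P y = D_z c i (D_zbar c j' (p c j)) y - D_z c i (D_zbar c j (p c j')) y"
        using wirtinger_add[OF c y UNIV_I sD[OF p[OF c]] chart_smooth_minus[OF c open_UNIV sD[OF p[OF c]]]]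
          wirtinger_minus[OF c y UNIV_I sD[OF p[OF c]]]
        by (simp add: P_def[abs_def] D_zbar_wirtinger D_z_wirtinger)
      moreover have "D_zbar c j (D_zbar c j' (q c i)) y = D_zbar c j' (D_zbar c j (q c i)) y"
        unfolding D_zbar_wirtinger by (rule wirtinger_commute[OF c open_UNIV q[OF c] y UNIV_I])
      ultimately show ?thesis by (simp add: delbar_2 D\<omega>[OF y])
    qed
    then have "D_z c k (delbar \<omega> c [i] [j, j']) x = D_z c k (D_z c i P) x" for k i
      unfolding D_z_wirtinger by (intro wirtinger_cong[OF c open_UNIV sD[OF sP] x UNIV_I]) auto
    moreover have "D_z c i (D_z c i' P) x = D_z c i' (D_z c i P) x"
      unfolding D_z_wirtinger by (rule wirtinger_commute[OF c open_UNIV sP x UNIV_I])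
    ultimately show ?thesis by (simp add: del_2)
  qed
  then show ?thesis by (auto simp: form_eq_def length_Suc_conv numeral_2_eq_2)
qed

end

section \<open>Ricci forms\<close>

context hermitian
begin

lemma chern_ricci_gamma:
  "c \<in> A \<Longrightarrow> x \<in> fst c \<Longrightarrow> chern_ricci g c [i] [j] x = - \<i> * D_zbar c j (gamma c i) x"
  by (simp add: chern_ricci_def form11_def D_zbar_gamma)

lemma pq_form_chern_ricci: "pq_form A 1 1 (chern_ricci g)"
  unfolding pq_form_11_iff
proof (intro conjI ballI allI)
  fix c and i j :: 'n assume c: "c \<in> A"
  have "chart_smooth_on c UNIV (\<lambda>x. - \<i> * D_zbar c j (gamma c i) x)"
    unfolding D_zbar_wirtinger
    by (intro chart_smooth_mult chart_smooth_const chart_smooth_wirtinger chart_smooth_gamma c open_UNIV)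
  then show "chart_smooth_on c UNIV (chern_ricci g c [i] [j])"
    by (rule chart_smooth_cong[OF c open_UNIV]) (simp add: chern_ricci_gamma[OF c])
next
  fix c d x and i j :: 'n assume "c \<in> A" "d \<in> A" "x \<in> fst c \<inter> fst d"
  then show "chern_ricci g c [i] [j] x
      = (\<Sum>a\<in>UNIV. \<Sum>b\<in>UNIV. chern_ricci g d [a] [b] x * jacobian c d a i x * cnj (jacobian c d b j x))"
    by (simp add: chern_ricci_gamma D_zbar_gamma_change[of c d x] sum_distrib_left sum_negf mult.assoc)
qed

text \<open>The metric is Hermitian and conjugation exchanges \<open>D_z\<close> and
  \<open>D_zbar\<close>; commuting the second derivatives restores the order of the
  definition.\<close>

lemma cnj_chern_curv:
  assumes c: "c \<in> A" and x: "x \<in> fst c"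
  shows "cnj (chern_curv g c i j k l x) = chern_curv g c j i l k x"
proof -
  have s: "chart_smooth_on c UNIV (wirtinger a c i (h_lo g c k l))" for a i k l
    by (intro chart_smooth_wirtinger chart_smooth_h_lo c open_UNIV)
  have w: "wirtinger a c i (h_lo g c k l) y = cnj (wirtinger (cnj a) c i (h_lo g c l k) y)"
    if y: "y \<in> fst c" for a i k l y
  proof -
    have "wirtinger a c i (h_lo g c k l) y = wirtinger a c i (\<lambda>z. cnj (h_lo g c l k z)) y"
      by (rule wirtinger_cong[OF c open_UNIV chart_smooth_cnj[OF c open_UNIV chart_smooth_h_lo[OF c]] y UNIV_I])
         (simp add: cnj_h_lo[OF c])
    then show ?thesis by (simp add: wirtinger_cnj[OF c y UNIV_I chart_smooth_h_lo[OF c]])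
  qed
  have "D_z c j (D_zbar c i (h_lo g c l k)) x = D_zbar c i (D_z c j (h_lo g c l k)) x"
    unfolding D_zbar_wirtinger D_z_wirtinger
    by (rule wirtinger_commute[OF c open_UNIV chart_smooth_h_lo[OF c] x UNIV_I])
  also have "\<dots> = D_zbar c i (\<lambda>y. cnj (D_zbar c j (h_lo g c k l) y)) x"
    unfolding D_zbar_wirtinger D_z_wirtinger
    by (rule wirtinger_cong[OF c open_UNIV chart_smooth_cnj[OF c open_UNIV s] x UNIV_I])
       (subst w, simp_all)
  also have "\<dots> = cnj (D_z c i (D_zbar c j (h_lo g c k l)) x)"
    unfolding D_zbar_wirtinger D_z_wirtinger by (simp add: wirtinger_cnj[OF c x UNIV_I s])
  finally have 1: "cnj (D_z c i (D_zbar c j (h_lo g c k l)) x) = D_z c j (D_zbar c i (h_lo g c l k)) x" ..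
  have 2: "cnj (D_zbar c j (h_lo g c p l) x) = D_z c j (h_lo g c l p) x"
    "cnj (D_z c i (h_lo g c k q) x) = D_zbar c i (h_lo g c q k) x" for p q
    unfolding D_zbar_wirtinger D_z_wirtinger by (simp_all add: w[OF x, of _ _ l p] w[OF x, of _ _ q k])
  show ?thesis
    unfolding chern_curv_def
    by (subst (2) sum.swap) (simp add: 1 2 cnj_h_up[OF c x] mult_ac)
qed

lemma real_chern_ricci: "chern_ricci g \<in> real_11_forms A"
proof -
  have "cnj (chern_ricci g c [j] [i] x) = - chern_ricci g c [i] [j] x" if c: "c \<in> A" and x: "x \<in> fst c" for c i j x
    unfolding chern_ricci_def form11_def
    by (subst sum.swap) (simp add: cnj_chern_curv[OF c x] cnj_h_up[OF c x])
  then show ?thesis using pq_form_chern_ricci by (simp add: real_11_forms_iff)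
qed

lemma chern_ricci_cocycle: "chern_ricci g \<in> aeppli_cocycles A"
proof -
  have "form_eq A 2 2 (del (delbar (chern_ricci g))) 0"
  \<comment> \<open>Because of its inhomogeneous transformation \<open>gamma\<close> need not be a
    global (1,0)-form, but it serves as a local potential.\<close>
  proof (rule del_delbar_zero[where p = "\<lambda>c j x. 0" and q = "\<lambda>c i x. - \<i> * gamma c i x"])
    show "chart_smooth_on c UNIV (\<lambda>x. - \<i> * gamma c i x)" if "c \<in> A" for c i
      by (intro chart_smooth_mult chart_smooth_const chart_smooth_gamma that open_UNIV)
    show "chart_smooth_on c UNIV (\<lambda>_. 0)" if "c \<in> A" for c by (rule chart_smooth_const[OF that open_UNIV])
    show "chern_ricci g c [i] [j] x = D_z c i (\<lambda>_. 0) x + D_zbar c j (\<lambda>x. - \<i> * gamma c i x) x"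
      if "c \<in> A" "x \<in> fst c" for c i j x
      using that wirtinger_cmult[OF that UNIV_I chart_smooth_gamma[OF that(1)], of \<i> j "- \<i>" i]
      by (simp add: chern_ricci_gamma D_z_wirtinger D_zbar_wirtinger wirtinger_const)
  qed
  then show ?thesis using real_chern_ricci by (simp add: aeppli_cocycles_def)
qed

end

context theta_connection
begin

text \<open>Contracting an upper with a lower index is independent of the chart: the Jacobian of the
  one meets the inverse Jacobian of the other.\<close>

lemma pq_form_trace_form: "pq_form A 1 0 (trace_form \<theta>)"
  unfolding pq_form_10_iff
proof (intro conjI ballI allI)
  fix c and i :: 'n assume c: "c \<in> A"
  then have "chart_smooth_on c UNIV (\<lambda>x. \<Sum>k\<in>UNIV. \<theta> c i k k x)"
    by (intro chart_smooth_sum chart_smooth_theta open_UNIV)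
  then show "chart_smooth_on c UNIV (trace_form \<theta> c [i] [])"
    by (simp add: trace_form_def form10_def)
next
  fix c d x and i :: 'n assume c: "c \<in> A" and d: "d \<in> A" and x: "x \<in> fst c \<inter> fst d"
  have xc: "x \<in> fst c" and xd: "x \<in> fst d" using x by auto
  let ?J = "\<lambda>a k. jacobian c d a k x" and ?K = "\<lambda>k a. jacobian d c k a x"
  have law: "(\<Sum>a\<in>UNIV. \<Sum>b\<in>UNIV. \<theta> d a b m x * ?J a i * ?J b j) = (\<Sum>k\<in>UNIV. \<theta> c i j k x * ?J m k)" for j m
    using theta_form c d x unfolding End_valued_10_form_def by blast
  \<comment> \<open>A Kronecker delta is inserted as inverse Jacobian times Jacobian, which creates
    the right-hand side of \<open>law\<close>.\<close>
  have "(\<Sum>j\<in>UNIV. \<theta> c i j j x) = (\<Sum>j\<in>UNIV. \<Sum>k\<in>UNIV. \<theta> c i j k x * (\<Sum>m\<in>UNIV. ?K j m * ?J m k))"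
    by (simp add: jacobian_inverse[OF c d xc xd] if_distrib[of "\<lambda>t. a * t" for a] cong: if_cong)
  also have "\<dots> = (\<Sum>j\<in>UNIV. \<Sum>m\<in>UNIV. ?K j m * (\<Sum>k\<in>UNIV. \<theta> c i j k x * ?J m k))"
    unfolding sum_distrib_left by (rule sum.cong[OF refl], subst sum.swap) (simp add: mult_ac)
  also have "\<dots> = (\<Sum>j\<in>UNIV. \<Sum>m\<in>UNIV. \<Sum>a\<in>UNIV. \<Sum>b\<in>UNIV. \<theta> d a b m x * ?J a i * (?J b j * ?K j m))"
    unfolding law[symmetric] sum_distrib_left by (simp add: mult_ac)
  also have "\<dots> = (\<Sum>m\<in>UNIV. \<Sum>j\<in>UNIV. \<Sum>a\<in>UNIV. \<Sum>b\<in>UNIV. \<theta> d a b m x * ?J a i * (?J b j * ?K j m))"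
    by (rule sum.swap)
  also have "\<dots> = (\<Sum>m\<in>UNIV. \<Sum>a\<in>UNIV. \<Sum>j\<in>UNIV. \<Sum>b\<in>UNIV. \<theta> d a b m x * ?J a i * (?J b j * ?K j m))"
    by (intro sum.cong refl sum.swap)
  also have "\<dots> = (\<Sum>m\<in>UNIV. \<Sum>a\<in>UNIV. \<Sum>b\<in>UNIV. \<Sum>j\<in>UNIV. \<theta> d a b m x * ?J a i * (?J b j * ?K j m))"
    by (intro sum.cong refl sum.swap)
  also have "\<dots> = (\<Sum>m\<in>UNIV. \<Sum>a\<in>UNIV. \<theta> d a m m x * ?J a i)"
    by (simp add: jacobian_inverse[OF d c xd xc] if_distrib[of "\<lambda>t. a * t" for a] flip: sum_distrib_left cong: if_cong)
  also have "\<dots> = (\<Sum>a\<in>UNIV. (\<Sum>m\<in>UNIV. \<theta> d a m m x) * ?J a i)"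
    unfolding sum_distrib_right by (rule sum.swap)
  finally show "trace_form \<theta> c [i] [] x = (\<Sum>a\<in>UNIV. trace_form \<theta> d [a] [] x * ?J a i)"
    by (simp add: trace_form_def form10_def)
qed

lemma hat_ricci_formula:
  assumes c: "c \<in> A" and x: "x \<in> fst c"
  shows "hat_ricci A g D c [i] [j] x = chern_ricci g c [i] [j] x
    - \<i> * (del (cnj_form (trace_form \<theta>)) c [i] [j] x - delbar (trace_form \<theta>) c [i] [j] x)"
proof -
  let ?U = "\<lambda>k l. h_up g c k l x" and ?h = "\<lambda>k l. h_lo g c k l x" and ?t = "\<lambda>i j k. \<theta> c i j k x"
  \<comment> \<open>The inverse metric against the unbarred index of the metric leaves the trace
    over the barred indices; \<open>UW\<close> is the counterpart with the roles exchanged.\<close>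
  have UV: "(\<Sum>k\<in>UNIV. \<Sum>l\<in>UNIV. ?U k l * (\<Sum>p\<in>UNIV. ?h k p * f l p)) = (\<Sum>l\<in>UNIV. f l l)" for f
  proof -
    have "(\<Sum>k\<in>UNIV. \<Sum>l\<in>UNIV. ?U k l * (\<Sum>p\<in>UNIV. ?h k p * f l p))
        = (\<Sum>l\<in>UNIV. \<Sum>p\<in>UNIV. f l p * (\<Sum>k\<in>UNIV. ?h k p * ?U k l))"
      unfolding sum_distrib_left by (subst sum.swap, rule sum.cong[OF refl], subst sum.swap) (simp add: mult_ac)
    then show ?thesis by (simp add: h_lo_h_up[OF c x] if_distrib[of "\<lambda>t. a * t" for a] cong: if_cong)
  qed
  have UW: "(\<Sum>k\<in>UNIV. \<Sum>l\<in>UNIV. ?U k l * (\<Sum>p\<in>UNIV. ?h p l * f k p)) = (\<Sum>k\<in>UNIV. f k k)" for f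
  proof -
    have "(\<Sum>k\<in>UNIV. \<Sum>l\<in>UNIV. ?U k l * (\<Sum>p\<in>UNIV. ?h p l * f k p))
        = (\<Sum>k\<in>UNIV. \<Sum>p\<in>UNIV. f k p * (\<Sum>l\<in>UNIV. ?U k l * ?h p l))"
      unfolding sum_distrib_left by (rule sum.cong[OF refl], subst sum.swap) (simp add: mult_ac)
    then show ?thesis by (simp add: h_up_h_lo[OF c x] if_distrib[of "\<lambda>t. a * t" for a] cong: if_cong)
  qed
  \<comment> \<open>Contracting the second quadratic term with \<open>?U k l\<close> removes one
    metric factor and leaves its internal pair m, n as the traced pair; up to renaming this is the
    trace of the first term.\<close>
  have Q: "(\<Sum>k\<in>UNIV. \<Sum>l\<in>UNIV. ?U k l * (\<Sum>m\<in>UNIV. \<Sum>n\<in>UNIV. \<Sum>p\<in>UNIV. \<Sum>q\<in>UNIV.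
        ?U m n * ?t i m p * cnj (?t j n q) * ?h p l * ?h k q))
      = (\<Sum>k\<in>UNIV. \<Sum>l\<in>UNIV. ?U k l * (\<Sum>p\<in>UNIV. \<Sum>q\<in>UNIV. ?t i k p * cnj (?t j l q) * ?h p q))"
  proof -
    have "(\<Sum>m\<in>UNIV. \<Sum>n\<in>UNIV. \<Sum>p\<in>UNIV. \<Sum>q\<in>UNIV. ?U m n * ?t i m p * cnj (?t j n q) * ?h p l * ?h k q)
        = (\<Sum>p\<in>UNIV. ?h p l * (\<Sum>q\<in>UNIV. ?h k q * (\<Sum>m\<in>UNIV. \<Sum>n\<in>UNIV. ?U m n * ?t i m p * cnj (?t j n q))))"
      for k l
    proof -
      have "(\<Sum>m\<in>UNIV. \<Sum>n\<in>UNIV. \<Sum>p\<in>UNIV. \<Sum>q\<in>UNIV. ?U m n * ?t i m p * cnj (?t j n q) * ?h p l * ?h k q)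
          = (\<Sum>m\<in>UNIV. \<Sum>p\<in>UNIV. \<Sum>n\<in>UNIV. \<Sum>q\<in>UNIV. ?U m n * ?t i m p * cnj (?t j n q) * ?h p l * ?h k q)"
        by (intro sum.cong refl sum.swap)
      also have "\<dots> = (\<Sum>p\<in>UNIV. \<Sum>m\<in>UNIV. \<Sum>n\<in>UNIV. \<Sum>q\<in>UNIV. ?U m n * ?t i m p * cnj (?t j n q) * ?h p l * ?h k q)"
        by (rule sum.swap)
      also have "\<dots> = (\<Sum>p\<in>UNIV. \<Sum>m\<in>UNIV. \<Sum>q\<in>UNIV. \<Sum>n\<in>UNIV. ?U m n * ?t i m p * cnj (?t j n q) * ?h p l * ?h k q)"
        by (intro sum.cong refl sum.swap)
      also have "\<dots> = (\<Sum>p\<in>UNIV. \<Sum>q\<in>UNIV. \<Sum>m\<in>UNIV. \<Sum>n\<in>UNIV. ?U m n * ?t i m p * cnj (?t j n q) * ?h p l * ?h k q)"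
        by (intro sum.cong refl sum.swap)
      finally show ?thesis by (simp add: sum_distrib_left mult_ac)
    qed
    then have "(\<Sum>k\<in>UNIV. \<Sum>l\<in>UNIV. ?U k l * (\<Sum>m\<in>UNIV. \<Sum>n\<in>UNIV. \<Sum>p\<in>UNIV. \<Sum>q\<in>UNIV.
        ?U m n * ?t i m p * cnj (?t j n q) * ?h p l * ?h k q))
      = (\<Sum>k\<in>UNIV. \<Sum>q\<in>UNIV. ?h k q * (\<Sum>m\<in>UNIV. \<Sum>n\<in>UNIV. ?U m n * ?t i m k * cnj (?t j n q)))"
      by (simp add: UW)
    also have "\<dots> = (\<Sum>k\<in>UNIV. \<Sum>q\<in>UNIV. \<Sum>m\<in>UNIV. \<Sum>n\<in>UNIV. ?U m n * (?t i m k * cnj (?t j n q) * ?h k q))"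
      by (simp add: sum_distrib_left mult_ac)
    also have "\<dots> = (\<Sum>k\<in>UNIV. \<Sum>m\<in>UNIV. \<Sum>q\<in>UNIV. \<Sum>n\<in>UNIV. ?U m n * (?t i m k * cnj (?t j n q) * ?h k q))"
      by (intro sum.cong refl sum.swap)
    also have "\<dots> = (\<Sum>m\<in>UNIV. \<Sum>k\<in>UNIV. \<Sum>q\<in>UNIV. \<Sum>n\<in>UNIV. ?U m n * (?t i m k * cnj (?t j n q) * ?h k q))"
      by (rule sum.swap)
    also have "\<dots> = (\<Sum>m\<in>UNIV. \<Sum>k\<in>UNIV. \<Sum>n\<in>UNIV. \<Sum>q\<in>UNIV. ?U m n * (?t i m k * cnj (?t j n q) * ?h k q))"
      by (intro sum.cong refl sum.swap)
    also have "\<dots> = (\<Sum>m\<in>UNIV. \<Sum>n\<in>UNIV. \<Sum>k\<in>UNIV. \<Sum>q\<in>UNIV. ?U m n * (?t i m k * cnj (?t j n q) * ?h k q))"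
      by (intro sum.cong refl sum.swap)
    finally show ?thesis by (simp add: sum_distrib_left)
  qed
  have th: "chart_smooth_on c UNIV (\<lambda>y. cnj (\<theta> c j k k y))" for k
    by (intro chart_smooth_cnj c open_UNIV chart_smooth_theta)
  have del: "del (cnj_form (trace_form \<theta>)) c [i] [j] x = (\<Sum>l\<in>UNIV. D_z c i (\<lambda>y. cnj (\<theta> c j l l y)) x)"
    by (simp add: del_1 cnj_form_def trace_form_def form10_def D_z_wirtinger wirtinger_sum[OF c open_UNIV x UNIV_I th])
  \<comment> \<open>The sign is that of \<open>delbar\<close> on (1,0)-forms; it turns the sum of
    the two traces in the curvature into the difference of the Ricci formula.\<close>
  have delbar: "delbar (trace_form \<theta>) c [i] [j] x = - (\<Sum>k\<in>UNIV. D_zbar c j (\<theta> c i k k) x)"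
    by (simp add: delbar_1 trace_form_def form10_def D_zbar_wirtinger
        wirtinger_sum[OF c open_UNIV x UNIV_I chart_smooth_theta[OF c]])
  show ?thesis
    unfolding hat_ricci_def form11_def list.sel curvature_hat[OF c cvfield_on_d_z[OF c] cvfield_on_d_zbar[OF c]]
      curvature_11[OF c x] chern_ricci_def del delbar
    by (simp only: distrib_left right_diff_distrib sum.distrib sum_subtractf UV UW Q) (simp add: algebra_simps)
qed

lemma chart_smooth_trace_form: "c \<in> A \<Longrightarrow> chart_smooth_on c UNIV (trace_form \<theta> c [i] [])"
  using pq_form_trace_form unfolding pq_form_10_iff by blast

text \<open>These are the witnesses alpha and beta for the Aeppli coboundary, with the factor -i of
  the Ricci formula absorbed. As alpha is the conjugate of beta, the first claim follows from the
  second.\<close>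

lemma pq_form_imaginary_multiples:
  shows pq_form_i_cnj_trace: "pq_form A 0 1 (\<lambda>c I J x. - \<i> * cnj_form (trace_form \<theta>) c I J x)"
    and pq_form_i_trace: "pq_form A 1 0 (\<lambda>c I J x. \<i> * trace_form \<theta> c I J x)"
proof -
  show "pq_form A 1 0 (\<lambda>c I J x. \<i> * trace_form \<theta> c I J x)"
    unfolding pq_form_10_iff
  proof (intro conjI ballI allI)
    fix c and i :: 'n assume c: "c \<in> A"
    show "chart_smooth_on c UNIV (\<lambda>x. \<i> * trace_form \<theta> c [i] [] x)"
      by (intro chart_smooth_mult chart_smooth_const chart_smooth_trace_form c open_UNIV)
  next
    fix c d x and i :: 'n assume "c \<in> A" "d \<in> A" "x \<in> fst c \<inter> fst d"
    then have "trace_form \<theta> c [i] [] x = (\<Sum>a\<in>UNIV. trace_form \<theta> d [a] [] x * jacobian c d a i x)"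
      using pq_form_trace_form unfolding pq_form_10_iff by blast
    then show "\<i> * trace_form \<theta> c [i] [] x = (\<Sum>a\<in>UNIV. \<i> * trace_form \<theta> d [a] [] x * jacobian c d a i x)"
      by (simp add: sum_distrib_left mult.assoc)
  qed
  from pq_form_cnj_form[OF this]
  show "pq_form A 0 1 (\<lambda>c I J x. - \<i> * cnj_form (trace_form \<theta>) c I J x)"
    unfolding pq_form_01_iff by (simp (no_asm_use) add: cnj_form_def)
qed

lemma hat_ricci_coboundary:
  assumes c: "c \<in> A" and x: "x \<in> fst c"
  shows "hat_ricci A g D c [i] [j] x = chern_ricci g c [i] [j] x
    + (del (\<lambda>c I J x. - \<i> * cnj_form (trace_form \<theta>) c I J x) + delbar (\<lambda>c I J x. \<i> * trace_form \<theta> c I J x)) c [i] [j] x"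
proof -
  have s: "chart_smooth_on c UNIV (\<lambda>y. cnj (trace_form \<theta> c [j] [] y))" for j
    by (intro chart_smooth_cnj c open_UNIV chart_smooth_trace_form)
  show ?thesis
    unfolding hat_ricci_formula[OF c x]
    using wirtinger_cmult[OF c x UNIV_I s, of "- \<i>" i "- \<i>" j]
      wirtinger_cmult[OF c x UNIV_I chart_smooth_trace_form[OF c], of \<i> j \<i> i]
    by (simp add: del_1 delbar_1 cnj_form_def D_z_wirtinger D_zbar_wirtinger algebra_simps)
qed

text \<open>\<open>hat_ricci\<close> uses a different restricted connection in each chart; its
  transformation law is read off from the right-hand side of \<open>hat_ricci_coboundary\<close>, a
  sum of global forms.\<close>

lemma pq_form_hat_ricci: "pq_form A 1 1 (hat_ricci A g D)"
proof -
  have *: "pq_form A 1 1 (chern_ricci g + (del (\<lambda>c I J x. - \<i> * cnj_form (trace_form \<theta>) c I J x)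
      + delbar (\<lambda>c I J x. \<i> * trace_form \<theta> c I J x)))"
    by (intro pq_form_11_add pq_form_chern_ricci pq_form_del pq_form_delbar pq_form_i_cnj_trace pq_form_i_trace)
  show ?thesis
    unfolding pq_form_11_iff
  proof (intro conjI ballI allI)
    fix c and i j :: 'n assume c: "c \<in> A"
    show "chart_smooth_on c UNIV (hat_ricci A g D c [i] [j])"
      by (rule chart_smooth_cong[OF c open_UNIV *[unfolded pq_form_11_iff, THEN conjunct1, rule_format, OF c]])
         (simp add: hat_ricci_coboundary[OF c])
  next
    fix c d x and i j :: 'n assume c: "c \<in> A" and d: "d \<in> A" and x: "x \<in> fst c \<inter> fst d"
    then have xc: "x \<in> fst c" and xd: "x \<in> fst d" by auto
    show "hat_ricci A g D c [i] [j] x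
      = (\<Sum>a\<in>UNIV. \<Sum>b\<in>UNIV. hat_ricci A g D d [a] [b] x * jacobian c d a i x * cnj (jacobian c d b j x))"
      unfolding hat_ricci_coboundary[OF c xc] hat_ricci_coboundary[OF d xd]
      using *[unfolded pq_form_11_iff, THEN conjunct2, rule_format, OF c d x] by simp
  qed
qed

text \<open>Conjugation with transposed indices swaps the two theta terms, while the factor
  \<open>\<i>\<close> supplies the sign.\<close>

lemma real_hat_ricci: "hat_ricci A g D \<in> real_11_forms A"
proof -
  have "cnj (hat_ricci A g D c [j] [i] x) = - hat_ricci A g D c [i] [j] x" if c: "c \<in> A" and x: "x \<in> fst c" for c i j x
  proof -
    have "cnj (chern_ricci g c [j] [i] x) = - chern_ricci g c [i] [j] x"
      using real_chern_ricci c x by (simp add: real_11_forms_iff)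
    then show ?thesis
      by (simp add: hat_ricci_formula[OF c x] del_1 delbar_1 cnj_form_def D_z_wirtinger D_zbar_wirtinger
          wirtinger_cnj[OF c x UNIV_I chart_smooth_trace_form[OF c]] algebra_simps)
  qed
  then show ?thesis using pq_form_hat_ricci by (simp add: real_11_forms_iff)
qed

lemma hat_ricci_cocycle: "hat_ricci A g D \<in> aeppli_cocycles A"
proof -
  have "form_eq A 2 2 (del (delbar (hat_ricci A g D))) 0"
  \<comment> \<open>Local potentials again. The theta part of \<open>q\<close> has the sign opposite
    to beta because \<open>del_delbar_zero\<close> is phrased with \<open>D_zbar\<close>, which is
    minus \<open>delbar\<close> on (1,0)-forms.\<close>
  proof (rule del_delbar_zero[where p = "\<lambda>c j x. - \<i> * cnj (trace_form \<theta> c [j] [] x)"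
        and q = "\<lambda>c i x. - \<i> * (gamma c i x + trace_form \<theta> c [i] [] x)"])
    show "chart_smooth_on c UNIV (\<lambda>x. - \<i> * cnj (trace_form \<theta> c [j] [] x))" if "c \<in> A" for c j
      by (intro chart_smooth_mult chart_smooth_const chart_smooth_cnj chart_smooth_trace_form that open_UNIV)
    show "chart_smooth_on c UNIV (\<lambda>x. - \<i> * (gamma c i x + trace_form \<theta> c [i] [] x))" if "c \<in> A" for c i
      by (intro chart_smooth_mult chart_smooth_const chart_smooth_add chart_smooth_gamma chart_smooth_trace_form
          that open_UNIV)
    fix c i j x assume c: "c \<in> A" and x: "x \<in> fst c"
    note st = chart_smooth_trace_form[OF c] and sg = chart_smooth_gamma[OF c]
    have "wirtinger \<i> c j (\<lambda>x. - \<i> * (gamma c i x + trace_form \<theta> c [i] [] x)) x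
        = - \<i> * (wirtinger \<i> c j (gamma c i) x + wirtinger \<i> c j (trace_form \<theta> c [i] []) x)"
      unfolding wirtinger_cmult[OF c x UNIV_I chart_smooth_add[OF c open_UNIV sg st]]
        wirtinger_add[OF c x UNIV_I sg st] ..
    moreover have "wirtinger (- \<i>) c i (\<lambda>x. - \<i> * cnj (trace_form \<theta> c [j] [] x)) x
        = - \<i> * wirtinger (- \<i>) c i (\<lambda>x. cnj (trace_form \<theta> c [j] [] x)) x"
      by (rule wirtinger_cmult[OF c x UNIV_I chart_smooth_cnj[OF c open_UNIV st]])
    ultimately show "hat_ricci A g D c [i] [j] x = D_z c i (\<lambda>x. - \<i> * cnj (trace_form \<theta> c [j] [] x)) x
        + D_zbar c j (\<lambda>x. - \<i> * (gamma c i x + trace_form \<theta> c [i] [] x)) x"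
      by (simp add: hat_ricci_formula[OF c x] chern_ricci_gamma[OF c x] del_1 delbar_1 cnj_form_def
          D_z_wirtinger D_zbar_wirtinger algebra_simps)
  qed
  then show ?thesis using real_hat_ricci by (simp add: aeppli_cocycles_def)
qed

lemma aeppli_class_hat_ricci: "aeppli_class A (hat_ricci A g D) = aeppli_class A (chern_ricci g)"
proof (rule aeppli_class_eqI[OF hat_ricci_cocycle chern_ricci_cocycle])
  have "hat_ricci A g D - chern_ricci g \<in> real_11_forms A"
    using real_11_forms_add[OF real_hat_ricci real_11_forms_minus[OF real_chern_ricci]] by simp
  moreover have "form_eq A 1 1 (hat_ricci A g D - chern_ricci g)
      (del (\<lambda>c I J x. - \<i> * cnj_form (trace_form \<theta>) c I J x) + delbar (\<lambda>c I J x. \<i> * trace_form \<theta> c I J x))"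
    unfolding form_eq_11_iff by (simp add: hat_ricci_coboundary)
  ultimately show "hat_ricci A g D - chern_ricci g \<in> aeppli_coboundaries A"
    using pq_form_i_cnj_trace pq_form_i_trace unfolding aeppli_coboundaries_def by blast
qed

end

theorem theorem1p6:
  fixes A :: "('m::{t2_space, second_countable_topology}, 'n::finite) chart set"
    and g :: "('m, 'n) metric"
    and \<theta> :: "('m, 'n) tensor12"
    and D :: "('m, 'n) connection"
  assumes "hermitian_manifold A g"
    and "End_valued_10_form A \<theta>"
    and "associated_connection A g \<theta> D"
  shows
    "(\<forall>c\<in>A. \<forall>x\<in>fst c. \<forall>i j k l.
       curvature g (complexify D) (d_z c i) (d_zbar c j) (d_z c k) (d_zbar c l) c x
         = curvature g (hat_connection A (fst c) D) (d_z c i) (d_zbar c j) (d_z c k) (d_zbar c l) c x \<and>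
       curvature g (hat_connection A (fst c) D) (d_z c i) (d_zbar c j) (d_z c k) (d_zbar c l) c x
         = chern_curv g c i j k l x
           - ((\<Sum>p\<in>UNIV. h_lo g c k p x * D_z c i (\<lambda>y. cnj (\<theta> c j l p y)) x)
              + (\<Sum>p\<in>UNIV. h_lo g c p l x * D_zbar c j (\<theta> c i k p) x))
           + ((\<Sum>p\<in>UNIV. \<Sum>q\<in>UNIV. \<theta> c i k p x * cnj (\<theta> c j l q x) * h_lo g c p q x)
              - (\<Sum>m\<in>UNIV. \<Sum>n\<in>UNIV. \<Sum>p\<in>UNIV. \<Sum>q\<in>UNIV.
                   h_up g c m n x * \<theta> c i m p x * cnj (\<theta> c j n q x) * h_lo g c p l x * h_lo g c k q x))) \<and>
     (\<forall>c\<in>A. \<forall>x\<in>fst c. \<forall>i j k l.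
       curvature g (complexify D) (d_z c i) (d_z c j) (d_z c k) (d_zbar c l) c x
         = curvature g (hat_connection A (fst c) D) (d_z c i) (d_z c j) (d_z c k) (d_zbar c l) c x \<and>
       curvature g (hat_connection A (fst c) D) (d_z c i) (d_z c j) (d_z c k) (d_zbar c l) c x
         = (\<Sum>m\<in>UNIV.
             (D_z c i (\<theta> c j k m) x - D_z c j (\<theta> c i k m) x
              + (\<Sum>s\<in>UNIV. chern_Gamma g c j k s x * \<theta> c i s m x)
              - (\<Sum>s\<in>UNIV. chern_Gamma g c j s m x * \<theta> c i k s x)
              + (\<Sum>s\<in>UNIV. chern_Gamma g c i s m x * \<theta> c j k s x)
              - (\<Sum>s\<in>UNIV. chern_Gamma g c i k s x * \<theta> c j s m x)) * h_lo g c m l x)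
           + (\<Sum>m\<in>UNIV.
               (\<Sum>p\<in>UNIV. \<theta> c i p m x * \<theta> c j k p x - \<theta> c i k p x * \<theta> c j p m x) * h_lo g c m l x)) \<and>
     aeppli_class A (hat_ricci A g D) \<in> aeppli_cohomology A \<and>
     aeppli_class A (chern_ricci g) \<in> aeppli_cohomology A \<and>
     aeppli_class A (hat_ricci A g D) = aeppli_class A (chern_ricci g) \<and>
     (\<forall>c\<in>A. \<forall>x\<in>fst c. \<forall>i j.
       hat_ricci A g D c [i] [j] x
         = chern_ricci g c [i] [j] x
           - \<i> * (del (cnj_form (trace_form \<theta>)) c [i] [j] x - delbar (trace_form \<theta>) c [i] [j] x))"
proof -
  interpret theta_connection A g D \<theta>
    using assms
    by unfold_locales (auto simp: hermitian_manifold_def associated_connection_def)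
  have classes: "aeppli_class A (hat_ricci A g D) \<in> aeppli_cohomology A"
    "aeppli_class A (chern_ricci g) \<in> aeppli_cohomology A"
    unfolding aeppli_class_def aeppli_cohomology_def
    by (intro quotientI hat_ricci_cocycle chern_ricci_cocycle)+
  show ?thesis
    by (intro conjI ballI allI classes aeppli_class_hat_ricci hat_ricci_formula)
       (simp_all only: curvature_hat cvfield_on_d_z cvfield_on_d_zbar curvature_11 curvature_20)
qed

end
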